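(* Let $N\in\mathbb{N}$, $N\ge3$, and $\max\{N-4,0\}<\alpha<N$. Let $f\in C(\mathbb{R},\mathbb{R})$ satisfy $$\lim_{t\to0}\frac{f(t)}{|t|^{\frac{\alpha}{N}}}=0,\qquad\lim_{|t|\to\infty}\frac{f(t)}{|t|^{\frac{4+\alpha-N}{N-2}}t}\in[0,\infty)\ \text{(the limit exists)},$$ and put $F(t)=\int_0^tf(s)\,ds$. Let $\{w_n\}$ be a sequence in $H^1(\mathbb{R}^N)$ such that $w_n\rightharpoonup w$ weakly in $H^1(\mathbb{R}^N)$ for some $w\in H^1(\mathbb{R}^N)$ and $w_n(x)\to w(x)$ for almost every $x\in\mathbb{R}^N$. Then there exists a subsequence of $\{w_n\}$ (still denoted $\{w_n\}$) such that $$\int_{\mathbb{R}^N}\left\{(I_\alpha*F(w_n))f(w_n)-(I_\alpha*F(w_n-w))f(w_n-w)-(I_\alpha*F(w))f(w)\right\}\varphi\,dx=o_n(1)\|\varphi\|_{H^1(\mathbb{R}^N)},$$ where $o_n(1)\to0$ as $n\to\infty$ uniformly in $\varphi\in H^1(\mathbb{R}^N)$.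
   Context: $I_\alpha$ is the Riesz potential on $\mathbb{R}^N\setminus\{0\}$: $I_\alpha(x)=\frac{A_\alpha}{|x|^{N-\alpha}}$ with $A_\alpha=\frac{\Gamma((N-\alpha)/2)}{\Gamma(\alpha/2)\pi^{N/2}2^\alpha}$, and $*$ denotes convolution on $\mathbb{R}^N$. "$o_n(1)\to 0$ uniformly in $\varphi$" means: there is a sequence $\varepsilon_n\to0$ independent of $\varphi$ such that the absolute value of the left-hand side is at most $\varepsilon_n\|\varphi\|_{H^1(\mathbb{R}^N)}$ for all $\varphi\in H^1(\mathbb{R}^N)$. *)

theory Defs
  imports "HOL-Analysis.Analysis"
begin

section \<open>The Sobolev space \<open>H\<^sup>1\<close> of real-valued functions on \<open>real ^ 'n\<close>\<close>

definition pderiv_at :: "'n::finite \<Rightarrow> (real ^ 'n \<Rightarrow> real) \<Rightarrow> real ^ 'n \<Rightarrow> real" where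
  "pderiv_at i \<psi> x = frechet_derivative \<psi> (at x) (axis i 1)"

primrec C_diff :: "nat \<Rightarrow> (real ^ 'n::finite \<Rightarrow> real) \<Rightarrow> bool" where
  "C_diff 0 \<psi> \<longleftrightarrow> continuous_on UNIV \<psi>"
| "C_diff (Suc k) \<psi> \<longleftrightarrow> (\<forall>x. \<psi> differentiable (at x)) \<and> (\<forall>i. C_diff k (pderiv_at i \<psi>))"

definition test_function :: "(real ^ 'n::finite \<Rightarrow> real) \<Rightarrow> bool" where
  "test_function \<psi> \<longleftrightarrow> (\<forall>k. C_diff k \<psi>) \<and> compact (closure {x. \<psi> x \<noteq> 0})"

text \<open>Elements of \<open>L\<^sup>2\<close> and \<open>H\<^sup>1\<close> are represented by functions rather than by classes modulo
  almost-everywhere equality. Every notion below is invariant under changes on null sets.\<close>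

definition L2_fun :: "(real ^ 'n::finite \<Rightarrow> real) set" where
  "L2_fun = {u \<in> borel_measurable lebesgue. integrable lebesgue (\<lambda>x. (u x)\<^sup>2)}"

definition is_weak_pderiv ::
    "'n::finite \<Rightarrow> (real ^ 'n \<Rightarrow> real) \<Rightarrow> (real ^ 'n \<Rightarrow> real) \<Rightarrow> bool" where
  "is_weak_pderiv i u g \<longleftrightarrow> (\<forall>\<psi>. test_function \<psi> \<longrightarrow>
     (\<integral>x. u x * pderiv_at i \<psi> x \<partial>lebesgue) = - (\<integral>x. g x * \<psi> x \<partial>lebesgue))"

definition H1 :: "(real ^ 'n::finite \<Rightarrow> real) set" where
  "H1 = {u \<in> L2_fun. \<forall>i. \<exists>g \<in> L2_fun. is_weak_pderiv i u g}"

text \<open>For \<open>u \<in> H1\<close> the weak derivative is unique up to a null set.\<close>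

definition weak_pderiv :: "'n::finite \<Rightarrow> (real ^ 'n \<Rightarrow> real) \<Rightarrow> real ^ 'n \<Rightarrow> real" where
  "weak_pderiv i u = (SOME g. g \<in> L2_fun \<and> is_weak_pderiv i u g)"

definition H1_norm :: "(real ^ 'n::finite \<Rightarrow> real) \<Rightarrow> real" where
  "H1_norm u = sqrt ((\<integral>x. (u x)\<^sup>2 \<partial>lebesgue) + (\<Sum>i\<in>UNIV. \<integral>x. (weak_pderiv i u x)\<^sup>2 \<partial>lebesgue))"

text \<open>Continuous linear functionals on \<open>H\<^sup>1\<close>. The bound forces \<open>l\<close> to agree on functions that
  are equal almost everywhere. Values of \<open>l\<close> outside \<open>H1\<close> are irrelevant.\<close>

definition H1_dual :: "((real ^ 'n::finite \<Rightarrow> real) \<Rightarrow> real) set" where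
  "H1_dual = {l.
     (\<forall>u\<in>H1. \<forall>v\<in>H1. l (\<lambda>x. u x + v x) = l u + l v) \<and>
     (\<forall>c. \<forall>u\<in>H1. l (\<lambda>x. c * u x) = c * l u) \<and>
     (\<exists>C. \<forall>u\<in>H1. \<bar>l u\<bar> \<le> C * H1_norm u)}"

definition H1_weakly_tendsto ::
    "(nat \<Rightarrow> real ^ 'n::finite \<Rightarrow> real) \<Rightarrow> (real ^ 'n \<Rightarrow> real) \<Rightarrow> bool" where
  "H1_weakly_tendsto w w0 \<longleftrightarrow> (\<forall>l\<in>H1_dual. (\<lambda>n. l (w n)) \<longlonglongrightarrow> l w0)"

section \<open>Riesz potential and convolution\<close>

definition riesz_const :: "nat \<Rightarrow> real \<Rightarrow> real" where
  "riesz_const N \<alpha> = Gamma ((real N - \<alpha>) / 2) / (Gamma (\<alpha> / 2) * pi powr (real N / 2) * 2 powr \<alpha>)"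

text \<open>The kernel is only meaningful for \<open>x \<noteq> 0\<close>; at the origin it takes the value 0, which does not
  affect convolutions.\<close>

definition riesz :: "real \<Rightarrow> real ^ 'n::finite \<Rightarrow> real" where
  "riesz \<alpha> x = riesz_const CARD('n) \<alpha> / norm x powr (real CARD('n) - \<alpha>)"

definition convol ::
    "(real ^ 'n::finite \<Rightarrow> real) \<Rightarrow> (real ^ 'n \<Rightarrow> real) \<Rightarrow> real ^ 'n \<Rightarrow> real" where
  "convol g h x = (\<integral>y. g (x - y) * h y \<partial>lebesgue)"

end

theory Submission
  imports Defs
begin

text \<open>Let \<open>N = CARD('n)\<close>, \<open>v\<^sub>n = w\<^sub>n - w\<close> and let \<open>I\<close> be the Riesz kernel. The left-hand side splits as
  \<open>(I * d\<^sub>n) f(w\<^sub>n) + (I * F(v\<^sub>n)) k\<^sub>n + (I * F(w)) k\<^sub>n + (I * F(v\<^sub>n)) f(w) + (I * F(w)) f(v\<^sub>n)\<close>,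
with the splitting errors \<open>d\<^sub>n = F(w\<^sub>n) - F(v\<^sub>n) - F(w)\<close> and \<open>k\<^sub>n = f(w\<^sub>n) - f(v\<^sub>n) - f(w)\<close>, and each of
the five terms tends to zero as a functional on \<open>H1\<close>. Everything is estimated in absolute value.

The exponents are arranged so that all terms are finite. Put \<open>p = 2N/(N + \<alpha>)\<close> and \<open>crit = 2N/(N - 2)\<close>.
The function \<open>f\<close> is bounded by a multiple of \<open>|t|^(\<alpha>/N)\<close> near 0 and of \<open>|t|^((\<alpha> + 2)/(N - 2))\<close> near
infinity, so \<open>F(u)\<close> and \<open>f(u) \<phi>\<close> lie in \<open>L^p\<close> whenever \<open>u\<close> and \<open>\<phi>\<close> lie in \<open>L^2\<close> and in \<open>L^crit\<close>; the inequality of Hardy,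
Littlewood and Sobolev pairs two functions in \<open>L^p\<close> through \<open>I\<close>. Membership in \<open>L^crit\<close> is Sobolev's
inequality, and the sequence \<open>w\<^sub>n\<close> is bounded in \<open>L^2\<close> and \<open>L^crit\<close> because it converges weakly.

The errors \<open>d\<^sub>n\<close> and \<open>k\<^sub>n\<close> are handled as by Brezis and Lieb: for every \<open>\<delta>\<close>, the functions \<open>|d\<^sub>n|^p\<close> and
\<open>|k\<^sub>n|\<close> are at most \<open>\<delta>\<close> times a function of \<open>v\<^sub>n\<close> that stays bounded in the relevant norm plus a fixed
function of \<open>w\<close> for which this norm is finite, and they tend to zero almost everywhere (\<open>F_splitting_vanishing\<close>, \<open>f_splitting_vanishing\<close>). For \<open>k\<^sub>n\<close> this is where the limit of
\<open>f\<close> at infinity enters: up to a lower-order term \<open>f\<close> is a pure power there, so that small relative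
changes of the argument change \<open>f\<close> little compared with its size (\<open>increment_bound\<close>). In the fourth
term \<open>f(w)\<close> may be taken bounded with bounded support; near the singularity of \<open>I\<close> the contribution is uniformly small, and away from it
\<open>I * |F(v\<^sub>n)|\<close> tends to zero pointwise (\<open>vanishing_local_form\<close>). In the fifth term the fixed function
\<open>I * |F(w)|\<close> multiplies a bounded sequence that tends to zero almost everywhere
(\<open>vanishing_fixed_potential_form\<close>).

Two inequalities carry the analysis. The one of Hardy, Littlewood and Sobolev follows from the layer cake
formula and the fact that the potential of a set is largest for a ball (\<open>Hardy_Littlewood_Sobolev\<close>).
Sobolev's inequality is derived from it: a mollified function is an integral of its gradient along rays,
and averaging over the directions of the rays bounds it by the potential of order 1 of its gradient
(\<open>line_bound_imp_riesz_pot_bound\<close>, \<open>Sobolev_inequality\<close>).\<close>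

section \<open>Integrals of the kernel\<close>

lemma nn_integral_powr_tail:
  fixes a \<mu> :: real
  assumes "0 < a" "0 < \<mu>"
  shows "(\<integral>\<^sup>+c. ennreal (\<mu> * c powr (-\<mu> - 1)) * indicator {a..} c \<partial>lborel) = ennreal (a powr (-\<mu>))"
proof -
  have "(\<integral>\<^sup>+c. ennreal (\<mu> * c powr (-\<mu> - 1)) * indicator {a..} c \<partial>lborel) = ennreal (0 - (- (a powr (-\<mu>))))"
  proof (rule nn_integral_FTC_atLeast)
    fix c assume "a \<le> c"
    then have "0 < c" using assms by simp
    then show "((\<lambda>c. - (c powr (-\<mu>))) has_real_derivative \<mu> * c powr (- \<mu> - 1)) (at c)"
      by (auto intro!: derivative_eq_intros simp: powr_diff)
    show "0 \<le> \<mu> * c powr (- \<mu> - 1)" using assms by simp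
  next
    have "((\<lambda>c. c powr (-\<mu>)) \<longlongrightarrow> 0) at_top"
      using assms by (intro tendsto_neg_powr filterlim_ident) auto
    then show "((\<lambda>c. - (c powr (-\<mu>))) \<longlongrightarrow> 0) at_top"
      using tendsto_minus by fastforce
  qed auto
  then show ?thesis by simp
qed

lemma nn_integral_powr_head:
  fixes s \<beta> :: real
  assumes "0 < s" "0 < \<beta>"
  shows "(\<integral>\<^sup>+c. ennreal (c powr (\<beta> - 1)) * indicator {0<..s} c \<partial>lborel) = ennreal (s powr \<beta> / \<beta>)"
proof -
  have "((\<lambda>c. c powr (\<beta> - 1)) has_integral (s powr (\<beta> - 1 + 1) / (\<beta> - 1 + 1))) {0..s}"
    using assms by (intro has_integral_powr_from_0) auto
  moreover have "((\<lambda>c. c powr (\<beta> - 1)) has_integral (s powr \<beta> / \<beta>)) {0..s} \<longleftrightarrow>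
      ((\<lambda>c. c powr (\<beta> - 1)) has_integral (s powr \<beta> / \<beta>)) {0<..s}"
    by (rule has_integral_spike_set_eq) (auto intro: negligible_subset[of "{0}"])
  ultimately have "((\<lambda>c. c powr (\<beta> - 1)) has_integral (s powr \<beta> / \<beta>)) {0<..s}"
    by simp
  then have "((\<lambda>c. indicator {0<..s} c *\<^sub>R c powr (\<beta> - 1)) has_integral (s powr \<beta> / \<beta>)) UNIV"
    by (subst (asm) has_integral_restrict_UNIV[symmetric]) (simp add: indicator_def of_bool_def if_distrib if_distribR cong: if_cong)
  then have "(\<integral>\<^sup>+c. ennreal (indicator {0<..s} c *\<^sub>R c powr (\<beta> - 1)) \<partial>lborel) = ennreal (s powr \<beta> / \<beta>)"
    by (intro nn_integral_has_integral_lborel) auto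
  then show ?thesis
    by (auto simp: indicator_def of_bool_def if_distrib if_distribR mult.commute cong: if_cong)
qed

text \<open>Since \<open>|z|^(-\<mu>)\<close> is the integral of \<open>\<mu> c^(-\<mu> - 1)\<close> over \<open>c \<ge> |z|\<close>, the kernel is a superposition of
indicators of balls, and Tonelli's theorem turns its integral into one over volumes.\<close>

lemma layer_cake_kernel:
  fixes x :: "'a::euclidean_space" and \<mu> :: real
  assumes "0 < \<mu>" and E[measurable]: "E \<in> sets borel"
  shows "(\<integral>\<^sup>+y. ennreal (norm (x - y) powr (-\<mu>)) * indicator E y \<partial>lborel)
     \<le> (\<integral>\<^sup>+c. ennreal (\<mu> * c powr (-\<mu> - 1)) * indicator {0<..} c * emeasure lborel (E \<inter> cball x c) \<partial>lborel)"
proof -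
  let ?k = "\<lambda>c::real. ennreal (\<mu> * c powr (-\<mu> - 1)) * indicator {0<..} c"
  let ?i = "\<lambda>y c. indicator E y * (if dist x y \<le> c then 1 else 0) :: ennreal"
  have "ennreal (norm (x - y) powr (-\<mu>)) * indicator E y \<le> (\<integral>\<^sup>+c. ?k c * ?i y c \<partial>lborel)" for y
  proof (cases "x = y \<or> y \<notin> E")
    case False
    have "ennreal (norm (x - y) powr (-\<mu>)) = (\<integral>\<^sup>+c. ennreal (\<mu> * c powr (-\<mu> - 1)) * indicator {norm (x-y)..} c \<partial>lborel)"
      using False assms by (subst nn_integral_powr_tail) auto
    also have "\<dots> \<le> (\<integral>\<^sup>+c. ?k c * ?i y c \<partial>lborel)"
      using False by (intro nn_integral_mono) (auto simp: indicator_def dist_norm not_less powr_def dest: order_trans)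
    finally show ?thesis using False by simp
  qed auto
  then have "(\<integral>\<^sup>+y. ennreal (norm (x - y) powr (-\<mu>)) * indicator E y \<partial>lborel)
     \<le> (\<integral>\<^sup>+y. (\<integral>\<^sup>+c. ?k c * ?i y c \<partial>lborel) \<partial>lborel)"
    by (intro nn_integral_mono) auto
  also have "\<dots> = (\<integral>\<^sup>+c. (\<integral>\<^sup>+y. ?k c * ?i y c \<partial>lborel) \<partial>lborel)"
    by (rule lborel_pair.Fubini') measurable
  also have "\<dots> = (\<integral>\<^sup>+c. ?k c * emeasure lborel (E \<inter> cball x c) \<partial>lborel)"
  proof (rule nn_integral_cong)
    fix c :: real
    have [measurable]: "E \<inter> cball x c \<in> sets borel" by simp
    have "(\<integral>\<^sup>+y. ?k c * ?i y c \<partial>lborel) = ?k c * (\<integral>\<^sup>+y. indicator (E \<inter> cball x c) y \<partial>lborel)"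
      by (subst nn_integral_cmult[symmetric]) (auto intro!: nn_integral_cong simp: indicator_def)
    then show "(\<integral>\<^sup>+y. ?k c * ?i y c \<partial>lborel) = ?k c * emeasure lborel (E \<inter> cball x c)"
      by simp
  qed
  finally show ?thesis .
qed

text \<open>Among sets of given measure the ball around \<open>x\<close> has the largest potential at \<open>x\<close>. In the layer cake formula
this is the bound of the volume of \<open>E \<inter> cball x c\<close> by the smaller of the volume of the ball and the
measure of \<open>E\<close>.\<close>

lemma kernel_bathtub:
  fixes \<mu> :: real
  assumes "0 < \<mu>" "\<mu> < DIM('a::euclidean_space)"
  obtains C where "0 < C"
    "\<And>(x::'a) E m. E \<in> sets borel \<Longrightarrow> 0 < m \<Longrightarrow> emeasure lborel E \<le> ennreal m \<Longrightarrow>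
      (\<integral>\<^sup>+y. ennreal (norm (x - y) powr (-\<mu>)) * indicator E y \<partial>lborel) \<le> ennreal (C * m powr (1 - \<mu> / DIM('a)))"
proof
  let ?N = "real DIM('a)"
  define \<omega> where "\<omega> = unit_ball_vol (real DIM('a))"
  define C where "C = \<mu> * \<omega> / (?N - \<mu>) + 1"
  have \<omega>: "0 \<le> \<omega>" by (simp add: \<omega>_def unit_ball_vol_nonneg)
  show "0 < C" using assms \<omega> by (auto simp: C_def intro!: add_nonneg_pos)
  fix x :: 'a and E :: "'a set" and m assume [measurable]: "E \<in> sets borel" and m: "0 < (m::real)" "emeasure lborel E \<le> ennreal m"
  \<comment> \<open>The radius of a ball of volume comparable to \<open>m\<close>, where the two bounds of the layers balance.\<close>
  define R where "R = m powr (1 / ?N)"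
  have R: "0 < R" using m by (simp add: R_def)
  let ?k = "\<lambda>c::real. ennreal (\<mu> * c powr (-\<mu> - 1)) * indicator {0<..} c"
  have "(\<integral>\<^sup>+y. ennreal (norm (x - y) powr (-\<mu>)) * indicator E y \<partial>lborel) \<le> (\<integral>\<^sup>+c. ?k c * emeasure lborel (E \<inter> cball x c) \<partial>lborel)"
    by (rule layer_cake_kernel) (use assms in auto)
  also have "\<dots> \<le> (\<integral>\<^sup>+c. ennreal (\<mu> * \<omega>) * (ennreal (c powr ((?N - \<mu>) - 1)) * indicator {0<..R} c)
      + ennreal m * (ennreal (\<mu> * c powr (-\<mu> - 1)) * indicator {R..} c) \<partial>lborel)"
  proof (rule nn_integral_mono)
    fix c :: real
    show "?k c * emeasure lborel (E \<inter> cball x c) \<le> ennreal (\<mu> * \<omega>) * (ennreal (c powr ((?N - \<mu>) - 1)) * indicator {0<..R} c)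
      + ennreal m * (ennreal (\<mu> * c powr (-\<mu> - 1)) * indicator {R..} c)"
    proof (cases "0 < c")
      case True
      show ?thesis
      proof (cases "c \<le> R")
        case cR: True
        have "emeasure lborel (E \<inter> cball x c) \<le> emeasure lborel (cball x c)"
          by (intro emeasure_mono) auto
        also have "\<dots> = ennreal (\<omega> * c powr ?N)"
          using True by (simp add: emeasure_cball \<omega>_def powr_realpow)
        finally have "?k c * emeasure lborel (E \<inter> cball x c) \<le> ennreal (\<mu> * c powr (-\<mu> - 1)) * ennreal (\<omega> * c powr ?N)"
          using True by (auto intro!: mult_left_mono)
        also have "\<dots> = ennreal (\<mu> * \<omega> * (c powr (-\<mu> - 1) * c powr ?N))"
          using assms \<omega> by (subst ennreal_mult[symmetric]) (auto simp: mult_ac)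
        also have "c powr (-\<mu> - 1) * c powr ?N = c powr ((?N - \<mu>) - 1)"
          by (simp add: powr_add[symmetric] algebra_simps)
        also have "ennreal (\<mu> * \<omega> * c powr ((?N - \<mu>) - 1)) = ennreal (\<mu> * \<omega>) * (ennreal (c powr ((?N - \<mu>) - 1)) * indicator {0<..R} c)"
          using assms \<omega> True cR by (subst ennreal_mult) auto
        finally show ?thesis by (simp add: add_increasing2)
      next
        case cR: False
        have "emeasure lborel (E \<inter> cball x c) \<le> emeasure lborel E"
          by (intro emeasure_mono) auto
        also have "\<dots> \<le> ennreal m" by fact
        finally have "?k c * emeasure lborel (E \<inter> cball x c) \<le> ennreal m * (ennreal (\<mu> * c powr (-\<mu> - 1)) * indicator {R..} c)"
          using True cR by (subst mult.commute[of "ennreal m"]) (auto intro!: mult_left_mono)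
        then show ?thesis by (simp add: add_increasing)
      qed
    qed simp
  qed
  also have "\<dots> = ennreal (\<mu> * \<omega>) * ennreal (R powr (?N - \<mu>) / (?N - \<mu>)) + ennreal m * ennreal (R powr (-\<mu>))"
    using assms R by (subst nn_integral_add) (auto simp: nn_integral_cmult nn_integral_powr_head nn_integral_powr_tail)
  also have "\<dots> = ennreal (\<mu> * \<omega> * (R powr (?N - \<mu>) / (?N - \<mu>)) + m * R powr (-\<mu>))"
    using assms \<omega> m by (simp add: ennreal_mult[symmetric])
  also have "R powr (?N - \<mu>) = m powr (1 - \<mu> / ?N)"
    using m by (simp add: R_def powr_powr field_simps)
  also have "m * R powr (-\<mu>) = m powr 1 * m powr (-\<mu> / ?N)"
    using m by (simp add: R_def powr_powr)
  also have "\<dots> = m powr (1 - \<mu> / ?N)" by (simp only: powr_add[symmetric]) simp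
  finally show "(\<integral>\<^sup>+y. ennreal (norm (x - y) powr (-\<mu>)) * indicator E y \<partial>lborel) \<le> ennreal (C * m powr (1 - \<mu> / DIM('a)))"
    by (simp add: C_def algebra_simps)
qed

text \<open>Only balls of radius at least \<open>r\<close> contribute to the layer cake formula.\<close>

lemma kernel_tail_integral:
  fixes x :: "'a::euclidean_space" and \<mu> r :: real
  assumes "DIM('a) < \<mu>" "0 < r"
  shows "(\<integral>\<^sup>+y. ennreal (norm (x - y) powr (-\<mu>)) * indicator {y. r \<le> norm (x - y)} y \<partial>lborel)
     \<le> ennreal (\<mu> * unit_ball_vol DIM('a) / (\<mu> - DIM('a)) * r powr (DIM('a) - \<mu>))"
proof -
  let ?N = "real DIM('a)"
  define \<omega> where "\<omega> = unit_ball_vol ?N"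
  have \<omega>: "0 \<le> \<omega>" by (simp add: \<omega>_def unit_ball_vol_nonneg)
  let ?E = "{y. r \<le> norm (x - y)}"
  let ?k = "\<lambda>c::real. ennreal (\<mu> * c powr (-\<mu> - 1)) * indicator {0<..} c"
  have "(\<integral>\<^sup>+y. ennreal (norm (x - y) powr (-\<mu>)) * indicator ?E y \<partial>lborel) \<le> (\<integral>\<^sup>+c. ?k c * emeasure lborel (?E \<inter> cball x c) \<partial>lborel)"
    by (rule layer_cake_kernel) (use assms in auto)
  also have "\<dots> \<le> (\<integral>\<^sup>+c. ennreal (\<mu> * \<omega> / (\<mu> - ?N)) * (ennreal ((\<mu> - ?N) * c powr (-(\<mu> - ?N) - 1)) * indicator {r..} c) \<partial>lborel)"
  proof (rule nn_integral_mono)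
    fix c :: real
    show "?k c * emeasure lborel (?E \<inter> cball x c) \<le> ennreal (\<mu> * \<omega> / (\<mu> - ?N)) * (ennreal ((\<mu> - ?N) * c powr (-(\<mu> - ?N) - 1)) * indicator {r..} c)"
    proof (cases "r \<le> c")
      case True
      have "emeasure lborel (?E \<inter> cball x c) \<le> emeasure lborel (cball x c)"
        by (intro emeasure_mono) auto
      also have "\<dots> = ennreal (\<omega> * c powr ?N)"
        using True assms by (simp add: emeasure_cball \<omega>_def powr_realpow)
      finally have "?k c * emeasure lborel (?E \<inter> cball x c) \<le> ennreal (\<mu> * c powr (-\<mu> - 1)) * ennreal (\<omega> * c powr ?N)"
        using True assms by (auto intro!: mult_left_mono)
      also have "\<dots> = ennreal (\<mu> * \<omega> * (c powr (-\<mu> - 1) * c powr ?N))"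
        using assms \<omega> by (subst ennreal_mult[symmetric]) (auto simp: mult_ac)
      also have "c powr (-\<mu> - 1) * c powr ?N = c powr (-(\<mu> - ?N) - 1)"
        by (simp add: powr_add[symmetric] algebra_simps)
      also have "ennreal (\<mu> * \<omega> * c powr (-(\<mu> - ?N) - 1)) = ennreal (\<mu> * \<omega> / (\<mu> - ?N)) * (ennreal ((\<mu> - ?N) * c powr (-(\<mu> - ?N) - 1)) * indicator {r..} c)"
        using assms \<omega> True by (simp add: ennreal_mult[symmetric])
      finally show ?thesis .
    next
      case False
      then have "?E \<inter> cball x c = {}" by (auto simp: dist_norm)
      then show ?thesis by (metis emeasure_empty mult_zero_right zero_le)
    qed
  qed
  also have "\<dots> = ennreal (\<mu> * \<omega> / (\<mu> - ?N)) * ennreal (r powr (-(\<mu> - ?N)))"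
    using assms by (subst nn_integral_cmult, simp, subst nn_integral_powr_tail) auto
  also have "\<dots> = ennreal (\<mu> * \<omega> / (\<mu> - ?N) * r powr (?N - \<mu>))"
    using assms \<omega> by (simp add: ennreal_mult[symmetric])
  finally show ?thesis by (simp add: \<omega>_def)
qed

section \<open>Bounds of Lebesgue norms\<close>

text \<open>The \<open>L^p\<close> norm of \<open>g\<close> is at most \<open>a\<close>. Stating norm bounds with real numbers avoids roots of extended
nonnegative reals and questions of finiteness.\<close>

definition lp_le :: "real \<Rightarrow> real \<Rightarrow> ('a::euclidean_space \<Rightarrow> real) \<Rightarrow> bool" where
  "lp_le p a g \<longleftrightarrow> g \<in> borel_measurable borel \<and> 0 \<le> a \<and>
     (\<integral>\<^sup>+x. ennreal (\<bar>g x\<bar> powr p) \<partial>lborel) \<le> ennreal (a powr p)"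

lemma lp_leD:
  assumes "lp_le p a g"
  shows "g \<in> borel_measurable borel" "0 \<le> a" "(\<integral>\<^sup>+x. ennreal (\<bar>g x\<bar> powr p) \<partial>lborel) \<le> ennreal (a powr p)"
  using assms by (auto simp: lp_le_def)

lemma lp_le_mono:
  assumes "lp_le p a g" "h \<in> borel_measurable borel" "\<And>x. \<bar>h x\<bar> \<le> \<bar>g x\<bar>" "0 < p" "a \<le> b"
  shows "lp_le p b h"
proof -
  have "(\<integral>\<^sup>+x. ennreal (\<bar>h x\<bar> powr p) \<partial>lborel) \<le> (\<integral>\<^sup>+x. ennreal (\<bar>g x\<bar> powr p) \<partial>lborel)"
    using assms by (intro nn_integral_mono ennreal_leI powr_mono2) auto
  also have "\<dots> \<le> ennreal (a powr p)" using assms by (simp add: lp_le_def)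
  also have "\<dots> \<le> ennreal (b powr p)" using assms by (intro ennreal_leI powr_mono2) (auto simp: lp_le_def)
  finally show ?thesis using assms by (auto simp: lp_le_def)
qed

lemma lp_le_AE_zero:
  assumes "lp_le p 0 g"
  shows "AE x in lborel. g x = 0"
proof -
  note [measurable] = lp_leD(1)[OF assms]
  have "(\<integral>\<^sup>+x. ennreal (\<bar>g x\<bar> powr p) \<partial>lborel) = 0"
    using lp_leD(3)[OF assms] by simp
  then have "AE x in lborel. ennreal (\<bar>g x\<bar> powr p) = 0"
    by (subst (asm) nn_integral_0_iff_AE) auto
  then show ?thesis by eventually_elim (auto simp: ennreal_eq_0_iff)
qed

lemma lp_le_cmult:
  assumes "lp_le p a g" "0 < p"
  shows "lp_le p (\<bar>c\<bar> * a) (\<lambda>x. c * g x)"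
proof -
  note [measurable] = lp_leD(1)[OF assms(1)]
  have "(\<integral>\<^sup>+x. ennreal (\<bar>c * g x\<bar> powr p) \<partial>lborel) = ennreal (\<bar>c\<bar> powr p) * (\<integral>\<^sup>+x. ennreal (\<bar>g x\<bar> powr p) \<partial>lborel)"
    by (subst nn_integral_cmult[symmetric]) (auto simp: abs_mult powr_mult ennreal_mult)
  also have "\<dots> \<le> ennreal (\<bar>c\<bar> powr p) * ennreal (a powr p)"
    by (intro mult_left_mono lp_leD[OF assms(1)]) auto
  also have "\<dots> = ennreal ((\<bar>c\<bar> * a) powr p)"
    using lp_leD(2)[OF assms(1)] by (simp add: powr_mult ennreal_mult)
  finally show ?thesis using lp_leD(1,2)[OF assms(1)] by (auto simp: lp_le_def)
qed

text \<open>Minkowski's inequality up to the factor 2, from the elementary \<open>|s + t|^p \<le> 2^p (|s|^p + |t|^p)\<close>.\<close>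

lemma lp_le_add:
  assumes "lp_le p a g" "lp_le p b h" "1 \<le> p"
  shows "lp_le p (2 * (a + b)) (\<lambda>x. g x + h x)"
proof -
  note [measurable] = lp_leD(1)[OF assms(1)] lp_leD(1)[OF assms(2)]
  have ab: "0 \<le> a" "0 \<le> b" using assms by (auto simp: lp_le_def)
  have "(\<integral>\<^sup>+x. ennreal (\<bar>g x + h x\<bar> powr p) \<partial>lborel)
      \<le> (\<integral>\<^sup>+x. ennreal (2 powr p) * (ennreal (\<bar>g x\<bar> powr p) + ennreal (\<bar>h x\<bar> powr p)) \<partial>lborel)"
  proof (rule nn_integral_mono)
    fix x
    have "\<bar>g x + h x\<bar> powr p \<le> (2 * max \<bar>g x\<bar> \<bar>h x\<bar>) powr p"
      using assms by (intro powr_mono2) auto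
    also have "\<dots> = 2 powr p * max \<bar>g x\<bar> \<bar>h x\<bar> powr p" by (simp add: powr_mult)
    also have "\<dots> \<le> 2 powr p * (\<bar>g x\<bar> powr p + \<bar>h x\<bar> powr p)"
      by (intro mult_left_mono) (auto simp: max_def)
    finally show "ennreal (\<bar>g x + h x\<bar> powr p) \<le> ennreal (2 powr p) * (ennreal (\<bar>g x\<bar> powr p) + ennreal (\<bar>h x\<bar> powr p))"
      by (simp add: ennreal_mult[symmetric] ennreal_plus[symmetric] del: ennreal_plus)
  qed
  also have "\<dots> = ennreal (2 powr p) * ((\<integral>\<^sup>+x. ennreal (\<bar>g x\<bar> powr p) \<partial>lborel) + (\<integral>\<^sup>+x. ennreal (\<bar>h x\<bar> powr p) \<partial>lborel))"
    by (subst nn_integral_cmult) (auto simp: nn_integral_add)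
  also have "\<dots> \<le> ennreal (2 powr p) * (ennreal (a powr p) + ennreal (b powr p))"
    by (intro mult_left_mono add_mono lp_leD[OF assms(1)] lp_leD[OF assms(2)]) auto
  also have "\<dots> \<le> ennreal (2 powr p) * ennreal ((a + b) powr p)"
  proof -
    have "a powr p + b powr p \<le> (a + b) powr p"
    proof (cases "a = 0 \<or> b = 0")
      case False
      then have pos: "0 < a" "0 < b" using ab by auto
      have e: "c powr p = c * c powr (p - 1)" if "0 < c" for c
        using that powr_add[of c 1 "p - 1"] by (simp only: add_diff_cancel_left' diff_add_cancel add.commute[of 1]) simp
      have "a powr p + b powr p \<le> a * (a + b) powr (p - 1) + b * (a + b) powr (p - 1)"
        unfolding e[OF pos(1)] e[OF pos(2)] using pos assms by (intro add_mono mult_left_mono powr_mono2) auto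
      also have "\<dots> = (a + b) powr p" using pos by (simp add: e algebra_simps)
      finally show ?thesis .
    qed (use assms in auto)
    then show ?thesis by (intro mult_left_mono) (auto simp: ennreal_plus[symmetric] simp del: ennreal_plus)
  qed
  also have "\<dots> = ennreal ((2 * (a + b)) powr p)" using ab by (simp only: powr_mult[of 2 "a + b"]) (subst ennreal_mult, auto)
  finally show ?thesis using ab by (auto simp: lp_le_def)
qed

lemma weighted_power_mean:
  fixes x y \<theta> :: real
  assumes "0 \<le> x" "0 \<le> y" "0 < \<theta>" "\<theta> < 1"
  shows "x powr \<theta> * y powr (1 - \<theta>) \<le> \<theta> * x + (1 - \<theta>) * y"
proof (cases "x = 0 \<or> y = 0")
  case False
  then show ?thesis using assms by (intro Youngs_inequality_0) auto
qed (use assms in auto)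

text \<open>Hoelder's inequality for products. After normalisation it is Young's inequality, integrated.\<close>

lemma lp_le_mult:
  assumes g: "lp_le p a g" and h: "lp_le q b h" and "0 < p" "0 < q" "1 / r = 1 / p + 1 / q"
  shows "lp_le r (a * b) (\<lambda>x. g x * h x)"
proof -
  note [measurable] = lp_leD(1)[OF g] lp_leD(1)[OF h]
  have "0 < 1 / r" unfolding assms(5) using assms(3,4) by (intro add_pos_pos) auto
  then have r: "0 < r" by simp
  have ab: "0 \<le> a" "0 \<le> b" using assms by (auto simp: lp_le_def)
  have "(\<integral>\<^sup>+x. ennreal (\<bar>g x * h x\<bar> powr r) \<partial>lborel) \<le> ennreal ((a * b) powr r)"
  proof (cases "a = 0 \<or> b = 0")
    case True
    have "AE x in lborel. g x * h x = 0"
      using True lp_le_AE_zero[of p g] lp_le_AE_zero[of q h] g h by auto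
    then have "(\<integral>\<^sup>+x. ennreal (\<bar>g x * h x\<bar> powr r) \<partial>lborel) = 0"
      by (subst nn_integral_0_iff_AE) auto
    then show ?thesis by simp
  next
    case False
    then have pos: "0 < a" "0 < b" using ab by auto
    define \<theta> where "\<theta> = r / p"
    have \<theta>: "0 < \<theta>" "r / q = 1 - \<theta>" using assms r by (auto simp: \<theta>_def field_simps)
    have \<theta>1: "\<theta> < 1" using \<theta> assms r divide_pos_pos[of r q] by linarith
    have "(\<integral>\<^sup>+x. ennreal (\<bar>g x * h x\<bar> powr r) \<partial>lborel)
        \<le> (\<integral>\<^sup>+x. ennreal ((a*b) powr r * \<theta> / a powr p) * ennreal (\<bar>g x\<bar> powr p)
             + ennreal ((a*b) powr r * (1 - \<theta>) / b powr q) * ennreal (\<bar>h x\<bar> powr q) \<partial>lborel)"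
    proof (rule nn_integral_mono)
      fix x
      have "(\<bar>g x\<bar> powr p / a powr p) powr \<theta> * (\<bar>h x\<bar> powr q / b powr q) powr (1 - \<theta>)
          = \<bar>g x\<bar> powr r / a powr r * (\<bar>h x\<bar> powr r / b powr r)"
        using \<theta>(2)[symmetric] assms pos by (simp add: powr_divide powr_powr \<theta>_def)
      also have "\<dots> = \<bar>g x * h x\<bar> powr r / (a * b) powr r"
        using pos by (simp add: abs_mult powr_mult)
      finally have "\<bar>g x * h x\<bar> powr r = (a * b) powr r * ((\<bar>g x\<bar> powr p / a powr p) powr \<theta> * (\<bar>h x\<bar> powr q / b powr q) powr (1 - \<theta>))"
        using pos by simp
      also have "\<dots> \<le> (a * b) powr r * (\<theta> * (\<bar>g x\<bar> powr p / a powr p) + (1 - \<theta>) * (\<bar>h x\<bar> powr q / b powr q))"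
        using \<theta> \<theta>1 by (intro mult_left_mono weighted_power_mean) auto
      finally show "ennreal (\<bar>g x * h x\<bar> powr r) \<le> ennreal ((a*b) powr r * \<theta> / a powr p) * ennreal (\<bar>g x\<bar> powr p)
             + ennreal ((a*b) powr r * (1 - \<theta>) / b powr q) * ennreal (\<bar>h x\<bar> powr q)"
        using \<theta>(1) \<theta>1 by (simp add: ennreal_mult[symmetric] ennreal_plus[symmetric] distrib_left mult_ac ennreal_leI del: ennreal_plus)
    qed
    also have "\<dots> = ennreal ((a*b) powr r * \<theta> / a powr p) * (\<integral>\<^sup>+x. ennreal (\<bar>g x\<bar> powr p) \<partial>lborel)
             + ennreal ((a*b) powr r * (1 - \<theta>) / b powr q) * (\<integral>\<^sup>+x. ennreal (\<bar>h x\<bar> powr q) \<partial>lborel)"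
      by (subst nn_integral_add) (auto simp: nn_integral_cmult)
    also have "\<dots> \<le> ennreal ((a*b) powr r * \<theta> / a powr p) * ennreal (a powr p)
             + ennreal ((a*b) powr r * (1 - \<theta>) / b powr q) * ennreal (b powr q)"
      by (intro add_mono mult_left_mono lp_leD[OF g] lp_leD[OF h]) auto
    also have "\<dots> = ennreal ((a*b) powr r)"
      using \<theta>(1) \<theta>1 pos
      by (simp add: ennreal_mult[symmetric] ennreal_plus[symmetric] distrib_left[symmetric] del: ennreal_plus)
    finally show ?thesis .
  qed
  then show ?thesis using ab by (auto simp: lp_le_def)
qed

lemma lp_le_pairing:
  assumes "lp_le p a g" "lp_le q b h" "0 < p" "0 < q" "1 / p + 1 / q = 1"
  shows "(\<integral>\<^sup>+x. ennreal \<bar>g x * h x\<bar> \<partial>lborel) \<le> ennreal (a * b)"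
proof -
  have "lp_le 1 (a * b) (\<lambda>x. g x * h x)" using assms by (intro lp_le_mult[of p a g q b h]) auto
  from lp_leD(2,3)[OF this] show ?thesis by simp
qed

lemma lp_le_powr:
  assumes "lp_le p a g" "0 < s" "0 < p"
  shows "lp_le (p / s) (a powr s) (\<lambda>x. \<bar>g x\<bar> powr s)"
  using assms by (auto simp: lp_le_def powr_powr)

text \<open>Converse of Hoelder's inequality: testing \<open>U\<close> with the power \<open>q - 1\<close> of a truncation of itself gives
\<open>I \<le> A I^(1/r)\<close> for the \<open>q\<close>-th power integral \<open>I\<close> of the truncation, which can be divided because the
truncation makes \<open>I\<close> finite.\<close>

lemma lp_le_dual:
  fixes U :: "'a::euclidean_space \<Rightarrow> ennreal"
  assumes [measurable]: "U \<in> borel_measurable borel" and "1 < q" "1 / q + 1 / r = 1" "0 \<le> A"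
    and dual: "\<And>h b. lp_le r b h \<Longrightarrow> (\<integral>\<^sup>+x. U x * ennreal \<bar>h x\<bar> \<partial>lborel) \<le> ennreal (A * b)"
  shows "AE x in lborel. U x < \<infinity>" "lp_le q A (\<lambda>x. enn2real (U x))"
proof -
  have "inverse r = inverse (q / (q - 1))" using assms by (simp add: field_simps)
  then have r: "r = q / (q - 1)" by (simp only: inverse_eq_iff_eq)
  have r0: "0 < r" using assms by (simp add: r)
  \<comment> \<open>Truncation in height and in space; the sequence increases to \<open>U\<close>, also where \<open>U\<close> is infinite.\<close>
  define V where "V n x = enn2real (min (U x) (of_nat n)) * indicator (ball 0 (real n)) x" for n :: nat and x
  have [measurable]: "ball 0 (real n) \<in> sets (borel :: 'a measure)" for n by simp
  have [measurable]: "V n \<in> borel_measurable borel" for n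
    unfolding V_def by (intro borel_measurable_times borel_measurable_indicator) measurable
  have V0: "0 \<le> V n x" for n x by (simp add: V_def)
  have Vn: "V n x \<le> real n * indicator (ball 0 (real n)) x" for n x
    unfolding V_def by (intro mult_right_mono) (auto simp: enn2real_leI ennreal_of_nat_eq_real_of_nat)
  have VU: "ennreal (V n x) \<le> U x" for n x
    by (auto simp: V_def indicator_def ennreal_enn2real_if min_def ennreal_of_nat_eq_real_of_nat[symmetric] not_le)
  have bound: "(\<integral>\<^sup>+x. ennreal (V n x powr q) \<partial>lborel) \<le> ennreal (A powr q)" for n
  proof -
    have "(\<integral>\<^sup>+x. ennreal (V n x powr q) \<partial>lborel) \<le> (\<integral>\<^sup>+(x::'a). ennreal (real n powr q) * indicator (ball 0 (real n)) x \<partial>lborel)"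
    proof (intro nn_integral_mono)
      fix x
      show "ennreal (V n x powr q) \<le> ennreal (real n powr q) * indicator (ball 0 (real n)) x"
        using powr_mono2[OF _ V0 Vn, of q n x] assms by (auto simp: indicator_def)
    qed
    also have "\<dots> < \<infinity>"
      using emeasure_lborel_ball_finite[of "0::'a" "real n"]
      by (subst nn_integral_cmult) (auto simp: ennreal_mult_less_top)
    finally obtain I where I: "0 \<le> I" "(\<integral>\<^sup>+x. ennreal (V n x powr q) \<partial>lborel) = ennreal I"
      by (metis ennreal_cases infinity_ennreal_def less_irrefl)
    have "lp_le r (I powr (1 / r)) (\<lambda>x. V n x powr (q - 1))"
      using I r0 r assms V0 by (auto simp: lp_le_def powr_powr)
    from dual[OF this] have "(\<integral>\<^sup>+x. U x * ennreal \<bar>V n x powr (q - 1)\<bar> \<partial>lborel) \<le> ennreal (A * I powr (1 / r))" .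
    moreover have "(\<integral>\<^sup>+x. ennreal (V n x powr q) \<partial>lborel) \<le> (\<integral>\<^sup>+x. U x * ennreal \<bar>V n x powr (q - 1)\<bar> \<partial>lborel)"
    proof (rule nn_integral_mono)
      fix x
      have "V n x powr q = V n x * V n x powr (q - 1)"
        using V0[of n x] powr_add[of "V n x" 1 "q - 1"] by (cases "V n x = 0") auto
      then show "ennreal (V n x powr q) \<le> U x * ennreal \<bar>V n x powr (q - 1)\<bar>"
        using V0[of n x] by (auto simp: ennreal_mult intro!: mult_right_mono VU)
    qed
    ultimately have "ennreal I \<le> ennreal (A * I powr (1 / r))"
      unfolding I(2) by (rule order_trans[rotated])
    then have le: "I \<le> A * I powr (1 / r)" using assms(4) by (simp add: ennreal_le_iff)
    have "I \<le> A powr q"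
    proof (cases "I = 0")
      case False
      then have "0 < I" using I by simp
      have "I powr (1 / q) * I powr (1 / r) = I" using assms \<open>0 < I\<close> by (simp add: powr_add[symmetric])
      then have "I powr (1 / q) * I powr (1 / r) \<le> A * I powr (1 / r)" using le by simp
      then have "I powr (1 / q) \<le> A" using \<open>0 < I\<close> by (simp add: mult_le_cancel_right)
      then have "(I powr (1 / q)) powr q \<le> A powr q" using assms by (intro powr_mono2) auto
      then show ?thesis using \<open>0 < I\<close> assms by (simp add: powr_powr)
    qed simp
    then show ?thesis using I by (simp add: ennreal_leI)
  qed
  have Vinc: "V m x \<le> V n x" if "m \<le> n" for m n x
  proof -
    have "min (U x) (of_nat m) \<le> min (U x) (of_nat n)" using that by (intro min.mono) auto
    then have "enn2real (min (U x) (of_nat m)) \<le> enn2real (min (U x) (of_nat n))"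
      by (intro enn2real_mono) (auto simp: min_less_iff_disj ennreal_of_nat_eq_real_of_nat)
    moreover have "ball 0 (real m) \<subseteq> (ball 0 (real n) :: 'a set)" using that by auto
    ultimately show ?thesis unfolding V_def by (intro mult_mono) (auto simp: indicator_def)
  qed
  have inc: "incseq (\<lambda>n x. ennreal (V n x powr q))"
    using V0 Vinc assms by (auto simp: incseq_def le_fun_def intro!: ennreal_leI powr_mono2)
  have "(\<integral>\<^sup>+x. (SUP n. ennreal (V n x powr q)) \<partial>lborel) = (SUP n. \<integral>\<^sup>+x. ennreal (V n x powr q) \<partial>lborel)"
    by (rule nn_integral_monotone_convergence_SUP[OF inc]) auto
  also have "\<dots> \<le> ennreal (A powr q)" using bound by (auto intro: SUP_least)
  finally have S: "(\<integral>\<^sup>+x. (SUP n. ennreal (V n x powr q)) \<partial>lborel) \<le> ennreal (A powr q)" .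
  then have "AE x in lborel. (SUP n. ennreal (V n x powr q)) \<noteq> \<infinity>"
    by (intro nn_integral_PInf_AE) (auto simp: top_unique)
  then show AE: "AE x in lborel. U x < \<infinity>"
  proof eventually_elim
    fix x assume fin: "(SUP n. ennreal (V n x powr q)) \<noteq> \<infinity>"
    show "U x < \<infinity>"
    proof (rule ccontr)
      assume "\<not> U x < \<infinity>"
      then have "U x = top" using less_top[of "U x"] by auto
      obtain M where M: "(SUP n. ennreal (V n x powr q)) = ennreal M" "0 \<le> M"
        using fin by (metis ennreal_cases infinity_ennreal_def)
      obtain n :: nat where n: "norm x < n" "M < n" "1 < n" using reals_Archimedean2[of "max (norm x) (max M 1)"] by auto
      have "V n x = n" using n \<open>U x = top\<close> by (simp add: V_def)
      moreover have "real n powr 1 \<le> real n powr q" using assms n by (intro powr_mono) auto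
      ultimately have "M < V n x powr q" using n by simp
      moreover have "ennreal (V n x powr q) \<le> ennreal M" unfolding M(1)[symmetric] by (rule SUP_upper) simp
      ultimately show False using M by (simp add: ennreal_le_iff)
    qed
  qed
  have "(\<integral>\<^sup>+x. ennreal (\<bar>enn2real (U x)\<bar> powr q) \<partial>lborel) \<le> (\<integral>\<^sup>+x. (SUP n. ennreal (V n x powr q)) \<partial>lborel)"
  proof (rule nn_integral_mono_AE, use AE in eventually_elim)
    fix x assume "U x < \<infinity>"
    then obtain M where M: "U x = ennreal M" "0 \<le> M" by (metis ennreal_cases infinity_ennreal_def less_irrefl)
    obtain n :: nat where n: "norm x < n" "M < n" using reals_Archimedean2[of "max (norm x) M"] by auto
    have "min (U x) (of_nat n) = U x" using M n by (auto simp: min_def ennreal_of_nat_eq_real_of_nat)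
    then have "V n x = enn2real (U x)" using n by (simp add: V_def)
    then show "ennreal (\<bar>enn2real (U x)\<bar> powr q) \<le> (SUP n. ennreal (V n x powr q))"
      by (intro SUP_upper2[of n]) auto
  qed
  with S show "lp_le q A (\<lambda>x. enn2real (U x))" using assms by (auto simp: lp_le_def)
qed

section \<open>The inequality of Hardy, Littlewood and Sobolev\<close>

text \<open>Potential of \<open>|g|\<close> with the kernel of order \<open>DIM('a) - \<mu>\<close>, without the normalising constant. It is
extended-real valued, so that no integrability has to be known in advance.\<close>

definition riesz_pot :: "real \<Rightarrow> ('a::euclidean_space \<Rightarrow> real) \<Rightarrow> 'a \<Rightarrow> ennreal" where
  "riesz_pot \<mu> g x = (\<integral>\<^sup>+y. ennreal (norm (x - y) powr (-\<mu>) * \<bar>g y\<bar>) \<partial>lborel)"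

lemma riesz_pot_measurable [measurable]:
  assumes [measurable]: "g \<in> borel_measurable borel"
  shows "riesz_pot \<mu> g \<in> borel_measurable borel"
  unfolding riesz_pot_def by measurable

text \<open>The heart of the inequality of Hardy, Littlewood and Sobolev. Writing \<open>min |h| s\<close> as the integral of
the indicators of the level sets \<open>{t \<le> |h|}\<close> over \<open>0 < t \<le> s\<close>, each level set has measure at most
\<open>t^(-r)\<close> by Chebyshev's inequality, hence a potential bounded by a power of \<open>t\<close> that is integrable at 0.\<close>

lemma truncated_potential_le:
  fixes \<mu> r :: real
  assumes "0 < \<mu>" "\<mu> < DIM('a::euclidean_space)" "0 < r" "r * (1 - \<mu> / DIM('a)) < 1"
  obtains C where "0 < C"
    "\<And>h s x. lp_le r 1 h \<Longrightarrow> 0 < s \<Longrightarrow>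
      (\<integral>\<^sup>+(y::'a). ennreal (min \<bar>h y\<bar> s * norm (x - y) powr (-\<mu>)) \<partial>lborel) \<le> ennreal (C * s powr (1 - r * (1 - \<mu> / DIM('a))))"
proof -
  define \<kappa> where "\<kappa> = 1 - \<mu> / DIM('a)"
  define \<beta> where "\<beta> = 1 - r * \<kappa>"
  have \<beta>: "0 < \<beta>" using assms by (simp add: \<beta>_def \<kappa>_def)
  obtain C where C: "0 < C"
    "\<And>(x::'a) E m. E \<in> sets borel \<Longrightarrow> 0 < m \<Longrightarrow> emeasure lborel E \<le> ennreal m \<Longrightarrow>
      (\<integral>\<^sup>+y. ennreal (norm (x - y) powr (-\<mu>)) * indicator E y \<partial>lborel) \<le> ennreal (C * m powr \<kappa>)"
    unfolding \<kappa>_def by (rule kernel_bathtub[OF assms(1,2)]) blast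
  show ?thesis
  proof (rule that[of "C / \<beta>"])
    show "0 < C / \<beta>" using C \<beta> by simp
    fix h :: "'a \<Rightarrow> real" and s :: real and x :: 'a assume h: "lp_le r 1 h" and s: "0 < s"
    note [measurable] = lp_leD(1)[OF h]
    let ?i = "\<lambda>t y. indicator {0<..s} t * (if t \<le> \<bar>h y\<bar> then 1 else 0) :: ennreal"
    \<comment> \<open>The interval \<open>{0<..min |h y| s}\<close> has length \<open>min |h y| s\<close>.\<close>
    have "(\<integral>\<^sup>+y. ennreal (min \<bar>h y\<bar> s * norm (x - y) powr (-\<mu>)) \<partial>lborel)
        = (\<integral>\<^sup>+y. (\<integral>\<^sup>+t. ?i t y * ennreal (norm (x - y) powr (-\<mu>)) \<partial>lborel) \<partial>lborel)"
    proof (rule nn_integral_cong)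
      fix y
      have "(\<integral>\<^sup>+t. ?i t y * ennreal (norm (x - y) powr (-\<mu>)) \<partial>lborel)
         = (\<integral>\<^sup>+t. ennreal (norm (x - y) powr (-\<mu>)) * indicator {0<..min \<bar>h y\<bar> s} t \<partial>lborel)"
        by (intro nn_integral_cong) (auto simp: indicator_def)
      also have "\<dots> = ennreal (norm (x - y) powr (-\<mu>)) * ennreal (min \<bar>h y\<bar> s)"
        using s by (subst nn_integral_cmult) auto
      finally show "ennreal (min \<bar>h y\<bar> s * norm (x - y) powr (-\<mu>)) = (\<integral>\<^sup>+t. ?i t y * ennreal (norm (x - y) powr (-\<mu>)) \<partial>lborel)"
        using s by (simp add: ennreal_mult[symmetric] mult.commute)
    qed
    also have "\<dots> = (\<integral>\<^sup>+t. (\<integral>\<^sup>+y. ?i t y * ennreal (norm (x - y) powr (-\<mu>)) \<partial>lborel) \<partial>lborel)"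
      by (rule lborel_pair.Fubini') measurable
    also have "\<dots> \<le> (\<integral>\<^sup>+t. ennreal C * (ennreal (t powr (\<beta> - 1)) * indicator {0<..s} t) \<partial>lborel)"
    proof (rule nn_integral_mono)
      fix t :: real
      show "(\<integral>\<^sup>+y. ?i t y * ennreal (norm (x - y) powr (-\<mu>)) \<partial>lborel) \<le> ennreal C * (ennreal (t powr (\<beta> - 1)) * indicator {0<..s} t)"
      proof (cases "t \<in> {0<..s}")
        case True
        let ?E = "{y. t \<le> \<bar>h y\<bar>}"
        have "emeasure lborel ?E \<le> ennreal (t powr (-r)) * (\<integral>\<^sup>+y. ennreal (\<bar>h y\<bar> powr r) * indicator UNIV y \<partial>lborel)"
        proof -
          have "?E \<subseteq> {y \<in> UNIV. 1 \<le> ennreal (t powr (-r)) * ennreal (\<bar>h y\<bar> powr r)}"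
          proof (rule subsetI)
            fix y assume "y \<in> ?E"
            then have "t \<le> \<bar>h y\<bar>" by simp
            then have "t powr r \<le> \<bar>h y\<bar> powr r" using True assms by (intro powr_mono2) auto
            then have "1 \<le> t powr (-r) * \<bar>h y\<bar> powr r" using True by (simp add: powr_minus field_simps)
            then show "y \<in> {y \<in> UNIV. 1 \<le> ennreal (t powr (-r)) * ennreal (\<bar>h y\<bar> powr r)}"
              by (simp add: ennreal_mult[symmetric])
          qed
          then have "emeasure lborel ?E \<le> emeasure lborel {y \<in> UNIV. 1 \<le> ennreal (t powr (-r)) * ennreal (\<bar>h y\<bar> powr r)}"
            by (intro emeasure_mono) auto
          also have "\<dots> \<le> ennreal (t powr (-r)) * (\<integral>\<^sup>+y. ennreal (\<bar>h y\<bar> powr r) * indicator UNIV y \<partial>lborel)"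
            by (intro nn_integral_Markov_inequality) auto
          finally show ?thesis .
        qed
        also have "\<dots> \<le> ennreal (t powr (-r)) * 1"
          using lp_leD(3)[OF h] by (intro mult_left_mono) auto
        finally have E: "emeasure lborel ?E \<le> ennreal (t powr (-r))" by simp
        have "(\<integral>\<^sup>+y. ?i t y * ennreal (norm (x - y) powr (-\<mu>)) \<partial>lborel) = (\<integral>\<^sup>+y. ennreal (norm (x - y) powr (-\<mu>)) * indicator ?E y \<partial>lborel)"
          using True by (intro nn_integral_cong) (auto simp: indicator_def)
        also have "\<dots> \<le> ennreal (C * (t powr (-r)) powr \<kappa>)"
          using True E by (intro C(2)) auto
        also have "(t powr (-r)) powr \<kappa> = t powr (\<beta> - 1)"
          by (simp add: powr_powr \<beta>_def)
        finally show ?thesis using True C by (simp add: ennreal_mult)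
      qed simp
    qed
    also have "\<dots> = ennreal C * ennreal (s powr \<beta> / \<beta>)"
      using s \<beta> by (subst nn_integral_cmult) (auto simp: nn_integral_powr_head)
    also have "\<dots> = ennreal (C / \<beta> * s powr \<beta>)" using C \<beta> by (simp add: ennreal_mult[symmetric])
    finally show "(\<integral>\<^sup>+y. ennreal (min \<bar>h y\<bar> s * norm (x - y) powr (-\<mu>)) \<partial>lborel) \<le> ennreal (C / \<beta> * s powr (1 - r * (1 - \<mu> / DIM('a))))"
      unfolding \<beta>_def \<kappa>_def .
  qed
qed

text \<open>At every pair of points either \<open>|h y| \<le> |g x|^(p/r)\<close> or the reverse bound on \<open>g\<close> holds. In both regions one of
the two functions may be truncated at a height that depends on the other point only, and the
truncated potential bound leaves exactly the integral of \<open>|g|^p\<close> or \<open>|h|^r\<close>.\<close>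

lemma Hardy_Littlewood_Sobolev_unit:
  fixes \<mu> p r :: real
  assumes "0 < \<mu>" "\<mu> < DIM('a::euclidean_space)" "1 < p" "1 < r" "1 / p + 1 / r + \<mu> / DIM('a) = 2"
  obtains C where "0 < C"
    "\<And>(g::'a \<Rightarrow> real) h. lp_le p 1 g \<Longrightarrow> lp_le r 1 h \<Longrightarrow>
      (\<integral>\<^sup>+x. riesz_pot \<mu> g x * ennreal \<bar>h x\<bar> \<partial>lborel) \<le> ennreal C"
proof -
  define \<kappa> where "\<kappa> = 1 - \<mu> / DIM('a)"
  have \<kappa>: "\<kappa> = 1 / p + 1 / r - 1" using assms by (simp add: \<kappa>_def)
  have k1: "p * \<kappa> = 1 + p / r - p" "r * \<kappa> = 1 + r / p - r" using assms by (auto simp: \<kappa> field_simps)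
  have "1 / p < 1" "1 / r < 1" using assms by auto
  then have "p * (1 / p + 1 / r - 1) < p * (1 / p)" "r * (1 / p + 1 / r - 1) < r * (1 / r)"
    using assms by (intro mult_strict_left_mono; simp)+
  moreover have "p * (1 / p) = 1" "r * (1 / r) = 1" using assms by auto
  ultimately have k2: "p * \<kappa> < 1" "r * \<kappa> < 1" by (auto simp only: \<kappa>)
  have pos: "0 < p" "0 < r" using assms by auto
  obtain C1 where C1: "0 < C1"
    "\<And>h s x. lp_le p 1 h \<Longrightarrow> 0 < s \<Longrightarrow>
      (\<integral>\<^sup>+(y::'a). ennreal (min \<bar>h y\<bar> s * norm (x - y) powr (-\<mu>)) \<partial>lborel) \<le> ennreal (C1 * s powr (1 - p * \<kappa>))"
    unfolding \<kappa>_def by (rule truncated_potential_le[OF assms(1,2) pos(1) k2(1)[unfolded \<kappa>_def]]) blast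
  obtain C2 where C2: "0 < C2"
    "\<And>h s x. lp_le r 1 h \<Longrightarrow> 0 < s \<Longrightarrow>
      (\<integral>\<^sup>+(y::'a). ennreal (min \<bar>h y\<bar> s * norm (x - y) powr (-\<mu>)) \<partial>lborel) \<le> ennreal (C2 * s powr (1 - r * \<kappa>))"
    unfolding \<kappa>_def by (rule truncated_potential_le[OF assms(1,2) pos(2) k2(2)[unfolded \<kappa>_def]]) blast
  have half: "(\<integral>\<^sup>+x. (\<integral>\<^sup>+y. ennreal (\<bar>h x\<bar> * min \<bar>g y\<bar> (\<bar>h x\<bar> powr (r / p)) * norm (x - y) powr (-\<mu>)) \<partial>lborel) \<partial>lborel) \<le> ennreal C"
    if C: "0 < C" "\<And>h s x. lp_le p 1 h \<Longrightarrow> 0 < s \<Longrightarrow>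
      (\<integral>\<^sup>+(y::'a). ennreal (min \<bar>h y\<bar> s * norm (x - y) powr (-\<mu>)) \<partial>lborel) \<le> ennreal (C * s powr (1 - p * \<kappa>))"
      and g: "lp_le p 1 g" and h: "lp_le r 1 h" and pr: "0 < p" "0 < r" "p * \<kappa> = 1 + p / r - p"
    for p r C :: real and g h :: "'a \<Rightarrow> real"
  proof -
    note [measurable] = lp_leD(1)[OF g] lp_leD(1)[OF h]
    have "(\<integral>\<^sup>+y. ennreal (\<bar>h x\<bar> * min \<bar>g y\<bar> (\<bar>h x\<bar> powr (r / p)) * norm (x - y) powr (-\<mu>)) \<partial>lborel) \<le> ennreal C * ennreal (\<bar>h x\<bar> powr r)" for x
    proof (cases "h x = 0")
      case False
      have "(\<integral>\<^sup>+y. ennreal (\<bar>h x\<bar> * min \<bar>g y\<bar> (\<bar>h x\<bar> powr (r / p)) * norm (x - y) powr (-\<mu>)) \<partial>lborel)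
        = ennreal \<bar>h x\<bar> * (\<integral>\<^sup>+y. ennreal (min \<bar>g y\<bar> (\<bar>h x\<bar> powr (r / p)) * norm (x - y) powr (-\<mu>)) \<partial>lborel)"
        by (subst nn_integral_cmult[symmetric]) (auto intro!: nn_integral_cong simp: ennreal_mult[symmetric] mult_ac)
      also have "\<dots> \<le> ennreal \<bar>h x\<bar> * ennreal (C * (\<bar>h x\<bar> powr (r / p)) powr (1 - p * \<kappa>))"
        using False by (intro mult_left_mono C(2) g) auto
      also have "(\<bar>h x\<bar> powr (r / p)) powr (1 - p * \<kappa>) = \<bar>h x\<bar> powr (r - 1)"
      proof -
        have "r / p * (1 - p * \<kappa>) = r - 1" unfolding pr(3) using pr(1,2) by (simp add: field_simps)
        then show ?thesis by (simp only: powr_powr)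
      qed
      also have "ennreal \<bar>h x\<bar> * ennreal (C * \<bar>h x\<bar> powr (r - 1)) = ennreal C * ennreal (\<bar>h x\<bar> powr 1 * \<bar>h x\<bar> powr (r - 1))"
        using C by (simp add: ennreal_mult[symmetric] mult_ac)
      also have "\<bar>h x\<bar> powr 1 * \<bar>h x\<bar> powr (r - 1) = \<bar>h x\<bar> powr r"
        by (simp only: powr_add[symmetric]) simp
      finally show ?thesis .
    qed simp
    then have "(\<integral>\<^sup>+x. (\<integral>\<^sup>+y. ennreal (\<bar>h x\<bar> * min \<bar>g y\<bar> (\<bar>h x\<bar> powr (r / p)) * norm (x - y) powr (-\<mu>)) \<partial>lborel) \<partial>lborel)
      \<le> (\<integral>\<^sup>+x. ennreal C * ennreal (\<bar>h x\<bar> powr r) \<partial>lborel)"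
      by (intro nn_integral_mono)
    also have "\<dots> = ennreal C * (\<integral>\<^sup>+x. ennreal (\<bar>h x\<bar> powr r) \<partial>lborel)" by (subst nn_integral_cmult) auto
    also have "\<dots> \<le> ennreal C * 1" using lp_leD(3)[OF h] by (intro mult_left_mono) auto
    finally show ?thesis by simp
  qed
  show ?thesis
  proof (rule that[of "C1 + C2"])
    show "0 < C1 + C2" using C1 C2 by simp
    fix g h :: "'a \<Rightarrow> real" assume g: "lp_le p 1 g" and h: "lp_le r 1 h"
    note [measurable] = lp_leD(1)[OF g] lp_leD(1)[OF h]
    let ?A = "\<lambda>x y. ennreal (\<bar>h x\<bar> * min \<bar>g y\<bar> (\<bar>h x\<bar> powr (r / p)) * norm (x - y) powr (-\<mu>))"
    let ?B = "\<lambda>x y. ennreal (\<bar>g y\<bar> * min \<bar>h x\<bar> (\<bar>g y\<bar> powr (p / r)) * norm (y - x) powr (-\<mu>))"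
    have "(\<integral>\<^sup>+x. riesz_pot \<mu> g x * ennreal \<bar>h x\<bar> \<partial>lborel) = (\<integral>\<^sup>+x. (\<integral>\<^sup>+y. ennreal (norm (x - y) powr (-\<mu>) * \<bar>g y\<bar>) * ennreal \<bar>h x\<bar> \<partial>lborel) \<partial>lborel)"
      unfolding riesz_pot_def by (intro nn_integral_cong nn_integral_multc[symmetric]) simp
    also have "\<dots> \<le> (\<integral>\<^sup>+x. (\<integral>\<^sup>+y. ?A x y + ?B x y \<partial>lborel) \<partial>lborel)"
    proof (intro nn_integral_mono)
      fix x y
      have "norm (x - y) powr (-\<mu>) * \<bar>g y\<bar> * \<bar>h x\<bar> \<le> \<bar>h x\<bar> * min \<bar>g y\<bar> (\<bar>h x\<bar> powr (r / p)) * norm (x - y) powr (-\<mu>)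
          + \<bar>g y\<bar> * min \<bar>h x\<bar> (\<bar>g y\<bar> powr (p / r)) * norm (y - x) powr (-\<mu>)"
      proof (cases "\<bar>g y\<bar> \<le> \<bar>h x\<bar> powr (r / p)")
        case True
        have "0 \<le> \<bar>g y\<bar> * min \<bar>h x\<bar> (\<bar>g y\<bar> powr (p / r)) * norm (y - x) powr (-\<mu>)" by simp
        then show ?thesis using True by (simp add: mult_ac)
      next
        case False
        then have "(\<bar>h x\<bar> powr (r / p)) powr (p / r) \<le> \<bar>g y\<bar> powr (p / r)" using assms by (intro powr_mono2) auto
        then have "\<bar>h x\<bar> \<le> \<bar>g y\<bar> powr (p / r)" using assms by (simp add: powr_powr)
        moreover have "0 \<le> \<bar>h x\<bar> * min \<bar>g y\<bar> (\<bar>h x\<bar> powr (r / p)) * norm (x - y) powr (-\<mu>)" by simp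
        ultimately show ?thesis by (simp add: mult_ac norm_minus_commute)
      qed
      note le = this
      have "ennreal (norm (x - y) powr (-\<mu>) * \<bar>g y\<bar>) * ennreal \<bar>h x\<bar> = ennreal (norm (x - y) powr (-\<mu>) * \<bar>g y\<bar> * \<bar>h x\<bar>)"
        by (intro ennreal_mult[symmetric]) auto
      also have "\<dots> \<le> ?A x y + ?B x y"
        by (subst ennreal_plus[symmetric]) (auto intro!: ennreal_leI le mult_nonneg_nonneg simp del: ennreal_plus)
      finally show "ennreal (norm (x - y) powr (-\<mu>) * \<bar>g y\<bar>) * ennreal \<bar>h x\<bar> \<le> ?A x y + ?B x y" .
    qed
    also have "\<dots> = (\<integral>\<^sup>+x. (\<integral>\<^sup>+y. ?A x y \<partial>lborel) + (\<integral>\<^sup>+y. ?B x y \<partial>lborel) \<partial>lborel)"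
      by (intro nn_integral_cong nn_integral_add) measurable
    also have "\<dots> = (\<integral>\<^sup>+x. (\<integral>\<^sup>+y. ?A x y \<partial>lborel) \<partial>lborel) + (\<integral>\<^sup>+x. (\<integral>\<^sup>+y. ?B x y \<partial>lborel) \<partial>lborel)"
      by (intro nn_integral_add) measurable
    also have "(\<integral>\<^sup>+x. (\<integral>\<^sup>+y. ?B x y \<partial>lborel) \<partial>lborel) = (\<integral>\<^sup>+y. (\<integral>\<^sup>+x. ?B x y \<partial>lborel) \<partial>lborel)"
      by (rule lborel_pair.Fubini') measurable
    also have "(\<integral>\<^sup>+x. (\<integral>\<^sup>+y. ?A x y \<partial>lborel) \<partial>lborel) + (\<integral>\<^sup>+y. (\<integral>\<^sup>+x. ?B x y \<partial>lborel) \<partial>lborel) \<le> ennreal C1 + ennreal C2"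
      by (intro add_mono half[OF C1 g h _ _ k1(1)] half[OF C2 h g _ _ k1(2)]) (use assms in auto)
    also have "\<dots> = ennreal (C1 + C2)" using C1 C2 by simp
    finally show "(\<integral>\<^sup>+x. riesz_pot \<mu> g x * ennreal \<bar>h x\<bar> \<partial>lborel) \<le> ennreal (C1 + C2)" .
  qed
qed

lemma riesz_pot_cmult:
  assumes [measurable]: "g \<in> borel_measurable borel" and "0 \<le> c"
  shows "riesz_pot \<mu> (\<lambda>y. c * g y) x = ennreal c * riesz_pot \<mu> g x"
  unfolding riesz_pot_def using assms(2)
  by (subst nn_integral_cmult[symmetric]) (auto intro!: nn_integral_cong simp: ennreal_mult[symmetric] abs_mult mult_ac)

theorem Hardy_Littlewood_Sobolev:
  fixes \<mu> p r :: real
  assumes "0 < \<mu>" "\<mu> < DIM('a::euclidean_space)" "1 < p" "1 < r" "1 / p + 1 / r + \<mu> / DIM('a) = 2"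
  obtains C where "0 < C"
    "\<And>(g::'a \<Rightarrow> real) h a b. lp_le p a g \<Longrightarrow> lp_le r b h \<Longrightarrow>
      (\<integral>\<^sup>+x. riesz_pot \<mu> g x * ennreal \<bar>h x\<bar> \<partial>lborel) \<le> ennreal (C * a * b)"
proof -
  obtain C where C: "0 < C"
    "\<And>(g::'a \<Rightarrow> real) h. lp_le p 1 g \<Longrightarrow> lp_le r 1 h \<Longrightarrow>
      (\<integral>\<^sup>+x. riesz_pot \<mu> g x * ennreal \<bar>h x\<bar> \<partial>lborel) \<le> ennreal C"
    by (rule Hardy_Littlewood_Sobolev_unit[OF assms]) blast
  show ?thesis
  proof (rule that[OF C(1)])
    fix g h :: "'a \<Rightarrow> real" and a b assume g: "lp_le p a g" and h: "lp_le r b h"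
    note [measurable] = lp_leD(1)[OF g] lp_leD(1)[OF h]
    have ab: "0 \<le> a" "0 \<le> b" using g h by (auto simp: lp_le_def)
    show "(\<integral>\<^sup>+x. riesz_pot \<mu> g x * ennreal \<bar>h x\<bar> \<partial>lborel) \<le> ennreal (C * a * b)"
    proof (cases "a = 0 \<or> b = 0")
      case True
      have "(AE x in lborel. g x = 0) \<or> (AE x in lborel. h x = 0)"
        using True lp_le_AE_zero[of p g] lp_le_AE_zero[of r h] g h by auto
      then have "(\<integral>\<^sup>+x. riesz_pot \<mu> g x * ennreal \<bar>h x\<bar> \<partial>lborel) = 0"
      proof
        assume ae: "AE x in lborel. g x = 0"
        have "riesz_pot \<mu> g x = 0" for x
          unfolding riesz_pot_def by (subst nn_integral_0_iff_AE) (use ae in \<open>auto elim: eventually_mono\<close>)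
        then show ?thesis by simp
      next
        assume ae: "AE x in lborel. h x = 0"
        then have ae: "AE x in lborel. riesz_pot \<mu> g x * ennreal \<bar>h x\<bar> = 0"
          by eventually_elim simp
        then show ?thesis by (subst nn_integral_0_iff_AE) auto
      qed
      then show ?thesis by simp
    next
      case False
      then have pos: "0 < a" "0 < b" using ab by auto
      have "lp_le p (\<bar>1 / a\<bar> * a) (\<lambda>x. 1 / a * g x)" "lp_le r (\<bar>1 / b\<bar> * b) (\<lambda>x. 1 / b * h x)"
        using assms by (intro lp_le_cmult g h; simp)+
      then have "(\<integral>\<^sup>+x. riesz_pot \<mu> (\<lambda>x. 1 / a * g x) x * ennreal \<bar>1 / b * h x\<bar> \<partial>lborel) \<le> ennreal C"
        using pos by (intro C(2)) auto
      have "(\<integral>\<^sup>+x. riesz_pot \<mu> g x * ennreal \<bar>h x\<bar> \<partial>lborel)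
          = (\<integral>\<^sup>+x. ennreal (a * b) * (riesz_pot \<mu> (\<lambda>x. 1 / a * g x) x * ennreal \<bar>1 / b * h x\<bar>) \<partial>lborel)"
      proof (rule nn_integral_cong)
        fix x
        have 1: "riesz_pot \<mu> g x = ennreal a * riesz_pot \<mu> (\<lambda>x. 1 / a * g x) x"
          using pos by (subst riesz_pot_cmult[symmetric]) auto
        have 2: "ennreal \<bar>h x\<bar> = ennreal b * ennreal \<bar>1 / b * h x\<bar>"
          using pos by (simp add: ennreal_mult[symmetric] abs_mult)
        show "riesz_pot \<mu> g x * ennreal \<bar>h x\<bar> = ennreal (a * b) * (riesz_pot \<mu> (\<lambda>x. 1 / a * g x) x * ennreal \<bar>1 / b * h x\<bar>)"
          unfolding 1 2 using ab by (simp add: ennreal_mult mult_ac)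
      qed
      also have "\<dots> = ennreal (a * b) * (\<integral>\<^sup>+x. (riesz_pot \<mu> (\<lambda>x. 1 / a * g x) x * ennreal \<bar>1 / b * h x\<bar>) \<partial>lborel)"
        by (rule nn_integral_cmult) measurable
      also have "\<dots> \<le> ennreal (a * b) * ennreal C" by (intro mult_left_mono) (fact, simp)
      also have "\<dots> = ennreal (C * a * b)" using ab C by (simp add: ennreal_mult[symmetric] mult_ac)
      finally show ?thesis .
    qed
  qed
qed

theorem Riesz_potential_bound:
  fixes \<mu> p q :: real
  assumes "0 < \<mu>" "\<mu> < DIM('a::euclidean_space)" "1 < p" "1 < q" "1 / q = 1 / p + \<mu> / DIM('a) - 1"
  obtains C where "0 < C"
    "\<And>(g::'a \<Rightarrow> real) a. lp_le p a g \<Longrightarrow> AE x in lborel. riesz_pot \<mu> g x < \<infinity>"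
    "\<And>(g::'a \<Rightarrow> real) a. lp_le p a g \<Longrightarrow> lp_le q (C * a) (\<lambda>x. enn2real (riesz_pot \<mu> g x))"
proof -
  define r where "r = q / (q - 1)"
  have r: "1 < r" "1 / q + 1 / r = 1" using assms by (auto simp: r_def field_simps)
  have pr: "1 / p + 1 / r + \<mu> / DIM('a) = 2" using assms(5) r(2) by simp
  obtain C where C: "0 < C"
    "\<And>(g::'a \<Rightarrow> real) h a b. lp_le p a g \<Longrightarrow> lp_le r b h \<Longrightarrow>
      (\<integral>\<^sup>+x. riesz_pot \<mu> g x * ennreal \<bar>h x\<bar> \<partial>lborel) \<le> ennreal (C * a * b)"
    by (rule Hardy_Littlewood_Sobolev[OF assms(1,2,3) r(1) pr]) blast
  show ?thesis
  proof (rule that[OF C(1)])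
    fix g :: "'a \<Rightarrow> real" and a assume g: "lp_le p a g"
    have [measurable]: "g \<in> borel_measurable borel" "0 \<le> a" using g by (auto simp: lp_le_def)
    have "0 \<le> C * a" using C \<open>0 \<le> a\<close> by simp
    note * = lp_le_dual[OF _ assms(4) r(2) this, of "riesz_pot \<mu> g"]
    show "AE x in lborel. riesz_pot \<mu> g x < \<infinity>" "lp_le q (C * a) (\<lambda>x. enn2real (riesz_pot \<mu> g x))"
      using C(2)[OF g] by (intro *; simp)+
  qed
qed

section \<open>Pointwise inequalities for the nonlinearity\<close>

text \<open>The common size of the nonlinearity: the first power dominates for small arguments, the second for
large ones.\<close>

definition growth :: "real \<Rightarrow> real \<Rightarrow> real \<Rightarrow> real" where
  "growth a q t = \<bar>t\<bar> powr a + \<bar>t\<bar> powr q"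

lemma growth_nonneg [simp]: "0 \<le> growth a q t"
  by (simp add: growth_def)

lemma powr_add_bound:
  fixes s :: real
  assumes "0 < s"
  shows "(\<bar>x\<bar> + \<bar>y\<bar>) powr s \<le> 2 powr s * (\<bar>x\<bar> powr s + \<bar>y\<bar> powr s)"
proof -
  have "(\<bar>x\<bar> + \<bar>y\<bar>) powr s \<le> (2 * max \<bar>x\<bar> \<bar>y\<bar>) powr s" using assms by (intro powr_mono2) auto
  also have "\<dots> = 2 powr s * max \<bar>x\<bar> \<bar>y\<bar> powr s" by (simp add: powr_mult)
  also have "\<dots> \<le> 2 powr s * (\<bar>x\<bar> powr s + \<bar>y\<bar> powr s)"
    by (intro mult_left_mono) (auto simp: max_def)
  finally show ?thesis .
qed

lemma growth_mono:
  assumes "\<bar>s\<bar> \<le> \<bar>t\<bar>" "0 < a" "0 < q"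
  shows "growth a q s \<le> growth a q t"
  unfolding growth_def using assms by (intro add_mono powr_mono2) auto

lemma growth_add:
  assumes "0 < a" "0 < q"
  shows "growth a q (x + y) \<le> (2 powr a + 2 powr q) * (growth a q x + growth a q y)"
proof -
  have "growth a q (x + y) \<le> growth a q (\<bar>x\<bar> + \<bar>y\<bar>)" using assms by (intro growth_mono) auto
  also have "\<dots> \<le> 2 powr a * (\<bar>x\<bar> powr a + \<bar>y\<bar> powr a) + 2 powr q * (\<bar>x\<bar> powr q + \<bar>y\<bar> powr q)"
    using powr_add_bound[of a x y] powr_add_bound[of q x y] assms by (simp add: growth_def)
  also have "\<dots> \<le> (2 powr a + 2 powr q) * (\<bar>x\<bar> powr a + \<bar>y\<bar> powr a) + (2 powr a + 2 powr q) * (\<bar>x\<bar> powr q + \<bar>y\<bar> powr q)"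
    by (intro add_mono mult_right_mono) auto
  also have "\<dots> = (2 powr a + 2 powr q) * (growth a q x + growth a q y)"
    by (simp add: growth_def algebra_simps)
  finally show ?thesis .
qed

text \<open>Young's inequality with an arbitrarily small constant on one side. It holds by comparing \<open>x\<close> with
\<open>\<eta> y\<close>.\<close>

lemma young_small:
  fixes s t \<delta> :: real
  assumes "0 < s" "0 < t" "0 < \<delta>"
  obtains C where "0 < C" "\<And>x y. 0 \<le> x \<Longrightarrow> 0 \<le> y \<Longrightarrow> x powr s * y powr t \<le> \<delta> * y powr (s + t) + C * x powr (s + t)"
proof -
  define \<eta> where "\<eta> = \<delta> powr (1 / s)"
  have \<eta>: "0 < \<eta>" "\<eta> powr s = \<delta>" using assms by (auto simp: \<eta>_def powr_powr)
  show ?thesis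
  proof (rule that[of "\<eta> powr (-t)"])
    show "0 < \<eta> powr (-t)" using \<eta> by simp
    fix x y :: real assume xy: "0 \<le> x" "0 \<le> y"
    show "x powr s * y powr t \<le> \<delta> * y powr (s + t) + \<eta> powr (-t) * x powr (s + t)"
    proof (cases "x \<le> \<eta> * y")
      case True
      have "x powr s * y powr t \<le> (\<eta> * y) powr s * y powr t"
        using True xy assms by (intro mult_right_mono powr_mono2) auto
      also have "\<dots> = \<delta> * y powr (s + t)" using \<eta> xy by (simp add: powr_mult powr_add)
      finally show ?thesis by (simp add: add_increasing2)
    next
      case False
      then have "y \<le> x / \<eta>" using \<eta> by (simp add: field_simps)
      then have "x powr s * y powr t \<le> x powr s * (x / \<eta>) powr t"
        using xy assms by (intro mult_left_mono powr_mono2) auto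
      also have "\<dots> = \<eta> powr (-t) * x powr (s + t)" using \<eta> xy by (simp add: powr_divide powr_add powr_minus_divide)
      finally show ?thesis using assms by (simp add: add_increasing)
    qed
  qed
qed

text \<open>A function that is of lower order than \<open>growth\<close> both at 0 and at infinity has small increments: far out and near 0
both values are small by themselves, on the compact region in between small steps are covered by
uniform continuity, and large steps \<open>|y| \<ge> \<eta>\<close> are paid for by the term in \<open>y\<close>.\<close>

lemma increment_bound_perturbation:
  fixes f :: "real \<Rightarrow> real"
  assumes cont: "continuous_on UNIV f" and aq: "0 < a" "0 < q"
    and small: "\<And>\<delta>. 0 < \<delta> \<Longrightarrow> \<exists>\<tau>>0. \<exists>T. \<forall>t. \<bar>t\<bar> \<le> \<tau> \<or> T \<le> \<bar>t\<bar> \<longrightarrow> \<bar>f t\<bar> \<le> \<delta> * growth a q t"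
    and "0 < \<delta>"
  shows "\<exists>C\<ge>0. \<forall>x y. \<bar>f (x + y) - f x\<bar> \<le> \<delta> * growth a q x + C * growth a q y"
proof -
  let ?G = "growth a q"
  define c where "c = 2 powr a + 2 powr q"
  have c: "0 < c" by (simp add: c_def add_pos_pos)
  \<comment> \<open>Doubling \<open>growth (x + y)\<close> costs the factor \<open>c\<close>, so smallness is required with \<open>\<delta> / (c + 1)\<close>.\<close>
  define d where "d = \<delta> / (c + 1)"
  have d: "0 < d" "d * (c + 1) = \<delta>" using c assms by (auto simp: d_def)
  obtain \<tau> T where \<tau>: "0 < \<tau>" and T: "\<And>t. \<bar>t\<bar> \<le> \<tau> \<or> T \<le> \<bar>t\<bar> \<Longrightarrow> \<bar>f t\<bar> \<le> d * ?G t"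
    using small[OF d(1)] by metis
  define K where "K = {- (\<bar>T\<bar> + 2) .. \<bar>T\<bar> + 2}"
  have "compact (f ` K)" unfolding K_def by (intro compact_continuous_image continuous_on_subset[OF cont]) auto
  then obtain M where M: "\<And>t. t \<in> K \<Longrightarrow> \<bar>f t\<bar> \<le> M" 
    using compact_imp_bounded[of "f ` K"] unfolding bounded_iff by auto
  have "0 \<in> K" by (simp add: K_def)
  with M have M0: "0 \<le> M" by (meson abs_ge_zero order_trans)
  have fb: "\<bar>f t\<bar> \<le> d * ?G t + M" for t
  proof (cases "T \<le> \<bar>t\<bar>")
    case True
    then show ?thesis using T[of t] M0 by auto
  next
    case False
    then have "t \<in> K" by (auto simp: K_def)
    then show ?thesis using M[of t] d by (simp add: add_increasing)
  qed
  have two: "d * (?G (x + y) + ?G x) \<le> \<delta> * ?G x + \<delta> * ?G y" for x y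
  proof -
    have "d * (?G (x + y) + ?G x) \<le> d * (c * (?G x + ?G y) + ?G x)"
      using growth_add[OF aq, of x y] d by (intro mult_left_mono add_right_mono) (auto simp: c_def)
    also have "\<dots> \<le> d * ((c + 1) * (?G x + ?G y))"
      using d by (intro mult_left_mono) (auto simp: algebra_simps)
    also have "\<dots> = d * (c + 1) * (?G x + ?G y)" by simp
    also have "\<dots> = \<delta> * ?G x + \<delta> * ?G y" unfolding d(2) by (simp add: algebra_simps)
    finally show ?thesis .
  qed
  have "uniformly_continuous_on K f"
    unfolding K_def by (intro compact_uniformly_continuous continuous_on_subset[OF cont]) auto
  moreover have e: "0 < \<delta> * (\<tau> / 2) powr a" using assms \<tau> by simp
  ultimately obtain \<eta>0 where \<eta>0: "0 < \<eta>0" "\<And>s t. s \<in> K \<Longrightarrow> t \<in> K \<Longrightarrow> \<bar>t - s\<bar> < \<eta>0 \<Longrightarrow> \<bar>f t - f s\<bar> < \<delta> * (\<tau> / 2) powr a"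
    unfolding uniformly_continuous_on_def dist_real_def by metis
  \<comment> \<open>With this choice a step shorter than \<open>\<eta>\<close> from \<open>|x| \<le> \<tau> / 2\<close> stays in \<open>|t| \<le> \<tau>\<close>, and one from
    \<open>|x| \<ge> T + 1\<close> stays in \<open>|t| \<ge> T\<close>.\<close>
  define \<eta> where "\<eta> = min \<eta>0 (min (\<tau> / 2) 1)"
  have \<eta>: "0 < \<eta>" "\<eta> \<le> \<eta>0" "\<eta> \<le> \<tau> / 2" "\<eta> \<le> 1" using \<tau> \<eta>0 by (auto simp: \<eta>_def)
  have "\<bar>f (x + y) - f x\<bar> \<le> \<delta> * ?G x + (\<delta> + 2 * M / \<eta> powr a) * ?G y" for x y
  proof (cases "\<eta> \<le> \<bar>y\<bar>")
    case True
    have "\<eta> powr a \<le> \<bar>y\<bar> powr a" using True \<eta> aq by (intro powr_mono2) auto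
    also have "\<dots> \<le> ?G y" by (simp add: growth_def)
    finally have "M \<le> M / \<eta> powr a * ?G y"
      using M0 \<eta> by (simp add: field_simps mult_left_mono)
    moreover have "\<bar>f (x + y) - f x\<bar> \<le> d * (?G (x + y) + ?G x) + 2 * M"
      using fb[of "x + y"] fb[of x] by (auto simp: algebra_simps abs_le_iff)
    ultimately have "\<bar>f (x + y) - f x\<bar> \<le> (\<delta> * ?G x + \<delta> * ?G y) + 2 * (M / \<eta> powr a * ?G y)"
      using two[of x y] by linarith
    then show ?thesis by (simp add: algebra_simps)
  next
    case False
    have "0 \<le> 2 * M / \<eta> powr a * ?G y" using M0 by simp
    moreover have "\<bar>f (x + y) - f x\<bar> \<le> \<delta> * ?G x + \<delta> * ?G y"
    proof (cases "\<bar>x\<bar> \<le> \<tau> / 2 \<or> T + 1 \<le> \<bar>x\<bar>")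
      case True
      then have "\<bar>x\<bar> \<le> \<tau> \<or> T \<le> \<bar>x\<bar>" "\<bar>x + y\<bar> \<le> \<tau> \<or> T \<le> \<bar>x + y\<bar>"
        using False \<eta> \<tau> by linarith+
      then have "\<bar>f (x + y)\<bar> \<le> d * ?G (x + y)" "\<bar>f x\<bar> \<le> d * ?G x" using T by blast+
      then have "\<bar>f (x + y) - f x\<bar> \<le> d * (?G (x + y) + ?G x)" by (auto simp: algebra_simps abs_le_iff)
      then show ?thesis using two[of x y] by simp
    next
      case x: False
      then have "x \<in> K" "x + y \<in> K" using False \<eta> by (auto simp: K_def abs_if split: if_splits)
      then have "\<bar>f (x + y) - f x\<bar> < \<delta> * (\<tau> / 2) powr a" using False \<eta> by (intro \<eta>0(2)) auto
      also have "\<dots> \<le> \<delta> * \<bar>x\<bar> powr a" using x \<tau> assms by (intro mult_left_mono powr_mono2) auto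
      also have "\<dots> \<le> \<delta> * ?G x" using assms by (intro mult_left_mono) (auto simp: growth_def)
      also have "\<dots> \<le> \<delta> * ?G x + \<delta> * ?G y" using assms by simp
      finally show ?thesis by simp
    qed
    ultimately show ?thesis by (simp add: algebra_simps)
  qed
  then show ?thesis using M0 assms by (intro exI[of _ "\<delta> + 2 * M / \<eta> powr a"]) auto
qed

lemma signed_power_mult:
  fixes x y q :: real
  shows "\<bar>x * y\<bar> powr (q - 1) * (x * y) = (\<bar>x\<bar> powr (q - 1) * x) * (\<bar>y\<bar> powr (q - 1) * y)"
  by (simp add: abs_mult powr_mult)

lemma abs_signed_power:
  fixes x q :: real
  shows "\<bar>\<bar>x\<bar> powr (q - 1) * x\<bar> = \<bar>x\<bar> powr q"
  using powr_add[of "\<bar>x\<bar>" "q - 1" 1] by (cases "x = 0") (auto simp: abs_mult)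

lemma continuous_signed_power:
  fixes q :: real
  assumes "1 < q"
  shows "continuous_on UNIV (\<lambda>x. \<bar>x\<bar> powr (q - 1) * x)"
  using assms by (intro continuous_intros continuous_on_powr') auto

text \<open>By homogeneity it suffices to compare with continuity at 1 when \<open>|y|\<close> is small relative to \<open>|x|\<close>; otherwise \<open>|x|\<close>
itself is bounded by a multiple of \<open>|y|\<close>.\<close>

lemma increment_bound_power:
  fixes q \<delta> :: real
  assumes "1 < q" "0 < \<delta>"
  shows "\<exists>C\<ge>0. \<forall>x y. \<bar>\<bar>x + y\<bar> powr (q - 1) * (x + y) - \<bar>x\<bar> powr (q - 1) * x\<bar> \<le> \<delta> * \<bar>x\<bar> powr q + C * \<bar>y\<bar> powr q"
proof -
  define g where "g x = \<bar>x\<bar> powr (q - 1) * x" for x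
  have "isCont g 1" using continuous_signed_power[OF assms(1)] by (auto simp: g_def[abs_def] continuous_on_eq_continuous_at)
  then obtain \<eta> where \<eta>: "0 < \<eta>" "\<And>s. \<bar>s\<bar> < \<eta> \<Longrightarrow> \<bar>g (1 + s) - g 1\<bar> < \<delta>"
    using assms(2) unfolding continuous_at_eps_delta dist_real_def
    by (metis add_diff_cancel_left')
  have [simp]: "g 1 = 1" by (simp add: g_def)
  define C where "C = (1 / \<eta> + 1) powr q + (1 / \<eta>) powr q"
  have "\<bar>g (x + y) - g x\<bar> \<le> \<delta> * \<bar>x\<bar> powr q + C * \<bar>y\<bar> powr q" for x y
  proof (cases "\<bar>y\<bar> < \<eta> * \<bar>x\<bar>")
    case True
    then have "x \<noteq> 0" by auto
    have "g (x + y) = g x * g (1 + y / x)"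
      using signed_power_mult[of x "1 + y / x" q] \<open>x \<noteq> 0\<close> by (simp add: g_def distrib_left)
    then have "\<bar>g (x + y) - g x\<bar> = \<bar>g x\<bar> * \<bar>g (1 + y / x) - 1\<bar>"
      by (simp add: abs_mult[symmetric] algebra_simps)
    also have "\<dots> \<le> \<bar>x\<bar> powr q * \<delta>"
      proof (rule mult_mono)
      show "\<bar>g x\<bar> \<le> \<bar>x\<bar> powr q" by (simp add: g_def abs_signed_power)
      have "\<bar>y / x\<bar> < \<eta>" using True \<open>x \<noteq> 0\<close> by (simp add: field_simps)
      from \<eta>(2)[OF this] show "\<bar>g (1 + y / x) - 1\<bar> \<le> \<delta>" by simp
    qed auto
    also have "\<dots> \<le> \<delta> * \<bar>x\<bar> powr q + C * \<bar>y\<bar> powr q" by (simp add: C_def mult.commute)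
    finally show ?thesis .
  next
    case False
    then have x: "\<bar>x\<bar> \<le> 1 / \<eta> * \<bar>y\<bar>" using \<eta> by (simp add: field_simps)
    have "\<bar>g (x + y) - g x\<bar> \<le> \<bar>x + y\<bar> powr q + \<bar>x\<bar> powr q"
      using abs_triangle_ineq4[of "g (x+y)" "g x"] by (simp add: g_def abs_signed_power)
    also have "\<dots> \<le> ((1 / \<eta> + 1) * \<bar>y\<bar>) powr q + (1 / \<eta> * \<bar>y\<bar>) powr q"
      using x assms by (intro add_mono powr_mono2) (auto simp: algebra_simps)
    also have "\<dots> = C * \<bar>y\<bar> powr q" using \<eta>(1) by (simp only: powr_mult) (simp add: C_def distrib_right)
    finally show ?thesis using assms by (simp add: add_increasing)
  qed
  then show ?thesis unfolding g_def by (intro exI[of _ C]) (auto simp: C_def)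
qed

locale critical_nonlinearity =
  fixes a q :: real and f :: "real \<Rightarrow> real"
  assumes aq: "0 < a" "a < 1" "1 < q"
    and cont: "continuous_on UNIV f"
    and at_zero: "((\<lambda>t. f t / \<bar>t\<bar> powr a) \<longlongrightarrow> 0) (at 0)"
    and at_inf: "\<exists>L. ((\<lambda>t. f t / (\<bar>t\<bar> powr (q - 1) * t)) \<longlongrightarrow> L) at_infinity"
begin

lemma f_measurable [measurable]: "f \<in> borel_measurable borel"
  using cont by (rule borel_measurable_continuous_onI)

lemma f_tendsto: "(x \<longlongrightarrow> c) G \<Longrightarrow> ((\<lambda>n. f (x n)) \<longlongrightarrow> f c) G"
  using cont by (simp add: continuous_on_eq_continuous_at isCont_tendsto_compose)

lemma f_small_near_0:
  assumes "0 < \<delta>"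
  shows "\<exists>\<tau>>0. \<forall>t. t \<noteq> 0 \<and> \<bar>t\<bar> \<le> \<tau> \<longrightarrow> \<bar>f t\<bar> \<le> \<delta> * \<bar>t\<bar> powr a"
proof -
  have "\<forall>\<^sub>F t in at 0. \<bar>f t / \<bar>t\<bar> powr a\<bar> < \<delta>"
    using at_zero assms by (auto simp: tendsto_iff dist_real_def)
  then obtain \<tau> where \<tau>: "0 < \<tau>" "\<And>t. t \<noteq> 0 \<Longrightarrow> \<bar>t\<bar> < \<tau> \<Longrightarrow> \<bar>f t / \<bar>t\<bar> powr a\<bar> < \<delta>"
    unfolding eventually_at by (auto simp: dist_real_def)
  show ?thesis
  proof (intro exI[of _ "\<tau> / 2"] conjI allI impI)
    fix t assume "t \<noteq> 0 \<and> \<bar>t\<bar> \<le> \<tau> / 2"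
    then have "t \<noteq> 0" "\<bar>f t / \<bar>t\<bar> powr a\<bar> < \<delta>" using \<tau> by auto
    then show "\<bar>f t\<bar> \<le> \<delta> * \<bar>t\<bar> powr a" by (simp add: field_simps)
  qed (use \<tau> in auto)
qed

lemma f_0 [simp]: "f 0 = 0"
proof -
  have "((\<lambda>t. f t / \<bar>t\<bar> powr a * \<bar>t\<bar> powr a) \<longlongrightarrow> 0 * \<bar>0\<bar> powr a) (at 0)"
    using aq by (intro tendsto_mult at_zero tendsto_powr' tendsto_rabs tendsto_ident_at tendsto_const) auto
  then have "(f \<longlongrightarrow> 0) (at 0)"
    by (subst tendsto_cong[where g = "\<lambda>t. f t / \<bar>t\<bar> powr a * \<bar>t\<bar> powr a"]) (auto simp: eventually_at_filter)
  moreover have "(f \<longlongrightarrow> f 0) (at 0)" using f_tendsto[OF tendsto_ident_at] .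
  ultimately show ?thesis using tendsto_unique[of "at (0::real)"] by auto
qed

text \<open>Subtracting \<open>L |t|^(q - 1) t\<close>, where \<open>L\<close> is the limit at infinity, leaves a function of lower order at infinity;
it is still of lower order at 0 because \<open>a < q\<close>. The two parts are covered by the two preceding
bounds. Without a limit at infinity \<open>f\<close> could oscillate and the bound would fail.\<close>

lemma increment_bound:
  assumes "0 < \<delta>"
  shows "\<exists>C\<ge>0. \<forall>x y. \<bar>f (x + y) - f x\<bar> \<le> \<delta> * growth a q x + C * growth a q y"
proof -
  obtain L where L: "((\<lambda>t. f t / (\<bar>t\<bar> powr (q - 1) * t)) \<longlongrightarrow> L) at_infinity" using at_inf by auto
  define g where "g t = \<bar>t\<bar> powr (q - 1) * t" for t
  define f0 where "f0 t = f t - L * g t" for t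
  have absg: "\<bar>g t\<bar> = \<bar>t\<bar> powr q" for t by (simp add: g_def abs_signed_power)
  have "\<exists>\<tau>>0. \<exists>T. \<forall>t. \<bar>t\<bar> \<le> \<tau> \<or> T \<le> \<bar>t\<bar> \<longrightarrow> \<bar>f0 t\<bar> \<le> \<delta> * growth a q t" if \<delta>: "0 < \<delta>" for \<delta>
  proof -
    obtain \<tau>1 where \<tau>1: "0 < \<tau>1" "\<And>t. t \<noteq> 0 \<Longrightarrow> \<bar>t\<bar> \<le> \<tau>1 \<Longrightarrow> \<bar>f t\<bar> \<le> \<delta> / 2 * \<bar>t\<bar> powr a"
      using f_small_near_0[of "\<delta> / 2"] \<delta> by auto
    define e where "e = \<delta> / (2 * (\<bar>L\<bar> + 1))"
    have e: "0 < e" "\<bar>L\<bar> * e \<le> \<delta> / 2" using \<delta> by (auto simp: e_def field_simps)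
    \<comment> \<open>Below this threshold \<open>|t|^q \<le> e |t|^a\<close>.\<close>
    define \<tau>2 where "\<tau>2 = e powr (1 / (q - a))"
    have \<tau>2: "0 < \<tau>2" using e by (simp add: \<tau>2_def)
    have g2: "\<bar>t\<bar> powr q \<le> e * \<bar>t\<bar> powr a" if "\<bar>t\<bar> \<le> \<tau>2" for t
    proof -
      have "\<bar>t\<bar> powr (q - a) \<le> \<tau>2 powr (q - a)" using that aq by (intro powr_mono2) auto
      also have "\<dots> = e" using aq e by (simp add: \<tau>2_def powr_powr)
      finally have "\<bar>t\<bar> powr (q - a) * \<bar>t\<bar> powr a \<le> e * \<bar>t\<bar> powr a" by (intro mult_right_mono) auto
      then show ?thesis by (simp add: powr_add[symmetric])
    qed
    have "\<forall>\<^sub>F t in at_infinity. \<bar>f t / g t - L\<bar> < \<delta>"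
      using L \<delta> by (auto simp: tendsto_iff dist_real_def g_def)
    then obtain T where T: "\<And>t. T \<le> \<bar>t\<bar> \<Longrightarrow> \<bar>f t / g t - L\<bar> < \<delta>"
      unfolding eventually_at_infinity by auto
    show ?thesis
    proof (rule exI[of _ "min \<tau>1 \<tau>2"], rule conjI)
      show "0 < min \<tau>1 \<tau>2" using \<tau>1 \<tau>2 by simp
      show "\<exists>T. \<forall>t. \<bar>t\<bar> \<le> min \<tau>1 \<tau>2 \<or> T \<le> \<bar>t\<bar> \<longrightarrow> \<bar>f0 t\<bar> \<le> \<delta> * growth a q t"
      proof (rule exI[of _ "max T 1"], intro allI impI)
      fix t assume t: "\<bar>t\<bar> \<le> min \<tau>1 \<tau>2 \<or> max T 1 \<le> \<bar>t\<bar>"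
      show "\<bar>f0 t\<bar> \<le> \<delta> * growth a q t"
      proof (cases "t = 0")
        case True
        then show ?thesis by (simp add: f0_def g_def growth_def)
      next
        case t0: False
        from t show ?thesis
        proof
          assume s: "\<bar>t\<bar> \<le> min \<tau>1 \<tau>2"
          have "\<bar>f0 t\<bar> \<le> \<bar>f t\<bar> + \<bar>L\<bar> * \<bar>t\<bar> powr q"
            unfolding f0_def absg[symmetric] abs_mult[symmetric] by (rule abs_triangle_ineq4)
          also have "\<dots> \<le> \<delta> / 2 * \<bar>t\<bar> powr a + \<bar>L\<bar> * (e * \<bar>t\<bar> powr a)"
            using s t0 by (intro add_mono \<tau>1 mult_left_mono g2) auto
          also have "\<bar>L\<bar> * (e * \<bar>t\<bar> powr a) \<le> \<delta> / 2 * \<bar>t\<bar> powr a"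
            using mult_right_mono[OF e(2), of "\<bar>t\<bar> powr a"] by (simp add: mult.assoc)
          also have "\<delta> / 2 * \<bar>t\<bar> powr a + \<delta> / 2 * \<bar>t\<bar> powr a \<le> \<delta> * growth a q t"
            using \<delta> by (simp add: growth_def algebra_simps)
          finally show ?thesis by simp
        next
          assume s: "max T 1 \<le> \<bar>t\<bar>"
          then have "g t \<noteq> 0" by (auto simp: g_def)
          then have "\<bar>f0 t\<bar> = \<bar>f t / g t - L\<bar> * \<bar>g t\<bar>"
            by (simp add: f0_def abs_mult[symmetric] field_simps)
          also have "\<dots> \<le> \<delta> * \<bar>t\<bar> powr q"
            using T[of t] s by (intro mult_mono) (auto simp: absg)
          also have "\<dots> \<le> \<delta> * growth a q t" using \<delta> by (simp add: growth_def)
          finally show ?thesis .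
        qed
      qed
    qed
    qed
  qed
  moreover have "continuous_on UNIV f0"
    unfolding f0_def g_def by (intro continuous_intros cont continuous_signed_power aq)
  ultimately obtain C0 where C0: "0 \<le> C0" "\<And>x y. \<bar>f0 (x + y) - f0 x\<bar> \<le> \<delta> / 2 * growth a q x + C0 * growth a q y"
    using increment_bound_perturbation[of f0 a q "\<delta> / 2"] aq assms by auto
  define e where "e = \<delta> / (2 * (\<bar>L\<bar> + 1))"
  have e: "0 < e" "\<bar>L\<bar> * e \<le> \<delta> / 2" using assms by (auto simp: e_def field_simps)
  obtain C1 where C1: "0 \<le> C1" "\<And>x y. \<bar>g (x + y) - g x\<bar> \<le> e * \<bar>x\<bar> powr q + C1 * \<bar>y\<bar> powr q"
    using increment_bound_power[of q e] aq e unfolding g_def by auto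
  have "\<bar>f (x + y) - f x\<bar> \<le> \<delta> * growth a q x + (C0 + \<bar>L\<bar> * C1) * growth a q y" for x y
  proof -
    have "f (x + y) - f x = (f0 (x + y) - f0 x) + L * (g (x + y) - g x)"
      by (simp add: f0_def algebra_simps)
    then have "\<bar>f (x + y) - f x\<bar> \<le> \<bar>f0 (x + y) - f0 x\<bar> + \<bar>L\<bar> * \<bar>g (x + y) - g x\<bar>"
      using abs_triangle_ineq[of "f0 (x + y) - f0 x" "L * (g (x + y) - g x)"] by (simp add: abs_mult)
    also have "\<dots> \<le> (\<delta> / 2 * growth a q x + C0 * growth a q y) + \<bar>L\<bar> * (e * \<bar>x\<bar> powr q + C1 * \<bar>y\<bar> powr q)"
      by (intro add_mono C0 mult_left_mono C1) auto
    also have "\<dots> \<le> (\<delta> / 2 * growth a q x + C0 * growth a q y) + \<bar>L\<bar> * (e * growth a q x + C1 * growth a q y)"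
      using e C1(1) C0(1) assms by (intro add_left_mono mult_left_mono add_mono) (auto simp: growth_def)
    also have "\<dots> = (\<delta> / 2 + \<bar>L\<bar> * e) * growth a q x + (C0 + \<bar>L\<bar> * C1) * growth a q y"
      by (simp add: algebra_simps)
    also have "\<dots> \<le> \<delta> * growth a q x + (C0 + \<bar>L\<bar> * C1) * growth a q y"
      using e by (intro add_right_mono mult_right_mono) auto
    finally show ?thesis .
  qed
  then show ?thesis using C0 C1 by (intro exI[of _ "C0 + \<bar>L\<bar> * C1"]) auto
qed

lemma f_growth: "\<exists>c>0. \<forall>t. \<bar>f t\<bar> \<le> c * growth a q t"
proof -
  obtain C where "0 \<le> C" "\<And>x y. \<bar>f (x + y) - f x\<bar> \<le> 1 * growth a q x + C * growth a q y"
    using increment_bound[of 1] by auto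
  have "\<bar>f t\<bar> \<le> (C + 1) * growth a q t" for t
  proof -
    have "\<bar>f t\<bar> \<le> C * growth a q t"
      using \<open>\<And>x y. \<bar>f (x + y) - f x\<bar> \<le> 1 * growth a q x + C * growth a q y\<close>[of 0 t] by (simp add: growth_def)
    then show ?thesis by (simp add: distrib_right add_increasing2)
  qed
  then show ?thesis using \<open>0 \<le> C\<close> by (intro exI[of _ "C + 1"]) auto
qed

lemma splitting_bound:
  assumes "0 < \<delta>"
  shows "\<exists>C>0. \<forall>x y. \<bar>f (x + y) - f x - f y\<bar> \<le> \<delta> * growth a q x + C * growth a q y"
proof -
  obtain C where C: "0 \<le> C" "\<And>x y. \<bar>f (x + y) - f x\<bar> \<le> \<delta> * growth a q x + C * growth a q y"
    using increment_bound[OF assms] by auto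
  obtain c where c: "0 < c" "\<And>t. \<bar>f t\<bar> \<le> c * growth a q t" using f_growth by auto
  have "\<bar>f (x + y) - f x - f y\<bar> \<le> \<delta> * growth a q x + (C + c) * growth a q y" for x y
    using C(2)[of x y] c(2)[of y] by (simp add: algebra_simps)
  then show ?thesis using C c by (intro exI[of _ "C + c"]) auto
qed

end

locale critical_primitive = critical_nonlinearity +
  fixes F :: "real \<Rightarrow> real" and p :: real
  assumes F: "\<And>t. F t = (LBINT s=ereal 0..ereal t. f s)"
    and p: "1 \<le> p"
begin

lemma F_deriv: "(F has_real_derivative f t) (at t)"
proof -
  define b where "b = \<bar>t\<bar> + 1"
  have "((\<lambda>u. LBINT y=ereal 0..ereal u. f y) has_vector_derivative f t) (at t within {-b..b})"
    by (rule interval_integral_FTC2) (auto simp: b_def intro: continuous_on_subset[OF cont])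
  then have "(F has_real_derivative f t) (at t within {-b..b})"
    by (simp add: F[abs_def] has_real_derivative_iff_has_vector_derivative)
  then have "(F has_real_derivative f t) (at t within {-b<..<b})"
    by (rule DERIV_subset) auto
  then show ?thesis by (subst (asm) at_within_open) (auto simp: b_def)
qed

lemma F_0 [simp]: "F 0 = 0"
  by (simp add: F)

lemma F_cont: "continuous_on UNIV F"
  using F_deriv by (meson DERIV_isCont continuous_at_imp_continuous_on)

lemma F_measurable [measurable]: "F \<in> borel_measurable borel"
  using F_cont by (rule borel_measurable_continuous_onI)

lemma F_tendsto: "(x \<longlongrightarrow> c) G \<Longrightarrow> ((\<lambda>n. F (x n)) \<longlongrightarrow> F c) G"
  using F_cont by (simp add: continuous_on_eq_continuous_at isCont_tendsto_compose)

text \<open>By the mean value theorem the increment is at most \<open>|y|\<close> times the growth of \<open>|x| + |y|\<close>. Young's inequality with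
a small constant then separates the two factors of the \<open>p\<close>-th power.\<close>

lemma F_increment:
  assumes "0 < \<delta>"
  shows "\<exists>C>0. \<forall>x y. \<bar>F (x + y) - F x\<bar> powr p \<le> \<delta> * growth (p * (1 + a)) (p * (1 + q)) x + C * growth (p * (1 + a)) (p * (1 + q)) y"
proof -
  obtain c where c: "0 < c" "\<And>t. \<bar>f t\<bar> \<le> c * growth a q t" using f_growth by auto
  define m where "m x y = \<bar>x\<bar> + \<bar>y\<bar>" for x y :: real
  have mvt: "\<bar>F (x + y) - F x\<bar> \<le> c * (\<bar>y\<bar> * m x y powr a + \<bar>y\<bar> * m x y powr q)" for x y
  proof -
    have "norm (F (x + y) - F x) \<le> c * growth a q (m x y) * norm (x + y - x)"
    proof (rule field_differentiable_bound[where S = "closed_segment x (x + y)" and f' = f])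
      fix z assume z: "z \<in> closed_segment x (x + y)"
      show "(F has_field_derivative f z) (at z within closed_segment x (x + y))"
        by (rule has_field_derivative_at_within[OF F_deriv])
      have "\<bar>z\<bar> \<le> \<bar>m x y\<bar>" using z by (auto simp: m_def closed_segment_eq_real_ivl split: if_splits)
      then have "c * growth a q z \<le> c * growth a q (m x y)" using c aq by (intro mult_left_mono growth_mono) auto
      then show "norm (f z) \<le> c * growth a q (m x y)" using c(2)[of z] by simp
    qed auto
    then show ?thesis by (simp add: growth_def m_def algebra_simps)
  qed
  have pw: "(u + v) powr p \<le> 2 powr p * (u powr p + v powr p)" if "0 \<le> u" "0 \<le> v" for u v :: real
    using powr_add_bound[of p u v] that p by simp
  let ?P = "p * (1 + a)" and ?Q = "p * (1 + q)"
  define k where "k = c powr p * 2 powr p * (2 powr ?P + 2 powr ?Q)"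
  have k: "0 < k" using c by (auto simp: k_def intro!: mult_pos_pos add_pos_pos)
  define e where "e = \<delta> / k"
  have e: "0 < e" "e * k = \<delta>" using k assms by (auto simp: e_def)
  obtain C1 where C1: "0 < C1" "\<And>x y. 0 \<le> x \<Longrightarrow> 0 \<le> y \<Longrightarrow> x powr p * y powr (p * a) \<le> e * y powr (p + p * a) + C1 * x powr (p + p * a)"
    using young_small[of p "p * a" e] p aq e by auto
  obtain C2 where C2: "0 < C2" "\<And>x y. 0 \<le> x \<Longrightarrow> 0 \<le> y \<Longrightarrow> x powr p * y powr (p * q) \<le> e * y powr (p + p * q) + C2 * x powr (p + p * q)"
    using young_small[of p "p * q" e] p aq e by auto
  define C where "C = \<delta> + c powr p * 2 powr p * (C1 + C2)"
  have "\<bar>F (x + y) - F x\<bar> powr p \<le> \<delta> * growth ?P ?Q x + C * growth ?P ?Q y" for x y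
  proof -
    have m0: "0 \<le> m x y" by (simp add: m_def)
    have "\<bar>F (x + y) - F x\<bar> powr p \<le> (c * (\<bar>y\<bar> * m x y powr a + \<bar>y\<bar> * m x y powr q)) powr p"
      using mvt[of x y] p by (intro powr_mono2) auto
    also have "\<dots> = c powr p * (\<bar>y\<bar> * m x y powr a + \<bar>y\<bar> * m x y powr q) powr p"
      using c by (intro powr_mult)
    also have "\<dots> \<le> c powr p * (2 powr p * ((\<bar>y\<bar> * m x y powr a) powr p + (\<bar>y\<bar> * m x y powr q) powr p))"
      using m0 by (intro mult_left_mono pw) auto
    also have "(\<bar>y\<bar> * m x y powr a) powr p = \<bar>y\<bar> powr p * m x y powr (p * a)"
      using m0 by (simp add: powr_mult powr_powr mult.commute)
    also have "(\<bar>y\<bar> * m x y powr q) powr p = \<bar>y\<bar> powr p * m x y powr (p * q)"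
      using m0 by (simp add: powr_mult powr_powr mult.commute)
    also have "c powr p * (2 powr p * (\<bar>y\<bar> powr p * m x y powr (p * a) + \<bar>y\<bar> powr p * m x y powr (p * q)))
      \<le> c powr p * (2 powr p * ((e * m x y powr (p + p * a) + C1 * \<bar>y\<bar> powr (p + p * a)) + (e * m x y powr (p + p * q) + C2 * \<bar>y\<bar> powr (p + p * q))))"
      using m0 by (intro mult_left_mono add_mono C1 C2) auto
    also have "\<dots> \<le> c powr p * (2 powr p * ((e * (2 powr ?P * (\<bar>x\<bar> powr ?P + \<bar>y\<bar> powr ?P)) + C1 * \<bar>y\<bar> powr ?P) + (e * (2 powr ?Q * (\<bar>x\<bar> powr ?Q + \<bar>y\<bar> powr ?Q)) + C2 * \<bar>y\<bar> powr ?Q)))"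
    proof -
      have "0 < ?P" "0 < ?Q" using p aq by (auto intro!: mult_pos_pos)
      then have "m x y powr ?P \<le> 2 powr ?P * (\<bar>x\<bar> powr ?P + \<bar>y\<bar> powr ?P)"
        "m x y powr ?Q \<le> 2 powr ?Q * (\<bar>x\<bar> powr ?Q + \<bar>y\<bar> powr ?Q)"
        unfolding m_def by (intro powr_add_bound; simp)+
      moreover have "p + p * a = ?P" "p + p * q = ?Q" by (auto simp: algebra_simps)
      ultimately show ?thesis using e(1) C1(1)[THEN less_imp_le] C2(1)[THEN less_imp_le] by (simp only:, intro mult_left_mono add_mono) auto
    qed
    also have "\<dots> \<le> c powr p * (2 powr p * (e * ((2 powr ?P + 2 powr ?Q) * (growth ?P ?Q x + growth ?P ?Q y)) + (C1 + C2) * growth ?P ?Q y))"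
    proof -
      have "2 powr ?P * (\<bar>x\<bar> powr ?P + \<bar>y\<bar> powr ?P) + 2 powr ?Q * (\<bar>x\<bar> powr ?Q + \<bar>y\<bar> powr ?Q) \<le> (2 powr ?P + 2 powr ?Q) * (growth ?P ?Q x + growth ?P ?Q y)"
      proof -
        have "2 powr ?P * (\<bar>x\<bar> powr ?P + \<bar>y\<bar> powr ?P) \<le> 2 powr ?P * (growth ?P ?Q x + growth ?P ?Q y)"
          "2 powr ?Q * (\<bar>x\<bar> powr ?Q + \<bar>y\<bar> powr ?Q) \<le> 2 powr ?Q * (growth ?P ?Q x + growth ?P ?Q y)"
          by (intro mult_left_mono; simp add: growth_def)+
        then show ?thesis by (simp only: distrib_right)
      qed
      then have "e * (2 powr ?P * (\<bar>x\<bar> powr ?P + \<bar>y\<bar> powr ?P) + 2 powr ?Q * (\<bar>x\<bar> powr ?Q + \<bar>y\<bar> powr ?Q)) \<le> e * ((2 powr ?P + 2 powr ?Q) * (growth ?P ?Q x + growth ?P ?Q y))"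
        using e by (intro mult_left_mono) auto
      moreover have "C1 * \<bar>y\<bar> powr ?P + C2 * \<bar>y\<bar> powr ?Q \<le> (C1 + C2) * growth ?P ?Q y"
        using C1(1) C2(1) by (simp add: growth_def algebra_simps)
      ultimately have "(e * (2 powr ?P * (\<bar>x\<bar> powr ?P + \<bar>y\<bar> powr ?P)) + C1 * \<bar>y\<bar> powr ?P) + (e * (2 powr ?Q * (\<bar>x\<bar> powr ?Q + \<bar>y\<bar> powr ?Q)) + C2 * \<bar>y\<bar> powr ?Q)
         \<le> e * ((2 powr ?P + 2 powr ?Q) * (growth ?P ?Q x + growth ?P ?Q y)) + (C1 + C2) * growth ?P ?Q y"
        by (simp only: distrib_left)
      then show ?thesis by (intro mult_left_mono) auto
    qed
    also have "\<dots> = e * k * (growth ?P ?Q x + growth ?P ?Q y) + c powr p * 2 powr p * (C1 + C2) * growth ?P ?Q y"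
      by (simp add: k_def algebra_simps)
    also have "\<dots> = \<delta> * growth ?P ?Q x + C * growth ?P ?Q y"
      unfolding e(2) by (simp add: C_def algebra_simps)
    finally show ?thesis .
  qed
  moreover have "0 < C" using assms c C1 C2 by (auto simp: C_def intro!: add_pos_nonneg)
  ultimately show ?thesis by blast
qed

lemma F_growth: "\<exists>c>0. \<forall>t. \<bar>F t\<bar> powr p \<le> c * growth (p * (1 + a)) (p * (1 + q)) t"
proof -
  obtain C where C: "C > 0" "\<And>x y. \<bar>F (x + y) - F x\<bar> powr p \<le> 1 * growth (p * (1 + a)) (p * (1 + q)) x + C * growth (p * (1 + a)) (p * (1 + q)) y"
    using F_increment[of 1] by auto
  from C(2)[of 0] have "\<bar>F t\<bar> powr p \<le> C * growth (p * (1 + a)) (p * (1 + q)) t" for t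
    by (auto simp: growth_def)
  then show ?thesis using C by blast
qed

lemma F_splitting_bound:
  assumes "0 < \<delta>"
  shows "\<exists>C>0. \<forall>x y. \<bar>F (x + y) - F x - F y\<bar> powr p \<le> \<delta> * growth (p * (1 + a)) (p * (1 + q)) x + C * growth (p * (1 + a)) (p * (1 + q)) y"
proof -
  let ?H = "growth (p * (1 + a)) (p * (1 + q))"
  obtain C where C: "C > 0" "\<And>x y. \<bar>F (x + y) - F x\<bar> powr p \<le> \<delta> / 2 powr p * ?H x + C * ?H y"
    using F_increment[of "\<delta> / 2 powr p"] assms by auto
  obtain c where c: "0 < c" "\<And>t. \<bar>F t\<bar> powr p \<le> c * ?H t" using F_growth by auto
  have "\<bar>F (x + y) - F x - F y\<bar> powr p \<le> \<delta> * ?H x + 2 powr p * (C + c) * ?H y" for x y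
  proof -
    have "\<bar>F (x + y) - F x - F y\<bar> powr p \<le> (\<bar>F (x + y) - F x\<bar> + \<bar>F y\<bar>) powr p"
      using p by (intro powr_mono2) auto
    also have "\<dots> \<le> 2 powr p * (\<bar>F (x + y) - F x\<bar> powr p + \<bar>F y\<bar> powr p)"
      using p by (intro powr_add_bound) auto
    also have "\<dots> \<le> 2 powr p * ((\<delta> / 2 powr p * ?H x + C * ?H y) + c * ?H y)"
      by (intro mult_left_mono add_mono C c) auto
    also have "\<dots> = \<delta> * ?H x + 2 powr p * (C + c) * ?H y" by (simp add: algebra_simps)
    finally show ?thesis .
  qed
  moreover have "0 < 2 powr p * (C + c)" using C c by simp
  ultimately show ?thesis by blast
qed

end

section \<open>Smooth bump functions\<close>

text \<open>The family \<open>exp(-1/t) / t^m\<close>, continued by zero. Including the powers \<open>m\<close> makes it closed under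
differentiation up to linear combinations, which is what an induction over the order of smoothness
requires.\<close>

definition flat_exp :: "nat \<Rightarrow> real \<Rightarrow> real" where
  "flat_exp m t = (if 0 < t then exp (- (1 / t)) / t ^ m else 0)"

lemma flat_exp_nonneg: "0 \<le> flat_exp m t"
  by (simp add: flat_exp_def)

lemma flat_exp_tendsto_0: "(flat_exp m \<longlongrightarrow> 0) (at 0)"
proof -
  have "((\<lambda>t::real. inverse t ^ m / exp (inverse t)) \<longlongrightarrow> 0) (at_right 0)"
    by (rule filterlim_compose[OF tendsto_power_div_exp_0 filterlim_inverse_at_top_right])
  then have "(flat_exp m \<longlongrightarrow> 0) (at_right 0)"
    by (rule Lim_transform_eventually)
       (auto simp: eventually_at_right_less flat_exp_def exp_minus field_simps intro!: eventually_mono[OF eventually_at_right_less])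
  moreover have "(flat_exp m \<longlongrightarrow> 0) (at_left 0)"
    by (rule Lim_transform_eventually[OF tendsto_const])
       (auto simp: eventually_at_filter flat_exp_def)
  ultimately show ?thesis by (simp add: filterlim_at_split)
qed

lemma flat_exp_deriv: "(flat_exp m has_real_derivative flat_exp (m + 2) t - real m * flat_exp (m + 1) t) (at t)"
proof (cases "t = 0")
  case True
  have "((\<lambda>h. flat_exp (m + 1) h) \<longlongrightarrow> 0) (at 0)" by (rule flat_exp_tendsto_0)
  then have "((\<lambda>h. (flat_exp m (0 + h) - flat_exp m 0) / h) \<longlongrightarrow> 0) (at 0)"
    by (rule Lim_transform_eventually) (auto simp: eventually_at_filter flat_exp_def field_simps)
  then show ?thesis using True by (simp add: DERIV_def flat_exp_def)
next
  case False
  show ?thesis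
  proof (cases "0 < t")
    case True
    have "((\<lambda>t. exp (- (1 / t)) / t ^ m) has_real_derivative flat_exp (m + 2) t - real m * flat_exp (m + 1) t) (at t)"
    proof -
      have pm: "real m * t ^ (m - Suc 0) = real m * t ^ m / t" using True by (cases m) auto
      have "((\<lambda>t. exp (- (1 / t)) / t ^ m) has_real_derivative
          ((exp (- (1 / t)) * (1 / t\<^sup>2)) * t ^ m - exp (- (1 / t)) * (real m * t ^ (m - Suc 0))) / (t ^ m * t ^ m)) (at t)"
        using True by (auto intro!: derivative_eq_intros simp: power2_eq_square)
      moreover have "((exp (- (1 / t)) * (1 / t\<^sup>2)) * t ^ m - exp (- (1 / t)) * (real m * t ^ (m - Suc 0))) / (t ^ m * t ^ m)
          = flat_exp (m + 2) t - real m * flat_exp (m + 1) t"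
        unfolding pm using True by (simp add: flat_exp_def power_add field_simps power2_eq_square)
      ultimately show ?thesis by (simp only:)
    qed
    then show ?thesis
      by (rule has_field_derivative_transform_within_open[where S = "{0<..}"]) (use True in \<open>auto simp: flat_exp_def\<close>)
  next
    case f: False
    have "((\<lambda>t. 0) has_real_derivative flat_exp (m + 2) t - real m * flat_exp (m + 1) t) (at t)"
      using f by (auto simp: flat_exp_def)
    then show ?thesis
      by (rule has_field_derivative_transform_within_open[where S = "{..<0}"]) (use f False in \<open>auto simp: flat_exp_def\<close>)
  qed
qed

lemma continuous_flat_exp: "continuous_on UNIV (flat_exp m)"
  by (intro continuous_at_imp_continuous_on ballI DERIV_isCont[OF flat_exp_deriv])

lemma pderiv_at_eq:
  assumes "(\<psi> has_derivative D) (at x)"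
  shows "pderiv_at i \<psi> x = D (axis i 1)"
  using frechet_derivative_at[OF assms] by (simp add: pderiv_at_def)

lemma C_diff_SucD: "C_diff (Suc k) \<psi> \<Longrightarrow> C_diff k \<psi>"
proof (induction k arbitrary: \<psi>)
  case 0
  then show ?case
    by (auto simp: continuous_on_eq_continuous_at intro: differentiable_imp_continuous_within)
next
  case (Suc k)
  then have "\<forall>x. \<psi> differentiable (at x)" "\<And>i. C_diff (Suc k) (pderiv_at i \<psi>)" by auto
  then show ?case using Suc.IH by auto
qed

lemma C_diff_const: "C_diff k (\<lambda>x. c)"
proof (induction k arbitrary: c)
  case (Suc k)
  have "pderiv_at i (\<lambda>x. c) = (\<lambda>x. 0)" for i :: 'a
    by (rule ext) (rule pderiv_at_eq[OF has_derivative_const])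
  then show ?case using Suc by auto
qed auto

lemma C_diff_add: "C_diff k \<psi> \<Longrightarrow> C_diff k \<theta> \<Longrightarrow> C_diff k (\<lambda>x. \<psi> x + \<theta> x)"
proof (induction k arbitrary: \<psi> \<theta>)
  case (Suc k)
  have "pderiv_at i (\<lambda>x. \<psi> x + \<theta> x) = (\<lambda>x. pderiv_at i \<psi> x + pderiv_at i \<theta> x)" for i
  proof
    fix x
    have "(\<psi> has_derivative frechet_derivative \<psi> (at x)) (at x)" "(\<theta> has_derivative frechet_derivative \<theta> (at x)) (at x)"
      using Suc.prems by (auto simp: frechet_derivative_works[symmetric])
    from pderiv_at_eq[OF has_derivative_add[OF this]]
    show "pderiv_at i (\<lambda>x. \<psi> x + \<theta> x) x = pderiv_at i \<psi> x + pderiv_at i \<theta> x" by (simp add: pderiv_at_def)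
  qed
  then show ?case using Suc by auto
qed (auto intro: continuous_intros)

lemma C_diff_mult: "C_diff k \<psi> \<Longrightarrow> C_diff k \<theta> \<Longrightarrow> C_diff k (\<lambda>x. \<psi> x * \<theta> x)"
proof (induction k arbitrary: \<psi> \<theta>)
  case (Suc k)
  have "pderiv_at i (\<lambda>x. \<psi> x * \<theta> x) = (\<lambda>x. \<psi> x * pderiv_at i \<theta> x + pderiv_at i \<psi> x * \<theta> x)" for i
  proof
    fix x
    have "(\<psi> has_derivative frechet_derivative \<psi> (at x)) (at x)" "(\<theta> has_derivative frechet_derivative \<theta> (at x)) (at x)"
      using Suc.prems by (auto simp: frechet_derivative_works[symmetric])
    from pderiv_at_eq[OF has_derivative_mult[OF this]]
    show "pderiv_at i (\<lambda>x. \<psi> x * \<theta> x) x = \<psi> x * pderiv_at i \<theta> x + pderiv_at i \<psi> x * \<theta> x" by (simp add: pderiv_at_def)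
  qed
  then show ?case using Suc C_diff_SucD[OF Suc.prems(1)] C_diff_SucD[OF Suc.prems(2)]
    by (auto intro!: C_diff_add Suc.IH)
qed (auto intro: continuous_intros)

lemma has_derivative_sqdist:
  "((\<lambda>y. r - (norm (y - c))\<^sup>2) has_derivative (\<lambda>h. - (2 * ((y - c) \<bullet> h)))) (at y)"
  for y c :: "'a::real_inner"
  unfolding power2_norm_eq_inner by (auto intro!: derivative_eq_intros simp: inner_commute)

lemma C_diff_coord: "C_diff k (\<lambda>y. -2 * (y - c) $ i)"
proof (cases k)
  case (Suc l)
  have d: "((\<lambda>y. -2 * (y - c) $ i) has_derivative (\<lambda>h. -2 * h $ i)) (at y)" for y
    by (auto intro!: derivative_eq_intros bounded_linear.has_derivative[OF bounded_linear_vec_nth])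
  then have "pderiv_at j (\<lambda>y. -2 * (y - c) $ i) = (\<lambda>y. -2 * axis j 1 $ i)" for j
    by (intro ext pderiv_at_eq)
  then show ?thesis using Suc d C_diff_const by (auto simp: differentiable_def)
qed (auto intro!: continuous_intros)

lemma pderiv_at_sqdist: "pderiv_at i (\<lambda>y. r - (norm (y - c))\<^sup>2) = (\<lambda>y. -2 * (y - c) $ i)"
  by (rule ext) (simp add: pderiv_at_eq[OF has_derivative_sqdist] inner_axis)

text \<open>Induction on \<open>k\<close> for all \<open>m\<close> at once: a partial derivative is a combination of members with larger \<open>m\<close>,
multiplied by an affine function.\<close>

lemma C_diff_flat_exp: "C_diff k (\<lambda>y::real^'n. flat_exp m (r - (norm (y - c))\<^sup>2))"
proof (induction k arbitrary: m)
  case 0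
  have "continuous_on UNIV (flat_exp m)"
    by (rule continuous_flat_exp)
  then show ?case by (auto intro!: continuous_intros continuous_on_compose2[of UNIV "flat_exp m"])
next
  case (Suc k)
  let ?s = "\<lambda>y::real^'n. r - (norm (y - c))\<^sup>2"
  have d: "((\<lambda>y. flat_exp m (?s y)) has_derivative (\<lambda>h. (flat_exp (m + 2) (?s y) - real m * flat_exp (m + 1) (?s y)) * (- (2 * ((y - c) \<bullet> h))))) (at y)" for y
    using has_derivative_compose[OF has_derivative_sqdist flat_exp_deriv[unfolded has_field_derivative_def]] .
  have "pderiv_at i (\<lambda>y. flat_exp m (?s y)) = (\<lambda>y. (flat_exp (m + 2) (?s y) + (- real m) * flat_exp (m + 1) (?s y)) * (-2 * (y - c) $ i))" for i
    by (rule ext) (simp add: pderiv_at_eq[OF d] inner_axis)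
  moreover have "C_diff k (\<lambda>y. (flat_exp (m + 2) (?s y) + (- real m) * flat_exp (m + 1) (?s y)) * (-2 * (y - c) $ i))" for i
    by (intro C_diff_mult C_diff_add C_diff_const C_diff_coord Suc)
  ultimately have "C_diff k (pderiv_at i (\<lambda>y. flat_exp m (?s y)))" for i by (simp only:)
  then show ?case using d unfolding C_diff.simps differentiable_def by blast
qed

definition bump :: "real \<Rightarrow> real ^ 'n \<Rightarrow> real" where
  "bump e z = flat_exp 0 (e\<^sup>2 - (norm z)\<^sup>2)"

text \<open>The \<open>i\<close>-th partial derivative of \<open>bump e\<close>.\<close>

definition bump_deriv :: "real \<Rightarrow> 'n \<Rightarrow> real ^ 'n \<Rightarrow> real" where
  "bump_deriv e i z = flat_exp 2 (e\<^sup>2 - (norm z)\<^sup>2) * (-2 * z $ i)"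

lemma bump_nonneg: "0 \<le> bump e z" by (simp add: bump_def flat_exp_nonneg)

lemma bump_pos: "norm z < e \<Longrightarrow> 0 < bump e z"
  by (simp add: bump_def flat_exp_def abs_square_less_1 power_strict_mono)

lemma bump_support: "0 < e \<Longrightarrow> e \<le> norm z \<Longrightarrow> bump e z = 0" for z :: "real ^ 'n::finite"
proof -
  assume "0 < e" "e \<le> norm z"
  then have "e\<^sup>2 \<le> (norm z)\<^sup>2" by (intro power_mono) auto
  then have "\<not> 0 < e\<^sup>2 - (norm z)\<^sup>2" by linarith
  then show ?thesis by (simp only: bump_def flat_exp_def if_False mult_zero_left)
qed

lemma bump_deriv_support: "0 < e \<Longrightarrow> e \<le> norm z \<Longrightarrow> bump_deriv e i z = 0" for z :: "real ^ 'n::finite"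
proof -
  assume "0 < e" "e \<le> norm z"
  then have "e\<^sup>2 \<le> (norm z)\<^sup>2" by (intro power_mono) auto
  then have "\<not> 0 < e\<^sup>2 - (norm z)\<^sup>2" by linarith
  then show ?thesis by (simp only: bump_deriv_def flat_exp_def if_False mult_zero_left)
qed

lemma bump_has_derivative:
  "(bump e has_derivative (\<lambda>h. \<Sum>i\<in>UNIV. h $ i * bump_deriv e i z)) (at z)"
proof -
  have "((\<lambda>y. flat_exp 0 (e\<^sup>2 - (norm (y - 0))\<^sup>2)) has_derivative
      (\<lambda>h. (flat_exp (0 + 2) (e\<^sup>2 - (norm (z - 0))\<^sup>2) - real 0 * flat_exp (0 + 1) (e\<^sup>2 - (norm (z - 0))\<^sup>2)) * (- (2 * ((z - 0) \<bullet> h))))) (at z)"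
    using has_derivative_compose[OF has_derivative_sqdist flat_exp_deriv[unfolded has_field_derivative_def]] .
  moreover have "flat_exp 2 (e\<^sup>2 - (norm z)\<^sup>2) * (- (2 * (z \<bullet> h))) = (\<Sum>i\<in>UNIV. h $ i * bump_deriv e i z)" for h
    by (simp add: bump_deriv_def inner_vec_def sum_distrib_left sum_distrib_right sum_negf[symmetric] mult_ac)
  ultimately show ?thesis by (simp add: bump_def[abs_def] numeral_2_eq_2)
qed

lemma continuous_bump: "continuous_on UNIV (bump e)"
  using has_derivative_continuous[OF bump_has_derivative] by (auto simp: continuous_on_eq_continuous_at)

lemma continuous_bump_deriv: "continuous_on UNIV (bump_deriv e i)"
proof -
  have "continuous_on UNIV (\<lambda>z :: real ^ 'a. flat_exp 2 (e\<^sup>2 - (norm z)\<^sup>2))"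
    by (rule continuous_on_compose2[OF continuous_flat_exp]) (auto intro!: continuous_intros)
  moreover have "continuous_on UNIV (\<lambda>z :: real ^ 'a. -2 * z $ i)"
    by (intro continuous_intros)
  ultimately show ?thesis unfolding bump_deriv_def[abs_def] by (rule continuous_on_mult)
qed

lemma bump_measurable [measurable]: "bump e \<in> borel_measurable borel"
  by (rule borel_measurable_continuous_onI[OF continuous_bump])

lemma bump_deriv_measurable [measurable]: "bump_deriv e i \<in> borel_measurable borel"
  by (rule borel_measurable_continuous_onI[OF continuous_bump_deriv])

lemma bump_le_1: "bump e z \<le> 1"
  by (simp add: bump_def flat_exp_def)

lemma bump_deriv_bounded:
  assumes "0 < e"
  obtains B where "0 < B" "\<And>(i::'n::finite) z. \<bar>bump_deriv e i z\<bar> \<le> B"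
proof -
  have "\<exists>B. \<forall>z. \<bar>bump_deriv e i z\<bar> \<le> B" for i :: 'n
  proof -
    have "compact (bump_deriv e i ` cball 0 e)"
      by (intro compact_continuous_image continuous_on_subset[OF continuous_bump_deriv]) auto
    then obtain B where B: "\<And>z. z \<in> cball 0 e \<Longrightarrow> \<bar>bump_deriv e i z\<bar> \<le> B"
      using compact_imp_bounded[of "bump_deriv e i ` cball 0 e"] unfolding bounded_iff by (metis image_eqI real_norm_def)
    have "\<bar>bump_deriv e i z\<bar> \<le> \<bar>B\<bar>" for z
      using B[of z] bump_deriv_support[OF assms, of z i] by (cases "norm z \<le> e") (auto intro: order_trans)
    then show ?thesis by blast
  qed
  then obtain B where B: "\<And>(i::'n) z. \<bar>bump_deriv e i z\<bar> \<le> B i" by metis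
  have "\<bar>bump_deriv e i z\<bar> \<le> (\<Sum>i\<in>UNIV. \<bar>B i\<bar>) + 1" for i :: 'n and z
  proof -
    have "\<bar>bump_deriv e i z\<bar> \<le> \<bar>B i\<bar>" using B[of i z] by linarith
    also have "\<dots> \<le> (\<Sum>i\<in>UNIV. \<bar>B i\<bar>)" by (rule member_le_sum) auto
    finally show ?thesis by simp
  qed
  then show ?thesis by (intro that[of "(\<Sum>i\<in>UNIV. \<bar>B i\<bar>) + 1"]) (auto intro: add_nonneg_pos sum_nonneg)
qed

lemma test_function_bump:
  assumes "0 < e"
  shows "test_function (\<lambda>y. bump e (x - y))"
proof -
  have eq: "(\<lambda>y. bump e (x - y)) = (\<lambda>y. flat_exp 0 (e\<^sup>2 - (norm (y - x))\<^sup>2))"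
    by (simp add: bump_def norm_minus_commute)
  have "{y. bump e (x - y) \<noteq> 0} \<subseteq> cball x e"
  proof
    fix y assume "y \<in> {y. bump e (x - y) \<noteq> 0}"
    then show "y \<in> cball x e" using bump_support[OF assms, of "x - y"] by (force simp: dist_norm)
  qed
  then have "bounded {y. bump e (x - y) \<noteq> 0}" by (rule bounded_subset[rotated]) simp
  moreover have "\<forall>k. C_diff k (\<lambda>y. bump e (x - y))" unfolding eq using C_diff_flat_exp by blast
  ultimately show ?thesis by (simp add: test_function_def compact_closure)
qed

lemma pderiv_at_bump: "pderiv_at i (\<lambda>y. bump e (x - y)) y = - bump_deriv e i (x - y)"
proof -
  have "((\<lambda>y. bump e (x - y)) has_derivative (\<lambda>h. \<Sum>i\<in>UNIV. (- h) $ i * bump_deriv e i (x - y))) (at y)"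
    by (rule has_derivative_compose[OF _ bump_has_derivative]) (auto intro!: derivative_eq_intros)
  from pderiv_at_eq[OF this, of i] show ?thesis
    by (simp add: axis_def if_distrib if_distribR sum.delta' cong: if_cong)
qed

section \<open>Mollification\<close>

lemma nn_integral_lborel_affine:
  fixes t :: "'a::euclidean_space" and c :: real
  assumes [measurable]: "f \<in> borel_measurable borel" and "c \<noteq> 0"
  shows "(\<integral>\<^sup>+x. f x \<partial>lborel) = ennreal (\<bar>c\<bar> ^ DIM('a)) * (\<integral>\<^sup>+x. f (t + c *\<^sub>R x) \<partial>lborel)"
  by (subst lborel_affine[OF assms(2), of t])
     (simp add: nn_integral_density nn_integral_distr nn_integral_cmult)

lemma lp_le_2_iff:
  "lp_le 2 a u \<longleftrightarrow> u \<in> borel_measurable borel \<and> 0 \<le> a \<and> (\<integral>\<^sup>+x. ennreal ((u x)\<^sup>2) \<partial>lborel) \<le> ennreal (a\<^sup>2)"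
  by (auto simp: lp_le_def)

lemma integrable_square_lp_le:
  assumes "lp_le 2 a u"
  shows "integrable lborel (\<lambda>y. (u y)\<^sup>2)"
  using assms by (auto simp: lp_le_2_iff integrable_iff_bounded intro: le_less_trans)

text \<open>On the ball \<open>|u| \<le> 1 + u\<^sup>2\<close>.\<close>

lemma integrable_times_compact_support:
  fixes u k :: "'a::euclidean_space \<Rightarrow> real"
  assumes u: "lp_le 2 a u" and [measurable]: "k \<in> borel_measurable borel"
    and k: "\<And>y. \<bar>k y\<bar> \<le> B" "\<And>y. y \<notin> cball x r \<Longrightarrow> k y = 0"
  shows "integrable lborel (\<lambda>y. u y * k y)"
proof (rule Bochner_Integration.integrable_bound)
  have [measurable]: "u \<in> borel_measurable borel" using u by (simp add: lp_le_def)
  have "integrable lborel (indicator (cball x r) :: 'a \<Rightarrow> real)"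
    using emeasure_bounded_finite[of "cball x r"] by (intro integrable_real_indicator) auto
  then show "integrable lborel (\<lambda>y. B * (indicator (cball x r) y + (u y)\<^sup>2))"
    by (intro integrable_mult_right Bochner_Integration.integrable_add integrable_square_lp_le[OF u]) auto
  show "AE y in lborel. norm (u y * k y) \<le> norm (B * (indicator (cball x r) y + (u y)\<^sup>2))"
  proof (rule AE_I2)
    fix y
    have B: "0 \<le> B" using k(1)[of y] by linarith
    show "norm (u y * k y) \<le> norm (B * (indicator (cball x r) y + (u y)\<^sup>2))"
    proof (cases "y \<in> cball x r")
      case True
      have "\<bar>u y\<bar> \<le> 1 + (u y)\<^sup>2" using sum_squares_bound[of "\<bar>u y\<bar>" 1] by (auto simp: power2_eq_square) 
      then have "\<bar>u y\<bar> * \<bar>k y\<bar> \<le> (1 + (u y)\<^sup>2) * B" using k(1)[of y] by (intro mult_mono) auto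
      then show ?thesis using True B by (simp add: abs_mult mult.commute)
    qed (use k(2) in auto)
  qed
qed (use lp_leD(1)[OF u] in simp)

text \<open>Convolution with the bump function, not divided by its mass; the mass is accounted for separately.\<close>

definition mollify :: "real \<Rightarrow> (real ^ 'n \<Rightarrow> real) \<Rightarrow> real ^ 'n \<Rightarrow> real" where
  "mollify e u x = (\<integral>y. u y * bump e (x - y) \<partial>lborel)"

lemma mollify_measurable [measurable]:
  assumes [measurable]: "u \<in> borel_measurable borel"
  shows "mollify e u \<in> borel_measurable borel"
  unfolding mollify_def by measurable

lemma bump_outside: "0 < e \<Longrightarrow> y \<notin> cball x e \<Longrightarrow> bump e (x - y) = 0"
  for x :: "real ^ 'n::finite"
  using bump_support[of e "x - y"] by (simp add: dist_norm)

lemma integrable_mollify: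
  assumes "0 < e" "lp_le 2 a u"
  shows "integrable lborel (\<lambda>y. u y * bump e (x - y))"
  using assms
  by (intro integrable_times_compact_support[where B = 1 and x = x and r = e]) (auto intro!: bump_outside simp: abs_of_nonneg bump_nonneg bump_le_1)

lemma abs_integral_le_nn_integral:
  fixes f :: "'a \<Rightarrow> real"
  shows "ennreal \<bar>integral\<^sup>L M f\<bar> \<le> (\<integral>\<^sup>+x. ennreal \<bar>f x\<bar> \<partial>M)"
proof (cases "integrable M f")
  case True
  then show ?thesis using integral_norm_bound_ennreal[OF True] by simp
qed (simp add: not_integrable_integral_eq)

text \<open>The fundamental theorem of calculus for the bump function along the segment from \<open>x\<close> to \<open>x + T h\<close>,
integrated against \<open>u\<close>. After exchanging the integrals the derivative falls on the bump function, and
\<open>parts\<close> moves it to \<open>u\<close>.\<close>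

lemma mollify_line:
  fixes u :: "real ^ 'n::finite \<Rightarrow> real"
  assumes e: "0 < e" and u: "lp_le 2 a u" and [measurable]: "\<And>i. g i \<in> borel_measurable borel"
    and parts: "\<And>i x. (\<integral>y. u y * bump_deriv e i (x - y) \<partial>lborel) = mollify e (g i) x"
    and T: "0 \<le> T"
  shows "ennreal \<bar>mollify e u x\<bar> \<le> ennreal \<bar>mollify e u (x + T *\<^sub>R h)\<bar>
    + (\<integral>\<^sup>+s. ennreal (norm h * norm (\<chi> i. mollify e (g i) (x + s *\<^sub>R h))) * indicator {0..T} s \<partial>lborel)"
proof -
  have [measurable]: "u \<in> borel_measurable borel" using u by (simp add: lp_le_def)
  define D where "D s y = (\<Sum>i\<in>UNIV. h $ i * bump_deriv e i (x + s *\<^sub>R h - y))" for s y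
  obtain B where B: "0 < B" "\<And>i z. \<bar>bump_deriv e (i::'n) z\<bar> \<le> B" using bump_deriv_bounded[OF e] by blast
  have [measurable]: "(\<lambda>(y, s). D s y) \<in> borel_measurable (borel \<Otimes>\<^sub>M borel)" unfolding D_def by measurable
  have [measurable]: "(\<lambda>y. D s y) \<in> borel_measurable borel" "(\<lambda>s. D s y) \<in> borel_measurable borel" for s y
    unfolding D_def by measurable
  define H where "H = (\<Sum>i\<in>UNIV. \<bar>h $ i\<bar>) * B"
  have H0: "0 \<le> H" using B by (auto simp: H_def intro!: mult_nonneg_nonneg sum_nonneg)
  have DH: "\<bar>D s y\<bar> \<le> H" for s y
    unfolding D_def H_def sum_distrib_right
    by (rule order_trans[OF sum_abs]) (auto intro!: sum_mono mult_left_mono B simp: abs_mult)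
  define R where "R = e + T * norm h"
  have D0: "D s y = 0" if "y \<notin> cball x R" "s \<in> {0..T}" for s y
  proof -
    have "norm (x - y) \<le> norm (x + s *\<^sub>R h - y) + norm (s *\<^sub>R h)"
      using norm_triangle_ineq4[of "x + s *\<^sub>R h - y" "s *\<^sub>R h"] by (simp add: algebra_simps)
    moreover have "norm (s *\<^sub>R h) \<le> T * norm h" using that by (auto intro!: mult_right_mono)
    ultimately have "e \<le> norm (x + s *\<^sub>R h - y)" using that by (simp add: R_def dist_norm)
    then show ?thesis by (simp add: D_def bump_deriv_support[OF e])
  qed
  have [measurable]: "cball x R \<in> sets borel" by simp
  define P where "P y s = u y * (indicator {0..T} s * D s y)" for y s
  have Pm: "case_prod P \<in> borel_measurable (lborel \<Otimes>\<^sub>M lborel)" unfolding P_def by measurable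
  have "integrable lborel (\<lambda>y. u y * (H * indicator (cball x R) y))"
    by (rule integrable_times_compact_support[OF u, where B = H and x = x and r = R]) (use H0 in \<open>auto simp: indicator_def\<close>)
  then have fin: "(\<integral>\<^sup>+y. ennreal \<bar>u y * (H * indicator (cball x R) y)\<bar> \<partial>lborel) < \<infinity>"
    by (simp add: integrable_iff_bounded)
  have "integrable (lborel \<Otimes>\<^sub>M lborel) (case_prod P)"
  proof (rule integrableI_bounded[OF Pm])
    have "(\<integral>\<^sup>+z. ennreal (norm (case_prod P z)) \<partial>(lborel \<Otimes>\<^sub>M lborel)) = (\<integral>\<^sup>+y. (\<integral>\<^sup>+s. ennreal (norm (P y s)) \<partial>lborel) \<partial>lborel)"
      using Pm by (subst lborel.nn_integral_fst[symmetric]) auto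
    also have "\<dots> \<le> (\<integral>\<^sup>+y. (\<integral>\<^sup>+s. ennreal \<bar>u y * (H * indicator (cball x R) y)\<bar> * indicator {0..T} s \<partial>lborel) \<partial>lborel)"
    proof (intro nn_integral_mono)
      fix y s
      show "ennreal (norm (P y s)) \<le> ennreal \<bar>u y * (H * indicator (cball x R) y)\<bar> * indicator {0..T} s"
      proof (cases "s \<in> {0..T} \<and> y \<in> cball x R")
        case True
        then show ?thesis using DH[of s y] H0 by (auto simp: P_def abs_mult intro!: ennreal_leI mult_left_mono)
      qed (use D0 in \<open>auto simp: P_def indicator_def\<close>)
    qed
    also have "\<dots> = (\<integral>\<^sup>+y. ennreal T * ennreal \<bar>u y * (H * indicator (cball x R) y)\<bar> \<partial>lborel)"
      using T by (intro nn_integral_cong, subst nn_integral_cmult) (auto simp: mult.commute)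
    also have "\<dots> = ennreal T * (\<integral>\<^sup>+y. ennreal \<bar>u y * (H * indicator (cball x R) y)\<bar> \<partial>lborel)"
      by (intro nn_integral_cmult) measurable
    also have "\<dots> < \<infinity>" using fin by (simp add: ennreal_mult_less_top)
    finally show "(\<integral>\<^sup>+z. ennreal (norm (case_prod P z)) \<partial>(lborel \<Otimes>\<^sub>M lborel)) < \<infinity>" .
  qed
  then have Fub: "(\<integral>s. (\<integral>y. P y s \<partial>lborel) \<partial>lborel) = (\<integral>y. (\<integral>s. P y s \<partial>lborel) \<partial>lborel)"
    by (rule lborel_pair.Fubini_integral)
  have "(\<integral>s. P y s \<partial>lborel) = u y * bump e (x + T *\<^sub>R h - y) - u y * bump e (x - y)" for y
  proof -
    have "(\<integral>s. indicator {0..T} s *\<^sub>R D s y \<partial>lborel) = bump e (x + T *\<^sub>R h - y) - bump e (x + 0 *\<^sub>R h - y)"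
    proof (rule integral_FTC_Icc[OF T])
      fix s
      have "((\<lambda>s. bump e (x + s *\<^sub>R h - y)) has_derivative (\<lambda>c. \<Sum>i\<in>UNIV. (c *\<^sub>R h) $ i * bump_deriv e i (x + s *\<^sub>R h - y))) (at s)"
        by (rule has_derivative_compose[OF _ bump_has_derivative]) (auto intro!: derivative_eq_intros)
      then have "((\<lambda>s. bump e (x + s *\<^sub>R h - y)) has_vector_derivative D s y) (at s)"
        by (simp add: has_vector_derivative_def D_def sum_distrib_left mult.assoc)
      then show "((\<lambda>s. bump e (x + s *\<^sub>R h - y)) has_vector_derivative D s y) (at s within {0..T})"
        by (rule has_vector_derivative_at_within)
    next
      show "continuous_on {0..T} (\<lambda>s. D s y)"
        unfolding D_def
        by (intro continuous_on_sum continuous_on_mult continuous_on_const continuous_on_compose2[OF continuous_bump_deriv])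
           (auto intro!: continuous_intros)
    qed
    moreover have "(\<integral>s. P y s \<partial>lborel) = u y * (\<integral>s. indicator {0..T} s *\<^sub>R D s y \<partial>lborel)"
      by (simp add: P_def)
    ultimately show ?thesis by (simp add: right_diff_distrib)
  qed
  then have 1: "(\<integral>y. (\<integral>s. P y s \<partial>lborel) \<partial>lborel) = mollify e u (x + T *\<^sub>R h) - mollify e u x"
    unfolding mollify_def using integrable_mollify[OF e u]
    by (simp add: Bochner_Integration.integral_diff)
  have 2: "(\<integral>y. P y s \<partial>lborel) = indicator {0..T} s * (h \<bullet> (\<chi> i. mollify e (g i) (x + s *\<^sub>R h)))" for s
  proof -
    have int: "integrable lborel (\<lambda>y. u y * bump_deriv e i (x + s *\<^sub>R h - y))" for i
      by (rule integrable_times_compact_support[OF u, where B = B and x = "x + s *\<^sub>R h" and r = e])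
         (auto simp: dist_norm intro!: bump_deriv_support[OF e] B(2))
    have "(\<integral>y. P y s \<partial>lborel) = (\<integral>y. (\<Sum>i\<in>UNIV. indicator {0..T} s * h $ i * (u y * bump_deriv e i (x + s *\<^sub>R h - y))) \<partial>lborel)"
      by (intro Bochner_Integration.integral_cong refl) (simp add: P_def D_def sum_distrib_left mult_ac)
    also have "\<dots> = (\<Sum>i\<in>UNIV. indicator {0..T} s * h $ i * mollify e (g i) (x + s *\<^sub>R h))"
      using int by (subst Bochner_Integration.integral_sum) (auto simp: parts)
    finally show ?thesis by (simp add: inner_vec_def sum_distrib_left mult_ac)
  qed
  have "mollify e u x = mollify e u (x + T *\<^sub>R h) - (\<integral>s. indicator {0..T} s * (h \<bullet> (\<chi> i. mollify e (g i) (x + s *\<^sub>R h))) \<partial>lborel)"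
    using Fub unfolding 1 2 by simp
  then have "\<bar>mollify e u x\<bar> \<le> \<bar>mollify e u (x + T *\<^sub>R h)\<bar> + \<bar>\<integral>s. indicator {0..T} s * (h \<bullet> (\<chi> i. mollify e (g i) (x + s *\<^sub>R h))) \<partial>lborel\<bar>"
    by linarith
  then have "ennreal \<bar>mollify e u x\<bar> \<le> ennreal \<bar>mollify e u (x + T *\<^sub>R h)\<bar> + ennreal \<bar>\<integral>s. indicator {0..T} s * (h \<bullet> (\<chi> i. mollify e (g i) (x + s *\<^sub>R h))) \<partial>lborel\<bar>"
    by (subst ennreal_plus[symmetric]) (auto intro: ennreal_leI simp del: ennreal_plus)
  also have "ennreal \<bar>\<integral>s. indicator {0..T} s * (h \<bullet> (\<chi> i. mollify e (g i) (x + s *\<^sub>R h))) \<partial>lborel\<bar>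
      \<le> (\<integral>\<^sup>+s. ennreal \<bar>indicator {0..T} s * (h \<bullet> (\<chi> i. mollify e (g i) (x + s *\<^sub>R h)))\<bar> \<partial>lborel)"
    by (rule abs_integral_le_nn_integral)
  also have "\<dots> \<le> (\<integral>\<^sup>+s. ennreal (norm h * norm (\<chi> i. mollify e (g i) (x + s *\<^sub>R h))) * indicator {0..T} s \<partial>lborel)"
  proof (rule nn_integral_mono)
    fix s :: real
    show "ennreal \<bar>indicator {0..T} s * (h \<bullet> (\<chi> i. mollify e (g i) (x + s *\<^sub>R h)))\<bar> \<le> ennreal (norm h * norm (\<chi> i. mollify e (g i) (x + s *\<^sub>R h))) * indicator {0..T} s"
      using Cauchy_Schwarz_ineq2[of h "\<chi> i. mollify e (g i) (x + s *\<^sub>R h)"]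
      by (auto simp: indicator_def intro!: ennreal_leI)
  qed
  finally show ?thesis by (simp add: add_left_mono)
qed

text \<open>The value at \<open>z\<close> is controlled by the integral of \<open>u\<^sup>2\<close> over the ball around \<open>z\<close>, and the indicators of
these balls tend to zero when \<open>z\<close> escapes to infinity.\<close>

lemma mollify_decay:
  fixes u :: "real ^ 'n::finite \<Rightarrow> real"
  assumes e: "0 < e" and u: "lp_le 2 a u" and h: "h \<noteq> 0"
  shows "(\<lambda>n. mollify e u (x + real n *\<^sub>R h)) \<longlonglongrightarrow> 0"
proof -
  have [measurable]: "u \<in> borel_measurable borel" using u by (simp add: lp_le_def)
  define z where "z n = x + real n *\<^sub>R h" for n
  define V where "V = emeasure lborel (cball (0 :: real ^ 'n) e)"
  have V: "V < \<infinity>" using emeasure_bounded_finite[of "cball (0::real^'n) e"] by (simp add: V_def)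
  have [measurable]: "cball c e \<in> sets borel" for c :: "real ^ 'n" by simp
  have Vz: "emeasure lborel (cball c e) = V" for c :: "real ^ 'n"
    using e by (simp add: V_def emeasure_cball)
  define W where "W n = (\<integral>\<^sup>+y. ennreal ((u y)\<^sup>2) * indicator (cball (z n) e) y \<partial>lborel)" for n
  have "W \<longlonglongrightarrow> (\<integral>\<^sup>+(y::real^'n). 0 \<partial>lborel)"
    unfolding W_def
  proof (rule nn_integral_dominated_convergence[where w = "\<lambda>y. ennreal ((u y)\<^sup>2)"])
    show "(\<integral>\<^sup>+y. ennreal ((u y)\<^sup>2) \<partial>lborel) < \<infinity>" using u by (auto simp: lp_le_2_iff intro: le_less_trans)
    show "AE y in lborel. (\<lambda>n. ennreal ((u y)\<^sup>2) * indicator (cball (z n) e) y) \<longlonglongrightarrow> 0"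
    proof (rule AE_I2)
      fix y
      obtain m :: nat where m: "(norm (x - y) + e) / norm h < m" using reals_Archimedean2 by blast
      have "ennreal ((u y)\<^sup>2) * indicator (cball (z n) e) y = 0" if "m \<le> n" for n
      proof -
        have "(norm (x - y) + e) / norm h < real n" using m that by linarith
        then have "norm (x - y) + e < real n * norm h" using h by (simp add: divide_less_eq)
        moreover have "real n * norm h \<le> norm (z n - y) + norm (x - y)"
          using norm_triangle_ineq4[of "z n - y" "x - y"] by (simp add: z_def)
        ultimately have "y \<notin> cball (z n) e" by (simp add: dist_norm)
        then show ?thesis by simp
      qed
      then have "\<forall>\<^sub>F n in sequentially. ennreal ((u y)\<^sup>2) * indicator (cball (z n) e) y = 0"
        unfolding eventually_sequentially by blast
      then show "(\<lambda>n. ennreal ((u y)\<^sup>2) * indicator (cball (z n) e) y) \<longlonglongrightarrow> 0"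
        by (rule tendsto_eventually)
    qed
  qed (auto simp: indicator_def)
  then have W: "(\<lambda>n. W n * V) \<longlonglongrightarrow> 0"
    using V ennreal_tendsto_cmult[of V W 0 sequentially] by (simp add: mult.commute)
  have "ennreal ((mollify e u (z n))\<^sup>2) \<le> W n * V" for n
  proof -
    have "ennreal \<bar>mollify e u (z n)\<bar> \<le> (\<integral>\<^sup>+y. ennreal \<bar>u y * bump e (z n - y)\<bar> \<partial>lborel)"
      unfolding mollify_def by (rule abs_integral_le_nn_integral)
    also have "\<dots> \<le> (\<integral>\<^sup>+y. (ennreal \<bar>u y\<bar> * indicator (cball (z n) e) y) * indicator (cball (z n) e) y \<partial>lborel)"
    proof (rule nn_integral_mono)
      fix y
      show "ennreal \<bar>u y * bump e (z n - y)\<bar> \<le> (ennreal \<bar>u y\<bar> * indicator (cball (z n) e) y) * indicator (cball (z n) e) y"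
        using bump_outside[OF e, of y "z n"] bump_le_1[of e "z n - y"] bump_nonneg[of e "z n - y"]
        by (cases "y \<in> cball (z n) e") (auto simp: abs_mult mult_left_le intro!: ennreal_leI)
    qed
    finally have "(ennreal \<bar>mollify e u (z n)\<bar>)\<^sup>2 \<le> (\<integral>\<^sup>+y. (ennreal \<bar>u y\<bar> * indicator (cball (z n) e) y) * indicator (cball (z n) e) y \<partial>lborel)\<^sup>2"
      by (rule power_mono) simp
    also have "\<dots> \<le> (\<integral>\<^sup>+y. (ennreal \<bar>u y\<bar> * indicator (cball (z n) e) y)\<^sup>2 \<partial>lborel) * (\<integral>\<^sup>+y. (indicator (cball (z n) e) y)\<^sup>2 \<partial>lborel)"
      by (rule Cauchy_Schwarz_nn_integral) measurable
    also have "(\<integral>\<^sup>+y. (ennreal \<bar>u y\<bar> * indicator (cball (z n) e) y)\<^sup>2 \<partial>lborel) = W n"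
      unfolding W_def by (intro nn_integral_cong) (auto simp: indicator_def ennreal_power)
    also have "(\<integral>\<^sup>+y. (indicator (cball (z n) e) y)\<^sup>2 \<partial>lborel) = (\<integral>\<^sup>+y. indicator (cball (z n) e) y \<partial>lborel)"
      by (intro nn_integral_cong) (auto simp: indicator_def)
    also have "\<dots> = V" by (simp add: Vz)
    finally show ?thesis by (simp add: ennreal_power)
  qed
  then have "(\<lambda>n. ennreal ((mollify e u (z n))\<^sup>2)) \<longlonglongrightarrow> 0"
    by (intro tendsto_sandwich[OF _ _ tendsto_const W]) auto
  then have "(\<lambda>n. (mollify e u (z n))\<^sup>2) \<longlonglongrightarrow> 0"
    using tendsto_ennreal_iff[of "\<lambda>n. (mollify e u (z n))\<^sup>2" sequentially 0] by simp
  then have "(\<lambda>n. sqrt ((mollify e u (z n))\<^sup>2)) \<longlonglongrightarrow> sqrt 0" by (rule tendsto_real_sqrt)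
  then show ?thesis unfolding z_def by (simp add: tendsto_rabs_zero_iff)
qed

text \<open>Along each ray \<open>|v x|\<close> is at most the integral of \<open>|h| G(x + s h)\<close> over \<open>s \<ge> 0\<close>. Integrating this over all \<open>h\<close> in the
unit ball and substituting \<open>z = x + s h\<close> for fixed \<open>s\<close>, a point \<open>z\<close> at distance \<open>d\<close> from \<open>x\<close>
receives the weight \<open>d\<close> times the integral of \<open>s^(-N - 1)\<close> over \<open>s \<ge> d\<close>, which is of order \<open>d^(1 - N)\<close>.\<close>

lemma line_bound_imp_riesz_pot_bound:
  fixes v G :: "'a::euclidean_space \<Rightarrow> real"
  assumes [measurable]: "G \<in> borel_measurable borel" and G0: "\<And>x. 0 \<le> G x"
    and line: "\<And>x h T. 0 \<le> T \<Longrightarrow> ennreal \<bar>v x\<bar> \<le> ennreal \<bar>v (x + T *\<^sub>R h)\<bar>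
        + (\<integral>\<^sup>+s. ennreal (norm h * G (x + s *\<^sub>R h)) * indicator {0..T} s \<partial>lborel)"
    and decay: "\<And>x h. h \<noteq> 0 \<Longrightarrow> (\<lambda>n. v (x + real n *\<^sub>R h)) \<longlonglongrightarrow> 0"
  shows "ennreal (unit_ball_vol (real DIM('a)) * \<bar>v x\<bar>) \<le> riesz_pot (real DIM('a) - 1) G x"
proof -
  let ?N = "real DIM('a)"
  have N: "1 \<le> ?N" using DIM_positive[where 'a='a] by linarith
  define I where "I h = (\<integral>\<^sup>+s. ennreal (norm h * G (x + s *\<^sub>R h)) * indicator {0..} s \<partial>lborel)" for h
  have ray: "ennreal \<bar>v x\<bar> \<le> I h" if "h \<noteq> 0" for h
  proof -
    have "ennreal \<bar>v x\<bar> \<le> ennreal \<bar>v (x + real n *\<^sub>R h)\<bar> + I h" for n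
    proof -
      have "(\<integral>\<^sup>+s. ennreal (norm h * G (x + s *\<^sub>R h)) * indicator {0..real n} s \<partial>lborel) \<le> I h"
        unfolding I_def by (intro nn_integral_mono) (auto simp: indicator_def)
      then show ?thesis using line[of "real n" x h] by (meson add_left_mono of_nat_0_le_iff order_trans)
    qed
    moreover have "(\<lambda>n. ennreal \<bar>v (x + real n *\<^sub>R h)\<bar> + I h) \<longlonglongrightarrow> ennreal \<bar>0\<bar> + I h"
      by (intro tendsto_add tendsto_ennrealI tendsto_rabs decay that tendsto_const)
    ultimately show ?thesis using LIMSEQ_le_const[of _ "ennreal \<bar>0\<bar> + I h" "ennreal \<bar>v x\<bar>"] by auto
  qed
  have [measurable]: "cball (0::'a) 1 \<in> sets borel" "cball x s \<in> sets borel" for s by simp_all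
  have "ennreal (unit_ball_vol ?N * \<bar>v x\<bar>) = ennreal \<bar>v x\<bar> * emeasure lborel (cball (0::'a) 1)"
    by (simp add: emeasure_cball ennreal_mult[symmetric] mult.commute)
  also have "\<dots> = (\<integral>\<^sup>+h. ennreal \<bar>v x\<bar> * indicator (cball (0::'a) 1) h \<partial>lborel)"
    by (subst nn_integral_cmult) auto
  also have "\<dots> \<le> (\<integral>\<^sup>+h. I h * indicator (cball (0::'a) 1) h \<partial>lborel)"
  proof (rule nn_integral_mono_AE)
    have "AE h in lborel. h \<noteq> (0::'a)" by (rule AE_lborel_singleton)
    then show "AE h in lborel. ennreal \<bar>v x\<bar> * indicator (cball (0::'a) 1) h \<le> I h * indicator (cball (0::'a) 1) h"
      by eventually_elim (intro mult_right_mono ray, auto)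
  qed
  also have "\<dots> = (\<integral>\<^sup>+h. (\<integral>\<^sup>+s. ennreal (norm h * G (x + s *\<^sub>R h)) * indicator {0..} s * indicator (cball (0::'a) 1) h \<partial>lborel) \<partial>lborel)"
    unfolding I_def by (intro nn_integral_cong nn_integral_multc[symmetric]) measurable
  also have "\<dots> = (\<integral>\<^sup>+s. (\<integral>\<^sup>+h. ennreal (norm h * G (x + s *\<^sub>R h)) * indicator {0..} s * indicator (cball (0::'a) 1) h \<partial>lborel) \<partial>lborel)"
    by (rule lborel_pair.Fubini') measurable
  also have "\<dots> \<le> (\<integral>\<^sup>+s. (\<integral>\<^sup>+z. indicator {0<..} s * (if dist x z \<le> s then 1 else 0) * ennreal (s powr (-?N - 1) * (norm (x - z) * G z)) \<partial>lborel) \<partial>lborel)"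
  proof (rule nn_integral_mono_AE)
    have "AE s in lborel. s \<noteq> (0::real)" by (rule AE_lborel_singleton)
    then show "AE s in lborel. (\<integral>\<^sup>+h. ennreal (norm h * G (x + s *\<^sub>R h)) * indicator {0..} s * indicator (cball (0::'a) 1) h \<partial>lborel)
        \<le> (\<integral>\<^sup>+z. indicator {0<..} s * (if dist x z \<le> s then 1 else 0) * ennreal (s powr (-?N - 1) * (norm (x - z) * G z)) \<partial>lborel)"
    proof eventually_elim
      fix s :: real assume "s \<noteq> 0"
      show "(\<integral>\<^sup>+h. ennreal (norm h * G (x + s *\<^sub>R h)) * indicator {0..} s * indicator (cball (0::'a) 1) h \<partial>lborel)
        \<le> (\<integral>\<^sup>+z. indicator {0<..} s * (if dist x z \<le> s then 1 else 0) * ennreal (s powr (-?N - 1) * (norm (x - z) * G z)) \<partial>lborel)"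
      proof (cases "0 < s")
        case True
        have "(\<integral>\<^sup>+z. indicator {0<..} s * (if dist x z \<le> s then 1 else 0) * ennreal (s powr (-?N - 1) * (norm (x - z) * G z)) \<partial>lborel)
          = ennreal (\<bar>s\<bar> ^ DIM('a)) * (\<integral>\<^sup>+h. indicator {0<..} s * (if dist x (x + s *\<^sub>R h) \<le> s then 1 else 0) * ennreal (s powr (-?N - 1) * (norm (x - (x + s *\<^sub>R h)) * G (x + s *\<^sub>R h))) \<partial>lborel)"
          using True by (intro nn_integral_lborel_affine) auto
        also have "\<dots> = (\<integral>\<^sup>+h. ennreal (\<bar>s\<bar> ^ DIM('a)) * (indicator {0<..} s * (if dist x (x + s *\<^sub>R h) \<le> s then 1 else 0) * ennreal (s powr (-?N - 1) * (norm (x - (x + s *\<^sub>R h)) * G (x + s *\<^sub>R h)))) \<partial>lborel)"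
          by (intro nn_integral_cmult[symmetric]) measurable
        also have "\<dots> = (\<integral>\<^sup>+h. ennreal (norm h * G (x + s *\<^sub>R h)) * indicator {0..} s * indicator (cball (0::'a) 1) h \<partial>lborel)"
        proof (rule nn_integral_cong)
          fix h :: 'a
          have "\<bar>s\<bar> ^ DIM('a) * (s powr (-?N - 1) * (norm (x - (x + s *\<^sub>R h)) * G (x + s *\<^sub>R h))) = (s powr ?N * s powr (-?N - 1) * s) * (norm h * G (x + s *\<^sub>R h))"
            using True by (simp add: powr_realpow)
          also have "s powr ?N * s powr (-?N - 1) * s = 1"
            using True by (simp only: powr_add[symmetric]) (simp add: powr_minus_divide)
          finally have "ennreal (\<bar>s\<bar> ^ DIM('a)) * ennreal (s powr (-?N - 1) * (norm (x - (x + s *\<^sub>R h)) * G (x + s *\<^sub>R h))) = ennreal (norm h * G (x + s *\<^sub>R h))"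
            using G0 by (subst ennreal_mult[symmetric]) auto
          moreover have "dist x (x + s *\<^sub>R h) \<le> s \<longleftrightarrow> h \<in> cball 0 1"
            using True by (simp add: dist_norm)
          ultimately show "ennreal (\<bar>s\<bar> ^ DIM('a)) * (indicator {0<..} s * (if dist x (x + s *\<^sub>R h) \<le> s then 1 else 0) * ennreal (s powr (-?N - 1) * (norm (x - (x + s *\<^sub>R h)) * G (x + s *\<^sub>R h))))
            = ennreal (norm h * G (x + s *\<^sub>R h)) * indicator {0..} s * indicator (cball (0::'a) 1) h"
            using True by (simp add: indicator_def)
        qed
        finally show ?thesis by simp
      next
        case False
        then show ?thesis using \<open>s \<noteq> 0\<close> by (simp add: indicator_def)
      qed
    qed
  qed
  also have "\<dots> = (\<integral>\<^sup>+z. (\<integral>\<^sup>+s. indicator {0<..} s * (if dist x z \<le> s then 1 else 0) * ennreal (s powr (-?N - 1) * (norm (x - z) * G z)) \<partial>lborel) \<partial>lborel)"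
    by (rule lborel_pair.Fubini') measurable
  also have "\<dots> \<le> riesz_pot (?N - 1) G x"
    unfolding riesz_pot_def
  proof (rule nn_integral_mono)
    fix z
    show "(\<integral>\<^sup>+s. indicator {0<..} s * (if dist x z \<le> s then 1 else 0) * ennreal (s powr (-?N - 1) * (norm (x - z) * G z)) \<partial>lborel)
       \<le> ennreal (norm (x - z) powr - (?N - 1) * \<bar>G z\<bar>)"
    proof (cases "z = x")
      case False
      let ?d = "norm (x - z)"
      have d: "0 < ?d" using False by simp
      have "(\<integral>\<^sup>+s. indicator {0<..} s * (if dist x z \<le> s then 1 else 0) * ennreal (s powr (-?N - 1) * (?d * G z)) \<partial>lborel)
        \<le> (\<integral>\<^sup>+s. ennreal (?d * G z) * (ennreal (?N * s powr (-?N - 1)) * indicator {?d..} s) \<partial>lborel)"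
      proof (rule nn_integral_mono)
        fix s :: real
        have "s powr (-?N - 1) * (?d * G z) \<le> (?d * G z) * (?N * s powr (-?N - 1))"
          using mult_right_mono[OF N, of "s powr (-?N - 1) * (?d * G z)"] G0[of z] by (simp add: mult_ac)
        then have "ennreal (s powr (-?N - 1) * (?d * G z)) \<le> ennreal (?d * G z) * ennreal (?N * s powr (-?N - 1))"
          using G0[of z] by (subst ennreal_mult[symmetric]) (auto intro: ennreal_leI)
        then show "indicator {0<..} s * (if dist x z \<le> s then 1 else 0) * ennreal (s powr (-?N - 1) * (?d * G z)) \<le> ennreal (?d * G z) * (ennreal (?N * s powr (-?N - 1)) * indicator {?d..} s)"
          by (simp add: indicator_def dist_norm)
      qed
      also have "\<dots> = ennreal (?d * G z) * ennreal (?d powr (-?N))"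
        using d N by (subst nn_integral_cmult, simp, subst nn_integral_powr_tail) auto
      also have "\<dots> = ennreal ((?d powr 1 * ?d powr (-?N)) * G z)"
        using G0[of z] d by (simp add: ennreal_mult[symmetric] mult_ac)
      also have "?d powr 1 * ?d powr (-?N) = ?d powr - (?N - 1)" by (simp only: powr_add[symmetric]) simp
      finally show ?thesis using G0[of z] by simp
    qed simp
  qed
  finally show ?thesis .
qed

definition bump_mass :: "'n::finite itself \<Rightarrow> real \<Rightarrow> real" where
  "bump_mass _ e = (\<integral>y. bump e (y :: real ^ 'n) \<partial>lborel)"

lemma bump_integral:
  assumes e: "0 < e"
  shows "integrable lborel (\<lambda>y. bump e (x - y :: real ^ 'n::finite))"
    "(\<integral>y. bump e (x - y) \<partial>lborel) = bump_mass TYPE('n) e"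
    "(\<integral>\<^sup>+y. ennreal (bump e (x - y)) \<partial>lborel) = ennreal (bump_mass TYPE('n) e)"
    "(\<integral>\<^sup>+z. ennreal (bump e (z - x)) \<partial>lborel) = ennreal (bump_mass TYPE('n) e)"
    "0 < bump_mass TYPE('n) e"
proof -
  have fin: "emeasure lborel (cball (0::real^'n) e) < \<infinity>"
    using emeasure_bounded_finite[of "cball (0::real^'n) e"] by simp
  have le: "ennreal (bump e y) \<le> indicator (cball 0 e) y" for y :: "real ^ 'n"
    using bump_outside[OF e, of y 0] bump_le_1[of e y] by (auto simp: indicator_def bump_def)
  have "(\<integral>\<^sup>+y. ennreal (bump e (y::real^'n)) \<partial>lborel) \<le> (\<integral>\<^sup>+y. indicator (cball (0::real^'n) e) y \<partial>lborel)"
    by (intro nn_integral_mono le)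
  also have "\<dots> < \<infinity>" using fin by simp
  finally have f: "(\<integral>\<^sup>+y. ennreal (bump e (y::real^'n)) \<partial>lborel) < \<infinity>" .
  then have int0: "integrable lborel (\<lambda>y. bump e (y::real^'n))"
    by (simp add: integrable_iff_bounded bump_nonneg)
  then have nn0: "(\<integral>\<^sup>+y. ennreal (bump e (y::real^'n)) \<partial>lborel) = ennreal (bump_mass TYPE('n) e)"
    unfolding bump_mass_def by (intro nn_integral_eq_integral) (auto simp: bump_nonneg)
  have tr: "(\<integral>\<^sup>+y. ennreal (bump e (x - y)) \<partial>lborel) = ennreal (bump_mass TYPE('n) e)" for x :: "real ^ 'n"
    using nn_integral_lborel_affine[of "\<lambda>y. ennreal (bump e y)" "-1" x] nn0 by simp
  show n: "(\<integral>\<^sup>+y. ennreal (bump e (x - y)) \<partial>lborel) = ennreal (bump_mass TYPE('n) e)" by (rule tr)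
  show "(\<integral>\<^sup>+z. ennreal (bump e (z - x)) \<partial>lborel) = ennreal (bump_mass TYPE('n) e)"
    using tr[of x] by (simp add: bump_def norm_minus_commute)
  have J0: "0 \<le> bump_mass TYPE('n) e" unfolding bump_mass_def by (simp add: bump_nonneg)
  show int: "integrable lborel (\<lambda>y. bump e (x - y))"
    using n by (simp add: integrable_iff_bounded bump_nonneg)
  show "(\<integral>y. bump e (x - y) \<partial>lborel) = bump_mass TYPE('n) e"
    using n J0 by (intro integral_eq_nn_integral[THEN trans]) (auto simp: bump_nonneg)
  show "0 < bump_mass TYPE('n) e"
  proof (rule ccontr)
    assume "\<not> 0 < bump_mass TYPE('n) e"
    then have "(\<integral>\<^sup>+y. ennreal (bump e (y::real^'n)) \<partial>lborel) = 0" using nn0 J0 by simp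
    then have "AE y in lborel. ennreal (bump e (y::real^'n)) = 0"
      by (subst (asm) nn_integral_0_iff_AE) auto
    then have "AE y in lborel. y \<notin> ball (0::real^'n) e"
      by eventually_elim (use bump_pos[where e = e] in \<open>force simp: ennreal_eq_0_iff\<close>)
    then have "emeasure lborel (ball (0::real^'n) e) = 0"
      by (subst (asm) AE_iff_measurable[where N = "ball 0 e"]) auto
    moreover have "0 < emeasure lborel (ball (0::real^'n) e)" using e by (simp add: emeasure_ball)
    ultimately show False by simp
  qed
qed

text \<open>Young's convolution inequality for an \<open>L^1\<close> kernel: Cauchy-Schwarz with respect to the weight
\<open>bump e (x - y)\<close>, followed by Tonelli.\<close>

lemma mollify_L2:
  fixes g :: "real ^ 'n::finite \<Rightarrow> real"
  assumes e: "0 < e" and [measurable]: "g \<in> borel_measurable borel"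
  shows "(\<integral>\<^sup>+x. ennreal ((mollify e g x)\<^sup>2) \<partial>lborel) \<le> ennreal ((bump_mass TYPE('n) e)\<^sup>2) * (\<integral>\<^sup>+x. ennreal ((g x)\<^sup>2) \<partial>lborel)"
proof -
  let ?J = "bump_mass TYPE('n) e"
  have "ennreal ((mollify e g x)\<^sup>2) \<le> (\<integral>\<^sup>+y. ennreal ((g y)\<^sup>2 * bump e (x - y)) \<partial>lborel) * ennreal ?J" for x
  proof -
    have "ennreal \<bar>mollify e g x\<bar> \<le> (\<integral>\<^sup>+y. ennreal \<bar>g y * bump e (x - y)\<bar> \<partial>lborel)"
      unfolding mollify_def by (rule abs_integral_le_nn_integral)
    also have "\<dots> = (\<integral>\<^sup>+y. ennreal (\<bar>g y\<bar> * sqrt (bump e (x - y))) * ennreal (sqrt (bump e (x - y))) \<partial>lborel)"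
      by (intro nn_integral_cong) (simp add: ennreal_mult[symmetric] abs_mult bump_nonneg mult.assoc)
    finally have "(ennreal \<bar>mollify e g x\<bar>)\<^sup>2 \<le> (\<integral>\<^sup>+y. ennreal (\<bar>g y\<bar> * sqrt (bump e (x - y))) * ennreal (sqrt (bump e (x - y))) \<partial>lborel)\<^sup>2"
      by (rule power_mono) simp
    also have "\<dots> \<le> (\<integral>\<^sup>+y. (ennreal (\<bar>g y\<bar> * sqrt (bump e (x - y))))\<^sup>2 \<partial>lborel) * (\<integral>\<^sup>+y. (ennreal (sqrt (bump e (x - y))))\<^sup>2 \<partial>lborel)"
      by (rule Cauchy_Schwarz_nn_integral) measurable
    also have "\<dots> = (\<integral>\<^sup>+y. ennreal ((g y)\<^sup>2 * bump e (x - y)) \<partial>lborel) * (\<integral>\<^sup>+y. ennreal (bump e (x - y)) \<partial>lborel)"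
      by (simp add: ennreal_power bump_nonneg power_mult_distrib)
    finally show ?thesis using e by (simp add: bump_integral ennreal_power)
  qed
  then have "(\<integral>\<^sup>+x. ennreal ((mollify e g x)\<^sup>2) \<partial>lborel) \<le> (\<integral>\<^sup>+x. (\<integral>\<^sup>+y. ennreal ((g y)\<^sup>2 * bump e (x - y)) \<partial>lborel) * ennreal ?J \<partial>lborel)"
    by (intro nn_integral_mono)
  also have "\<dots> = (\<integral>\<^sup>+x. (\<integral>\<^sup>+y. ennreal ((g y)\<^sup>2 * bump e (x - y)) \<partial>lborel) \<partial>lborel) * ennreal ?J"
    by (rule nn_integral_multc) measurable
  also have "(\<integral>\<^sup>+x. (\<integral>\<^sup>+y. ennreal ((g y)\<^sup>2 * bump e (x - y)) \<partial>lborel) \<partial>lborel) = (\<integral>\<^sup>+y. (\<integral>\<^sup>+x. ennreal ((g y)\<^sup>2 * bump e (x - y)) \<partial>lborel) \<partial>lborel)"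
    by (rule lborel_pair.Fubini') measurable
  also have "\<dots> = (\<integral>\<^sup>+y. ennreal ((g y)\<^sup>2) * ennreal ?J \<partial>lborel)"
  proof (rule nn_integral_cong)
    fix y
    have "(\<integral>\<^sup>+x. ennreal ((g y)\<^sup>2 * bump e (x - y)) \<partial>lborel) = ennreal ((g y)\<^sup>2) * (\<integral>\<^sup>+x. ennreal (bump e (x - y)) \<partial>lborel)"
      by (subst nn_integral_cmult[symmetric]) (auto simp: ennreal_mult bump_nonneg)
    then show "(\<integral>\<^sup>+x. ennreal ((g y)\<^sup>2 * bump e (x - y)) \<partial>lborel) = ennreal ((g y)\<^sup>2) * ennreal ?J"
      by (simp add: bump_integral[OF e])
  qed
  also have "\<dots> = (\<integral>\<^sup>+y. ennreal ((g y)\<^sup>2) \<partial>lborel) * ennreal ?J" by (rule nn_integral_multc) measurable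
  also have "(\<integral>\<^sup>+y. ennreal ((g y)\<^sup>2) \<partial>lborel) * ennreal ?J * ennreal ?J = ennreal (?J\<^sup>2) * (\<integral>\<^sup>+x. ennreal ((g x)\<^sup>2) \<partial>lborel)"
    using bump_integral(5)[OF e, where 'n = 'n] by (simp add: power2_eq_square ennreal_mult mult_ac)
  finally show ?thesis .
qed

lemma square_sum_le: "(a + b)\<^sup>2 \<le> 2 * a\<^sup>2 + 2 * (b\<^sup>2)" for a b :: real
  using sum_squares_bound[of a b] by (simp add: power2_sum)

lemma nn_integral_square_add:
  fixes f g :: "'a \<Rightarrow> real"
  assumes [measurable]: "f \<in> borel_measurable M" "g \<in> borel_measurable M"
    and f: "(\<integral>\<^sup>+x. ennreal ((f x)\<^sup>2) \<partial>M) \<le> ennreal a" and g: "(\<integral>\<^sup>+x. ennreal ((g x)\<^sup>2) \<partial>M) \<le> ennreal b"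
    and ab: "0 \<le> a" "0 \<le> b"
  shows "(\<integral>\<^sup>+x. ennreal ((f x + g x)\<^sup>2) \<partial>M) \<le> ennreal (2 * a + 2 * b)"
proof -
  have "(\<integral>\<^sup>+x. ennreal ((f x + g x)\<^sup>2) \<partial>M) \<le> (\<integral>\<^sup>+x. ennreal 2 * ennreal ((f x)\<^sup>2) + ennreal 2 * ennreal ((g x)\<^sup>2) \<partial>M)"
  proof (rule nn_integral_mono)
    fix x
    have "ennreal ((f x + g x)\<^sup>2) \<le> ennreal (2 * (f x)\<^sup>2 + 2 * (g x)\<^sup>2)" by (intro ennreal_leI square_sum_le)
    also have "\<dots> = ennreal 2 * ennreal ((f x)\<^sup>2) + ennreal 2 * ennreal ((g x)\<^sup>2)"
      by (subst ennreal_plus) (auto simp: ennreal_mult simp del: ennreal_plus)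
    finally show "ennreal ((f x + g x)\<^sup>2) \<le> ennreal 2 * ennreal ((f x)\<^sup>2) + ennreal 2 * ennreal ((g x)\<^sup>2)" .
  qed
  also have "\<dots> = ennreal 2 * (\<integral>\<^sup>+x. ennreal ((f x)\<^sup>2) \<partial>M) + ennreal 2 * (\<integral>\<^sup>+x. ennreal ((g x)\<^sup>2) \<partial>M)"
    by (subst nn_integral_add) (auto simp: nn_integral_cmult)
  also have "\<dots> \<le> ennreal 2 * ennreal a + ennreal 2 * ennreal b"
    by (intro add_mono mult_left_mono f g) auto
  also have "\<dots> = ennreal (2 * a + 2 * b)" using ab by (simp add: ennreal_mult)
  finally show ?thesis .
qed

text \<open>First truncate \<open>u\<close> in height and in space, then truncate in the same way a sequence of continuous functions that
converges to \<open>u\<close> almost everywhere. Both limits are dominated.\<close>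

lemma continuous_compact_support_dense_L2:
  fixes u :: "'a::euclidean_space \<Rightarrow> real"
  assumes u: "lp_le 2 a u" and \<delta>: "0 < \<delta>"
  shows "\<exists>v R. continuous_on UNIV v \<and> (\<forall>x. x \<notin> cball 0 R \<longrightarrow> v x = 0) \<and> (\<integral>\<^sup>+x. ennreal ((u x - v x)\<^sup>2) \<partial>lborel) \<le> ennreal \<delta>"
proof -
  have [measurable]: "u \<in> borel_measurable borel" using u by (simp add: lp_le_def)
  define cut where "cut M x = max 0 (min 1 (M + 1 - norm x))" for M :: real and x :: 'a
  define clamp where "clamp M t = max (-M) (min M t)" for M t :: real
  define T where "T M t x = clamp M t * cut M x" for M t :: real and x :: 'a
  have cut: "0 \<le> cut M x" "cut M x \<le> 1" for M x by (auto simp: cut_def)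
  have Tu: "\<bar>T M t x\<bar> \<le> \<bar>t\<bar>" if "0 \<le> M" for M t x
  proof -
    have "\<bar>clamp M t\<bar> \<le> \<bar>t\<bar>" using that by (auto simp: clamp_def)
    then show ?thesis using cut[of M x] by (simp add: T_def abs_mult mult_le_one mult_mono[of _ "\<bar>t\<bar>" _ 1, simplified])
  qed
  have TM: "\<bar>T M t x\<bar> \<le> M * indicator (cball 0 (M + 1)) x" if "0 \<le> M" for M t x
  proof (cases "x \<in> cball 0 (M + 1)")
    case True
    have "\<bar>clamp M t\<bar> \<le> M" using that by (auto simp: clamp_def)
    then show ?thesis using cut[of M x] True that by (simp add: T_def abs_mult mult_mono[of _ M _ 1, simplified])
  next
    case False
    then have "cut M x = 0" by (simp add: cut_def)
    then show ?thesis using that by (simp add: T_def)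
  qed
  have fin: "(\<integral>\<^sup>+x. ennreal ((u x)\<^sup>2) \<partial>lborel) < \<infinity>" using u by (auto simp: lp_le_2_iff intro: le_less_trans)
  have [measurable]: "(\<lambda>x. T M (h x) x) \<in> borel_measurable borel" if [measurable]: "h \<in> borel_measurable borel" for M h
    unfolding T_def clamp_def cut_def by measurable
  have "(\<lambda>n. \<integral>\<^sup>+x. ennreal ((u x - T (real n) (u x) x)\<^sup>2) \<partial>lborel) \<longlonglongrightarrow> (\<integral>\<^sup>+(x::'a). 0 \<partial>lborel)"
  proof (rule nn_integral_dominated_convergence[where w = "\<lambda>x. ennreal 4 * ennreal ((u x)\<^sup>2)"])
    show "AE x in lborel. ennreal ((u x - T (real n) (u x) x)\<^sup>2) \<le> ennreal 4 * ennreal ((u x)\<^sup>2)" for n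
    proof (rule AE_I2)
      fix x
      have "\<bar>u x - T (real n) (u x) x\<bar> \<le> 2 * \<bar>u x\<bar>" using Tu[of "real n" "u x" x] by simp
      then have "\<bar>u x - T (real n) (u x) x\<bar>\<^sup>2 \<le> (2 * \<bar>u x\<bar>)\<^sup>2" by (intro power_mono) auto
      then show "ennreal ((u x - T (real n) (u x) x)\<^sup>2) \<le> ennreal 4 * ennreal ((u x)\<^sup>2)"
        by (subst ennreal_mult[symmetric]) (auto simp: power_mult_distrib intro!: ennreal_leI)
    qed
    show "(\<integral>\<^sup>+x. ennreal 4 * ennreal ((u x)\<^sup>2) \<partial>lborel) < \<infinity>"
      using fin by (subst nn_integral_cmult) (auto simp: ennreal_mult_less_top)
    show "AE x in lborel. (\<lambda>n. ennreal ((u x - T (real n) (u x) x)\<^sup>2)) \<longlonglongrightarrow> 0"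
    proof (rule AE_I2)
      fix x
      obtain m :: nat where m: "max (norm x) \<bar>u x\<bar> < m" using reals_Archimedean2 by blast
      have "ennreal ((u x - T (real n) (u x) x)\<^sup>2) = 0" if "m \<le> n" for n
      proof -
        have "norm x < real n" "\<bar>u x\<bar> < real n" using m that by auto
        then show ?thesis by (auto simp: T_def clamp_def cut_def)
      qed
      then have "\<forall>\<^sub>F n in sequentially. ennreal ((u x - T (real n) (u x) x)\<^sup>2) = 0"
        unfolding eventually_sequentially by blast
      then show "(\<lambda>n. ennreal ((u x - T (real n) (u x) x)\<^sup>2)) \<longlonglongrightarrow> 0" by (rule tendsto_eventually)
    qed
  qed measurable
  then have "\<forall>\<^sub>F n in sequentially. (\<integral>\<^sup>+x. ennreal ((u x - T (real n) (u x) x)\<^sup>2) \<partial>lborel) < ennreal (\<delta> / 4)"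
    using \<delta> by (intro order_tendstoD) auto
  then obtain m where "(\<integral>\<^sup>+x. ennreal ((u x - T (real m) (u x) x)\<^sup>2) \<partial>lborel) < ennreal (\<delta> / 4)"
    by (auto simp: eventually_sequentially)
  then have 1: "(\<integral>\<^sup>+x. ennreal ((u x - T (real m) (u x) x)\<^sup>2) \<partial>lborel) \<le> ennreal (\<delta> / 4)" by simp
  have "u measurable_on UNIV" by (intro lebesgue_measurable_imp_measurable_on) (auto intro: measurable_completion)
  then obtain Z g where Z: "negligible Z" and g: "\<And>n. continuous_on UNIV (g n)" "\<And>x. x \<notin> Z \<Longrightarrow> (\<lambda>n. g n x) \<longlonglongrightarrow> u x"
    unfolding measurable_on_def by auto
  have [measurable]: "g n \<in> borel_measurable borel" for n by (rule borel_measurable_continuous_onI[OF g(1)])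
  have AEZ: "AE x in lborel. x \<notin> Z"
  proof -
    have "AE x in lebesgue. x \<notin> Z" using Z by (intro AE_not_in) (simp add: negligible_iff_null_sets)
    then show ?thesis by (simp add: AE_completion_iff)
  qed
  have [measurable]: "cball (0::'a) (real m + 1) \<in> sets borel" by simp
  have "(\<lambda>n. \<integral>\<^sup>+x. ennreal ((T (real m) (u x) x - T (real m) (g n x) x)\<^sup>2) \<partial>lborel) \<longlonglongrightarrow> (\<integral>\<^sup>+(x::'a). 0 \<partial>lborel)"
  proof (rule nn_integral_dominated_convergence[where w = "\<lambda>x. ennreal ((2 * real m)\<^sup>2) * indicator (cball 0 (real m + 1)) x"])
    show "AE x in lborel. ennreal ((T (real m) (u x) x - T (real m) (g n x) x)\<^sup>2) \<le> ennreal ((2 * real m)\<^sup>2) * indicator (cball 0 (real m + 1)) x" for n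
    proof (rule AE_I2)
      fix x
      have "\<bar>T (real m) (u x) x - T (real m) (g n x) x\<bar> \<le> 2 * real m * indicator (cball 0 (real m + 1)) x"
        using TM[of "real m" "u x" x] TM[of "real m" "g n x" x] by simp
      then have "\<bar>T (real m) (u x) x - T (real m) (g n x) x\<bar>\<^sup>2 \<le> (2 * real m * indicator (cball 0 (real m + 1)) x)\<^sup>2"
        by (intro power_mono) auto
      then show "ennreal ((T (real m) (u x) x - T (real m) (g n x) x)\<^sup>2) \<le> ennreal ((2 * real m)\<^sup>2) * indicator (cball 0 (real m + 1)) x"
        by (auto simp: indicator_def intro!: ennreal_leI)
    qed
    show "(\<integral>\<^sup>+x. ennreal ((2 * real m)\<^sup>2) * indicator (cball (0::'a) (real m + 1)) x \<partial>lborel) < \<infinity>"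
      using emeasure_bounded_finite[of "cball (0::'a) (real m + 1)"]
      by (subst nn_integral_cmult) (auto simp: ennreal_mult_less_top)
    show "AE x in lborel. (\<lambda>n. ennreal ((T (real m) (u x) x - T (real m) (g n x) x)\<^sup>2)) \<longlonglongrightarrow> 0"
      using AEZ
    proof eventually_elim
      fix x assume "x \<notin> Z"
      then have "(\<lambda>n. ennreal ((T (real m) (u x) x - T (real m) (g n x) x)\<^sup>2)) \<longlonglongrightarrow> ennreal ((T (real m) (u x) x - T (real m) (u x) x)\<^sup>2)"
        unfolding T_def clamp_def by (intro tendsto_ennrealI tendsto_intros g(2))
      then show "(\<lambda>n. ennreal ((T (real m) (u x) x - T (real m) (g n x) x)\<^sup>2)) \<longlonglongrightarrow> 0" by simp
    qed
  qed measurable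
  then have "\<forall>\<^sub>F n in sequentially. (\<integral>\<^sup>+x. ennreal ((T (real m) (u x) x - T (real m) (g n x) x)\<^sup>2) \<partial>lborel) < ennreal (\<delta> / 4)"
    using \<delta> by (intro order_tendstoD) auto
  then obtain n where "(\<integral>\<^sup>+x. ennreal ((T (real m) (u x) x - T (real m) (g n x) x)\<^sup>2) \<partial>lborel) < ennreal (\<delta> / 4)"
    by (auto simp: eventually_sequentially)
  then have 2: "(\<integral>\<^sup>+x. ennreal ((T (real m) (u x) x - T (real m) (g n x) x)\<^sup>2) \<partial>lborel) \<le> ennreal (\<delta> / 4)" by simp
  have "(\<integral>\<^sup>+x. ennreal ((u x - T (real m) (u x) x + (T (real m) (u x) x - T (real m) (g n x) x))\<^sup>2) \<partial>lborel) \<le> ennreal (2 * (\<delta> / 4) + 2 * (\<delta> / 4))"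
    by (rule nn_integral_square_add[OF _ _ 1 2]) (use \<delta> in auto)
  then have "(\<integral>\<^sup>+x. ennreal ((u x - T (real m) (g n x) x)\<^sup>2) \<partial>lborel) \<le> ennreal \<delta>" by simp
  moreover have "continuous_on UNIV (\<lambda>x. T (real m) (g n x) x)"
    unfolding T_def clamp_def cut_def by (intro continuous_intros g(1))
  moreover have "T (real m) (g n x) x = 0" if "x \<notin> cball 0 (real m + 1)" for x
    using TM[of "real m" "g n x" x] that by simp
  ultimately show ?thesis by blast
qed

section \<open>Convergence of mollifications\<close>

lemma uniformly_continuous_compact_support:
  fixes v :: "'a::euclidean_space \<Rightarrow> real"
  assumes cont: "continuous_on UNIV v" and supp: "\<And>x. x \<notin> cball 0 R \<Longrightarrow> v x = 0" and "0 < \<eta>"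
  shows "\<exists>d>0. \<forall>x y. dist x y < d \<longrightarrow> \<bar>v x - v y\<bar> \<le> \<eta>"
proof -
  have "uniformly_continuous_on (cball 0 (R + 1)) v"
    by (intro compact_uniformly_continuous continuous_on_subset[OF cont]) auto
  then obtain d where d: "0 < d" "\<And>x y. x \<in> cball 0 (R + 1) \<Longrightarrow> y \<in> cball 0 (R + 1) \<Longrightarrow> dist y x < d \<Longrightarrow> dist (v y) (v x) < \<eta>"
    using \<open>0 < \<eta>\<close> unfolding uniformly_continuous_on_def by metis
  have "\<bar>v x - v y\<bar> \<le> \<eta>" if "dist x y < min d 1" for x y
  proof (cases "x \<in> cball 0 (R + 1) \<and> y \<in> cball 0 (R + 1)")
    case True
    then show ?thesis using d(2)[of y x] that by (simp add: dist_real_def)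
  next
    case False
    have "norm x \<le> norm y + dist x y" "norm y \<le> norm x + dist x y"
      using norm_triangle_ineq2[of x y] norm_triangle_ineq2[of y x] by (auto simp: dist_norm norm_minus_commute)
    then have "x \<notin> cball 0 R" "y \<notin> cball 0 R" using False that by auto
    then show ?thesis using supp \<open>0 < \<eta>\<close> by simp
  qed
  then show ?thesis using d(1) by (intro exI[of _ "min d 1"]) auto
qed

lemma mollify_uniform:
  fixes v :: "real ^ 'n::finite \<Rightarrow> real"
  assumes e: "0 < e" and [measurable]: "v \<in> borel_measurable borel" and int: "integrable lborel (\<lambda>y. v y * bump e (x - y))"
    and v: "\<And>y. dist x y \<le> e \<Longrightarrow> \<bar>v y - v x\<bar> \<le> \<eta>"
  shows "\<bar>mollify e v x / bump_mass TYPE('n) e - v x\<bar> \<le> \<eta>"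
proof -
  let ?J = "bump_mass TYPE('n) e"
  note J = bump_integral[OF e, where 'n = 'n]
  have "mollify e v x - v x * ?J = (\<integral>y. v y * bump e (x - y) - v x * bump e (x - y) \<partial>lborel)"
    unfolding mollify_def J(2)[of x, symmetric] using int J(1)[of x]
    by (subst Bochner_Integration.integral_diff) auto
  also have "\<bar>\<dots>\<bar> \<le> (\<integral>y. \<eta> * bump e (x - y) \<partial>lborel)"
  proof (rule integral_abs_bound_integral)
    fix y
    show "\<bar>v y * bump e (x - y) - v x * bump e (x - y)\<bar> \<le> \<eta> * bump e (x - y)"
    proof (cases "dist x y \<le> e")
      case True
      have "\<bar>v y * bump e (x - y) - v x * bump e (x - y)\<bar> = \<bar>v y - v x\<bar> * bump e (x - y)"
        by (simp add: left_diff_distrib[symmetric] abs_mult bump_nonneg)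
      then show ?thesis using v[OF True] by (simp add: mult_right_mono bump_nonneg)
    next
      case False
      then show ?thesis using bump_outside[OF e, of y x] by simp
    qed
  qed (use int J(1)[of x] in auto)
  also have "\<dots> = \<eta> * ?J" using J(2)[of x] by simp
  finally have "\<bar>mollify e v x - v x * ?J\<bar> \<le> \<eta> * ?J" .
  moreover have "mollify e v x / ?J - v x = (mollify e v x - v x * ?J) / ?J" using J(5) by (simp add: field_simps)
  ultimately show ?thesis using J(5) by (simp add: field_simps)
qed

text \<open>Mollification is bounded on \<open>L^2\<close> uniformly in the radius, so it suffices to know the convergence for the dense class of
continuous functions of compact support, where it is uniform.\<close>

lemma mollify_converges_L2:
  fixes u :: "real ^ 'n::finite \<Rightarrow> real"
  assumes u: "lp_le 2 a u" and e: "\<And>n. 0 < e n" "e \<longlonglongrightarrow> 0"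
  shows "(\<lambda>n. \<integral>\<^sup>+x. ennreal ((mollify (e n) u x / bump_mass TYPE('n) (e n) - u x)\<^sup>2) \<partial>lborel) \<longlonglongrightarrow> 0"
proof (rule order_tendstoI)
  fix c :: ennreal assume "0 < c"
  \<comment> \<open>A positive real number that is at most \<open>c\<close>.\<close>
  define \<epsilon> where "\<epsilon> = (if c = top then 1 else enn2real c)"
  have \<epsilon>: "0 < \<epsilon>" "ennreal \<epsilon> \<le> c" using \<open>0 < c\<close> by (auto simp: \<epsilon>_def enn2real_positive_iff less_top)
  define \<delta> where "\<delta> = \<epsilon> / 16"
  have \<delta>: "0 < \<delta>" using \<epsilon> by (simp add: \<delta>_def)
  have [measurable]: "u \<in> borel_measurable borel" using u by (simp add: lp_le_def)
  obtain v R where v: "continuous_on UNIV v" "\<And>x. x \<notin> cball 0 R \<Longrightarrow> v x = 0" "(\<integral>\<^sup>+x. ennreal ((u x - v x)\<^sup>2) \<partial>lborel) \<le> ennreal \<delta>"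
    using continuous_compact_support_dense_L2[OF u \<delta>] by blast
  have [measurable]: "v \<in> borel_measurable borel" by (rule borel_measurable_continuous_onI[OF v(1)])
  define K where "K = cball (0 :: real ^ 'n) (R + 1)"
  have [measurable]: "K \<in> sets borel" by (simp add: K_def)
  have "emeasure lborel K < \<infinity>" unfolding K_def using emeasure_bounded_finite[of "cball (0::real^'n) (R+1)"] by simp
  then obtain V where V: "0 \<le> V" "emeasure lborel K = ennreal V" by (metis ennreal_cases infinity_ennreal_def less_irrefl)
  define \<eta> where "\<eta> = sqrt (\<delta> / (V + 1))"
  have \<eta>: "0 < \<eta>" "\<eta>\<^sup>2 * V \<le> \<delta>" using \<delta> V by (auto simp: \<eta>_def field_simps)
  obtain d where d: "0 < d" "\<And>x y. dist x y < d \<Longrightarrow> \<bar>v x - v y\<bar> \<le> \<eta>"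
    using uniformly_continuous_compact_support[OF v(1,2) \<eta>(1)] by blast
  have uv: "lp_le 2 (sqrt \<delta>) (\<lambda>x. u x - v x)" using v(3) \<delta> by (simp add: lp_le_2_iff)
  have "\<forall>\<^sub>F n in sequentially. e n < min d 1" using e(2) d(1) by (intro order_tendstoD) auto
  then show "\<forall>\<^sub>F n in sequentially. (\<integral>\<^sup>+x. ennreal ((mollify (e n) u x / bump_mass TYPE('n) (e n) - u x)\<^sup>2) \<partial>lborel) < c"
  proof eventually_elim
    case (elim n)
    let ?J = "bump_mass TYPE('n) (e n)"
    have en: "0 < e n" "e n < d" "e n < 1" using elim e by auto
    have J: "0 < ?J" using bump_integral(5)[OF en(1)] .
    have intv: "integrable lborel (\<lambda>y. v y * bump (e n) (x - y))" for x
    proof -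
      have "integrable lborel (\<lambda>y. u y * bump (e n) (x - y) - (u y - v y) * bump (e n) (x - y))"
        by (intro Bochner_Integration.integrable_diff integrable_mollify[OF en(1) u] integrable_mollify[OF en(1) uv])
      then show ?thesis by (simp add: left_diff_distrib)
    qed
    have vv: "(\<integral>\<^sup>+x. ennreal ((mollify (e n) v x / ?J - v x)\<^sup>2) \<partial>lborel) \<le> ennreal \<delta>"
    proof -
      have "(\<integral>\<^sup>+x. ennreal ((mollify (e n) v x / ?J - v x)\<^sup>2) \<partial>lborel) \<le> (\<integral>\<^sup>+x. ennreal (\<eta>\<^sup>2) * indicator K x \<partial>lborel)"
      proof (rule nn_integral_mono)
        fix x
        show "ennreal ((mollify (e n) v x / ?J - v x)\<^sup>2) \<le> ennreal (\<eta>\<^sup>2) * indicator K x"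
        proof (cases "x \<in> K")
          case True
          have "\<bar>mollify (e n) v x / ?J - v x\<bar> \<le> \<eta>"
            using d(2) en by (intro mollify_uniform intv) (auto simp: dist_commute)
          then have "\<bar>mollify (e n) v x / ?J - v x\<bar>\<^sup>2 \<le> \<eta>\<^sup>2" by (intro power_mono) auto
          then show ?thesis using True by (simp add: ennreal_leI)
        next
          case False
          have z: "v y = 0" if "dist x y \<le> e n" for y
          proof (rule v(2))
            have "norm x \<le> norm y + dist x y" using norm_triangle_ineq2[of x y] by (simp add: dist_norm)
            then show "y \<notin> cball 0 R" using False that en by (simp add: K_def)
          qed
          have "\<bar>mollify (e n) v x / ?J - v x\<bar> \<le> 0"
            using z z[of x] en by (intro mollify_uniform intv) auto
          then show ?thesis by simp
        qed
      qed
      also have "\<dots> = ennreal (\<eta>\<^sup>2 * V)" using V by (subst nn_integral_cmult) (auto simp: ennreal_mult)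
      also have "\<dots> \<le> ennreal \<delta>" using \<eta> by (intro ennreal_leI) auto
      finally show ?thesis .
    qed
    have uvm: "(\<integral>\<^sup>+x. ennreal ((mollify (e n) (\<lambda>x. u x - v x) x / ?J)\<^sup>2) \<partial>lborel) \<le> ennreal \<delta>"
    proof -
      have "(\<integral>\<^sup>+x. ennreal ((mollify (e n) (\<lambda>x. u x - v x) x / ?J)\<^sup>2) \<partial>lborel)
        = (\<integral>\<^sup>+x. ennreal (1 / ?J\<^sup>2) * ennreal ((mollify (e n) (\<lambda>x. u x - v x) x)\<^sup>2) \<partial>lborel)"
        by (intro nn_integral_cong) (simp add: ennreal_mult[symmetric] power_divide)
      also have "\<dots> = ennreal (1 / ?J\<^sup>2) * (\<integral>\<^sup>+x. ennreal ((mollify (e n) (\<lambda>x. u x - v x) x)\<^sup>2) \<partial>lborel)"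
        by (rule nn_integral_cmult) measurable
      also have "\<dots> \<le> ennreal (1 / ?J\<^sup>2) * (ennreal (?J\<^sup>2) * (\<integral>\<^sup>+x. ennreal ((u x - v x)\<^sup>2) \<partial>lborel))"
        by (intro mult_left_mono mollify_L2 en) auto
      also have "\<dots> = (\<integral>\<^sup>+x. ennreal ((u x - v x)\<^sup>2) \<partial>lborel)"
        using J by (simp add: mult.assoc[symmetric] ennreal_mult[symmetric])
      finally show ?thesis using v(3) by simp
    qed
    have vu: "(\<integral>\<^sup>+x. ennreal ((v x - u x)\<^sup>2) \<partial>lborel) \<le> ennreal \<delta>"
      using v(3) by (simp add: power2_commute)
    have "(\<integral>\<^sup>+x. ennreal (((mollify (e n) v x / ?J - v x) + (v x - u x))\<^sup>2) \<partial>lborel) \<le> ennreal (2 * \<delta> + 2 * \<delta>)"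
      by (rule nn_integral_square_add[OF _ _ vv vu]) (use \<delta> in auto)
    then have "(\<integral>\<^sup>+x. ennreal ((mollify (e n) (\<lambda>x. u x - v x) x / ?J + ((mollify (e n) v x / ?J - v x) + (v x - u x)))\<^sup>2) \<partial>lborel) \<le> ennreal (2 * \<delta> + 2 * (2 * \<delta> + 2 * \<delta>))"
      by (intro nn_integral_square_add[OF _ _ uvm]) (use \<delta> in auto)
    moreover have "mollify (e n) (\<lambda>x. u x - v x) x = mollify (e n) u x - mollify (e n) v x" for x
      unfolding mollify_def left_diff_distrib
      by (rule Bochner_Integration.integral_diff[OF integrable_mollify[OF en(1) u] intv])
    ultimately have "(\<integral>\<^sup>+x. ennreal ((mollify (e n) u x / ?J - u x)\<^sup>2) \<partial>lborel) \<le> ennreal (10 * \<delta>)"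
      by (simp add: diff_divide_distrib)
    also have "\<dots> < ennreal \<epsilon>" using \<epsilon> by (auto simp: \<delta>_def ennreal_less_iff)
    also have "\<dots> \<le> c" by fact
    finally show ?case .
  qed
qed simp

lemma mollify_converges_AE:
  fixes u :: "real ^ 'n::finite \<Rightarrow> real"
  assumes u: "lp_le 2 a u"
  shows "\<exists>e. (\<forall>n. 0 < e n) \<and> (AE x in lborel. (\<lambda>n. mollify (e n) u x / bump_mass TYPE('n) (e n)) \<longlonglongrightarrow> u x)"
proof -
  have [measurable]: "u \<in> borel_measurable borel" using u by (simp add: lp_le_def)
  define e where "e n = inverse (real (Suc n))" for n
  have e: "\<And>n. 0 < e n" "e \<longlonglongrightarrow> 0" using LIMSEQ_inverse_real_of_nat by (auto simp: e_def[abs_def])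
  define D where "D n x = (mollify (e n) u x / bump_mass TYPE('n) (e n) - u x)\<^sup>2" for n x
  have [measurable]: "D n \<in> borel_measurable borel" for n unfolding D_def by measurable
  have lim: "(\<lambda>n. \<integral>\<^sup>+x. ennreal (D n x) \<partial>lborel) \<longlonglongrightarrow> 0"
    unfolding D_def by (rule mollify_converges_L2[OF u e])
  then have "\<forall>\<^sub>F n in sequentially. (\<integral>\<^sup>+x. ennreal (D n x) \<partial>lborel) < 1"
    by (rule order_tendstoD) simp
  then obtain m where m: "\<And>n. m \<le> n \<Longrightarrow> (\<integral>\<^sup>+x. ennreal (D n x) \<partial>lborel) < 1"
    by (auto simp: eventually_sequentially)
  have D0: "0 \<le> D n x" for n x by (simp add: D_def)
  have int: "integrable lborel (D (n + m))" for n
    using m[of "n + m"] D0 by (auto simp: integrable_iff_bounded intro: less_trans)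
  have "(\<integral>\<^sup>+x. ennreal (D (n + m) x) \<partial>lborel) = ennreal (\<integral>x. norm (D (n + m) x) \<partial>lborel)" for n
    using int D0 by (simp add: nn_integral_eq_integral)
  moreover have "(\<lambda>n. \<integral>\<^sup>+x. ennreal (D (n + m) x) \<partial>lborel) \<longlonglongrightarrow> 0" using lim by (rule LIMSEQ_ignore_initial_segment)
  ultimately have "(\<lambda>n. \<integral>x. norm (D (n + m) x) \<partial>lborel) \<longlonglongrightarrow> 0"
    using tendsto_ennreal_iff[of "\<lambda>n. \<integral>x. norm (D (n + m) x) \<partial>lborel" sequentially 0] by simp
  from tendsto_L1_AE_subseq[OF int this] obtain r where r: "AE x in lborel. (\<lambda>n. D (r n + m) x) \<longlonglongrightarrow> 0"
    by blast
  have "AE x in lborel. (\<lambda>n. mollify (e (r n + m)) u x / bump_mass TYPE('n) (e (r n + m))) \<longlonglongrightarrow> u x"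
    using r
  proof eventually_elim
    case (elim x)
    have "(\<lambda>n. sqrt (D (r n + m) x)) \<longlonglongrightarrow> sqrt 0" by (rule tendsto_real_sqrt[OF elim])
    then have "(\<lambda>n. mollify (e (r n + m)) u x / bump_mass TYPE('n) (e (r n + m)) - u x) \<longlonglongrightarrow> 0"
      by (simp add: D_def tendsto_rabs_zero_iff)
    then show ?case by (rule LIM_zero_cancel)
  qed
  then show ?thesis using e(1) by (intro exI[of _ "\<lambda>n. e (r n + m)"]) auto
qed

section \<open>Sobolev's inequality\<close>

lemma lp_le_Fatou:
  fixes v :: "nat \<Rightarrow> 'a::euclidean_space \<Rightarrow> real"
  assumes v: "\<And>n. lp_le p a (v n)" and [measurable]: "u \<in> borel_measurable borel"
    and lim: "AE x in lborel. (\<lambda>n. v n x) \<longlonglongrightarrow> u x" and "0 < p"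
  shows "lp_le p a u"
proof -
  have [measurable]: "v n \<in> borel_measurable borel" for n using v by (simp add: lp_le_def)
  have "(\<integral>\<^sup>+x. ennreal (\<bar>u x\<bar> powr p) \<partial>lborel) = (\<integral>\<^sup>+x. liminf (\<lambda>n. ennreal (\<bar>v n x\<bar> powr p)) \<partial>lborel)"
  proof (rule nn_integral_cong_AE)
    show "AE x in lborel. ennreal (\<bar>u x\<bar> powr p) = liminf (\<lambda>n. ennreal (\<bar>v n x\<bar> powr p))"
      using lim
    proof eventually_elim
      case (elim x)
      have "(\<lambda>n. ennreal (\<bar>v n x\<bar> powr p)) \<longlonglongrightarrow> ennreal (\<bar>u x\<bar> powr p)"
        using \<open>0 < p\<close> by (intro tendsto_ennrealI tendsto_powr' tendsto_rabs elim tendsto_const) auto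
      then show ?case by (intro lim_imp_Liminf[symmetric]) auto
    qed
  qed
  also have "\<dots> \<le> liminf (\<lambda>n. \<integral>\<^sup>+x. ennreal (\<bar>v n x\<bar> powr p) \<partial>lborel)" by (rule nn_integral_liminf) measurable
  also have "\<dots> \<le> ennreal (a powr p)"
    using v by (intro Liminf_le) (auto simp: lp_le_def)
  finally show ?thesis using v by (auto simp: lp_le_def)
qed

text \<open>The mollified function is bounded pointwise by the potential of order 1 of the mollified gradient, to which the
potential bound from \<open>L^2\<close> to \<open>L^crit\<close> applies with a constant independent of the radius. Fatou's
lemma removes the mollification. The identity for \<open>mollify\<close> in the hypotheses says that \<open>g i\<close> is the
\<open>i\<close>-th weak derivative, tested with translated bump functions only.\<close>

lemma Sobolev_inequality_borel:
  assumes N: "3 \<le> CARD('n::finite)"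
  obtains C where "0 < C"
    "\<And>(u :: real ^ 'n \<Rightarrow> real) g a K. lp_le 2 a u \<Longrightarrow> (\<And>i. g i \<in> borel_measurable borel) \<Longrightarrow>
      (\<And>e i x. 0 < e \<Longrightarrow> (\<integral>y. u y * bump_deriv e i (x - y) \<partial>lborel) = mollify e (g i) x) \<Longrightarrow>
      0 \<le> K \<Longrightarrow> (\<Sum>i\<in>UNIV. \<integral>\<^sup>+x. ennreal ((g i x)\<^sup>2) \<partial>lborel) \<le> ennreal (K\<^sup>2) \<Longrightarrow>
      lp_le (2 * real CARD('n) / (real CARD('n) - 2)) (C * K) u"
proof -
  let ?N = "real CARD('n)"
  define q where "q = 2 * ?N / (?N - 2)"
  have N3: "3 \<le> ?N" using N by simp
  have q: "1 < q" "1 / q = 1 / 2 + (?N - 1) / DIM(real ^ 'n) - 1" using N3 by (auto simp: q_def field_simps)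
  have two: "1 < (2::real)" by simp
  have \<mu>: "0 < ?N - 1" "?N - 1 < real DIM(real ^ 'n)" using N3 by auto
  obtain C where C: "0 < C"
    "\<And>(g::real^'n \<Rightarrow> real) a. lp_le 2 a g \<Longrightarrow> AE x in lborel. riesz_pot (?N - 1) g x < \<infinity>"
    "\<And>(g::real^'n \<Rightarrow> real) a. lp_le 2 a g \<Longrightarrow> lp_le q (C * a) (\<lambda>x. enn2real (riesz_pot (?N - 1) g x))"
    by (rule Riesz_potential_bound[OF \<mu> two q]) blast
  define \<omega> where "\<omega> = unit_ball_vol ?N"
  have \<omega>: "0 < \<omega>" using N3 by (simp add: \<omega>_def)
  have main: "lp_le q (C / \<omega> * K) u" if u: "lp_le 2 a u" and gm: "\<And>i. g i \<in> borel_measurable borel"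
    and parts: "\<And>e i x. 0 < e \<Longrightarrow> (\<integral>y. u y * bump_deriv e i (x - y) \<partial>lborel) = mollify e (g i) x"
    and K: "0 \<le> K" "(\<Sum>i\<in>UNIV. \<integral>\<^sup>+x. ennreal ((g i x)\<^sup>2) \<partial>lborel) \<le> ennreal (K\<^sup>2)"
    for u :: "real ^ 'n \<Rightarrow> real" and g a K
  proof -
    note [measurable] = gm
    have um[measurable]: "u \<in> borel_measurable borel" using u by (simp add: lp_le_def)
    have M: "lp_le q (C / \<omega> * K) (\<lambda>x. mollify e u x / bump_mass TYPE('n) e)" if e: "0 < e" for e
    proof -
      let ?J = "bump_mass TYPE('n) e"
      have J: "0 < ?J" using bump_integral(5)[OF e] .
      define G where "G x = norm (\<chi> i. mollify e (g i) x)" for x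
      have G2: "(G x)\<^sup>2 = (\<Sum>i\<in>UNIV. (mollify e (g i) x)\<^sup>2)" for x
        by (simp add: G_def norm_vec_def L2_set_def sum_nonneg)
      have "G = (\<lambda>x. sqrt (\<Sum>i\<in>UNIV. (mollify e (g i) x)\<^sup>2))"
        by (rule ext) (simp add: G_def norm_vec_def L2_set_def)
      then have Gm[measurable]: "G \<in> borel_measurable borel" by simp
      have "(\<integral>\<^sup>+x. ennreal ((G x)\<^sup>2) \<partial>lborel) = (\<integral>\<^sup>+x. (\<Sum>i\<in>UNIV. ennreal ((mollify e (g i) x)\<^sup>2)) \<partial>lborel)"
        by (simp add: G2 sum_ennreal)
      also have "\<dots> = (\<Sum>i\<in>UNIV. \<integral>\<^sup>+x. ennreal ((mollify e (g i) x)\<^sup>2) \<partial>lborel)"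
        by (rule nn_integral_sum) measurable
      also have "\<dots> \<le> (\<Sum>i\<in>UNIV. ennreal (?J\<^sup>2) * (\<integral>\<^sup>+x. ennreal ((g i x)\<^sup>2) \<partial>lborel))"
        by (intro sum_mono mollify_L2 e gm)
      also have "\<dots> = ennreal (?J\<^sup>2) * (\<Sum>i\<in>UNIV. \<integral>\<^sup>+x. ennreal ((g i x)\<^sup>2) \<partial>lborel)"
        by (simp add: sum_distrib_left)
      also have "\<dots> \<le> ennreal (?J\<^sup>2) * ennreal (K\<^sup>2)" by (intro mult_left_mono K) auto
      also have "\<dots> = ennreal ((?J * K)\<^sup>2)" by (simp add: ennreal_mult power_mult_distrib)
      finally have G: "lp_le 2 (?J * K) G" using J K by (simp add: lp_le_2_iff)
      have bound: "ennreal (\<omega> * \<bar>mollify e u x\<bar>) \<le> riesz_pot (?N - 1) G x" for x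
      proof -
        have "ennreal (unit_ball_vol (real DIM(real ^ 'n)) * \<bar>mollify e u x\<bar>) \<le> riesz_pot (real DIM(real ^ 'n) - 1) G x"
        proof (rule line_bound_imp_riesz_pot_bound[OF Gm])
          show "0 \<le> G x" for x by (simp add: G_def)
          show "ennreal \<bar>mollify e u x\<bar> \<le> ennreal \<bar>mollify e u (x + T *\<^sub>R h)\<bar>
              + (\<integral>\<^sup>+s. ennreal (norm h * G (x + s *\<^sub>R h)) * indicator {0..T} s \<partial>lborel)" if "0 \<le> T" for x h T
            unfolding G_def by (rule mollify_line[OF e u gm parts[OF e] that])
          show "(\<lambda>n. mollify e u (x + real n *\<^sub>R h)) \<longlonglongrightarrow> 0" if "h \<noteq> 0" for x h
            by (rule mollify_decay[OF e u that])
        qed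
        then show ?thesis by (simp add: \<omega>_def)
      qed
      have P: "lp_le q (C * (?J * K)) (\<lambda>x. enn2real (riesz_pot (?N - 1) G x))" by (rule C(3)[OF G])
      have "lp_le q (C * (?J * K)) (\<lambda>x. \<omega> * mollify e u x)"
      proof -
        have "(\<integral>\<^sup>+x. ennreal (\<bar>\<omega> * mollify e u x\<bar> powr q) \<partial>lborel) \<le> (\<integral>\<^sup>+x. ennreal (\<bar>enn2real (riesz_pot (?N - 1) G x)\<bar> powr q) \<partial>lborel)"
        proof (rule nn_integral_mono_AE, use C(2)[OF G] in eventually_elim)
          fix x assume fin: "riesz_pot (?N - 1) G x < \<infinity>"
          have "\<omega> * \<bar>mollify e u x\<bar> \<le> enn2real (riesz_pot (?N - 1) G x)"
            using bound[of x] fin \<omega> enn2real_mono[OF bound[of x]] by simp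
          then show "ennreal (\<bar>\<omega> * mollify e u x\<bar> powr q) \<le> ennreal (\<bar>enn2real (riesz_pot (?N - 1) G x)\<bar> powr q)"
            using \<omega> q by (intro ennreal_leI powr_mono2) (auto simp: abs_mult)
        qed
        then show ?thesis using P by (auto simp: lp_le_def intro: order_trans)
      qed
      from lp_le_cmult[OF this, of "1 / (\<omega> * ?J)"] show ?thesis using q \<omega> J by (simp add: mult_ac)
    qed
    obtain e where e: "\<And>n. 0 < e n" "AE x in lborel. (\<lambda>n. mollify (e n) u x / bump_mass TYPE('n) (e n)) \<longlonglongrightarrow> u x"
      using mollify_converges_AE[OF u] by blast
    show ?thesis using q by (intro lp_le_Fatou[OF M[OF e(1)] um e(2)]) auto
  qed
  show ?thesis
  proof (rule that[of "C / \<omega>"])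
    show "0 < C / \<omega>" using C(1) \<omega> by simp
  qed (rule main[unfolded q_def])
qed

lemma AE_lborel_of_lebesgue: "AE x in lebesgue. P x \<Longrightarrow> AE x in lborel. P x"
  by (simp add: AE_completion_iff)

text \<open>Composition with \<open>x - y\<close> preserves Borel measurability but not Lebesgue measurability with respect to the product
\<open>\<sigma>\<close>-algebra. For Tonelli's theorem, functions in \<open>H1\<close> are therefore replaced by Borel functions to which
they are equal almost everywhere.\<close>

lemma integral_lebesgue_eq_lborel:
  fixes f g :: "'a::euclidean_space \<Rightarrow> real"
  assumes "f \<in> borel_measurable lebesgue" "g \<in> borel_measurable borel" "AE x in lebesgue. f x = g x"
  shows "(\<integral>x. f x \<partial>lebesgue) = (\<integral>x. g x \<partial>lborel)"
proof -
  have "(\<integral>x. f x \<partial>lebesgue) = (\<integral>x. g x \<partial>lebesgue)"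
    using assms by (intro integral_cong_AE) (auto intro: measurable_completion)
  also have "\<dots> = (\<integral>x. g x \<partial>lborel)" using assms by (intro integral_completion) simp
  finally show ?thesis .
qed

lemma L2_fun_measurable: "u \<in> L2_fun \<Longrightarrow> u \<in> borel_measurable lebesgue"
  by (simp add: L2_fun_def)

lemma borel_representative:
  fixes u :: "'a::euclidean_space \<Rightarrow> real"
  assumes "u \<in> borel_measurable lebesgue"
  shows "\<exists>v. v \<in> borel_measurable borel \<and> (AE x in lebesgue. u x = v x)"
  using completion_ex_borel_measurable_real[OF assms] by (auto intro: AE_completion)

lemma L2_fun_square_integral:
  assumes u: "u \<in> L2_fun" and v[measurable]: "v \<in> borel_measurable borel" and uv: "AE x in lebesgue. u x = v x"
  shows "(\<integral>\<^sup>+x. ennreal ((v x)\<^sup>2) \<partial>lborel) = ennreal (\<integral>x. (u x)\<^sup>2 \<partial>lebesgue)"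
proof -
  have int: "integrable lebesgue (\<lambda>x. (u x)\<^sup>2)" using u by (simp add: L2_fun_def)
  have "(\<integral>\<^sup>+x. ennreal ((v x)\<^sup>2) \<partial>lborel) = (\<integral>\<^sup>+x. ennreal ((v x)\<^sup>2) \<partial>lebesgue)"
    by (simp add: nn_integral_completion)
  also have "\<dots> = (\<integral>\<^sup>+x. ennreal ((u x)\<^sup>2) \<partial>lebesgue)"
    using uv by (intro nn_integral_cong_AE) (auto elim: eventually_mono)
  also have "\<dots> = ennreal (\<integral>x. (u x)\<^sup>2 \<partial>lebesgue)" using int by (intro nn_integral_eq_integral) auto
  finally show ?thesis .
qed

lemma weak_pderiv_H1:
  assumes "u \<in> H1"
  shows "weak_pderiv i u \<in> L2_fun" "is_weak_pderiv i u (weak_pderiv i u)"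
proof -
  have "\<exists>g. g \<in> L2_fun \<and> is_weak_pderiv i u g" using assms by (auto simp: H1_def)
  from someI_ex[OF this] show "weak_pderiv i u \<in> L2_fun" "is_weak_pderiv i u (weak_pderiv i u)"
    by (auto simp: weak_pderiv_def)
qed

lemma H1_measurable: "u \<in> H1 \<Longrightarrow> u \<in> borel_measurable lebesgue"
  by (simp add: H1_def L2_fun_def)

lemma H1_norm_nonneg: "0 \<le> H1_norm u"
  by (simp add: H1_norm_def sum_nonneg)

lemma H1_norm_square: "(H1_norm u)\<^sup>2 = (\<integral>x. (u x)\<^sup>2 \<partial>lebesgue) + (\<Sum>i\<in>UNIV. \<integral>x. (weak_pderiv i u x)\<^sup>2 \<partial>lebesgue)"
  by (simp add: H1_norm_def sum_nonneg)

lemma H1_L2_bound: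
  assumes u: "u \<in> H1" and v: "v \<in> borel_measurable borel" "AE x in lebesgue. u x = v x"
  shows "lp_le 2 (H1_norm u) v"
proof -
  have "(\<integral>\<^sup>+x. ennreal ((v x)\<^sup>2) \<partial>lborel) = ennreal (\<integral>x. (u x)\<^sup>2 \<partial>lebesgue)"
    using u v by (intro L2_fun_square_integral) (auto simp: H1_def)
  also have "\<dots> \<le> ennreal ((H1_norm u)\<^sup>2)"
    unfolding H1_norm_square by (intro ennreal_leI) (simp add: sum_nonneg)
  finally show ?thesis using v by (simp add: lp_le_2_iff H1_norm_nonneg)
qed

lemma weak_pderiv_mollify:
  fixes u :: "real ^ 'n::finite \<Rightarrow> real"
  assumes u: "u \<in> borel_measurable lebesgue" and g: "g \<in> borel_measurable lebesgue" and weak: "is_weak_pderiv i u g"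
    and v[measurable]: "v \<in> borel_measurable borel" and uv: "AE x in lebesgue. u x = v x"
    and k[measurable]: "k \<in> borel_measurable borel" and gk: "AE x in lebesgue. g x = k x"
    and e: "0 < e"
  shows "(\<integral>y. v y * bump_deriv e i (x - y) \<partial>lborel) = mollify e k x"
proof -
  have 1: "(\<integral>y. u y * pderiv_at i (\<lambda>y. bump e (x - y)) y \<partial>lebesgue) = (\<integral>y. v y * - bump_deriv e i (x - y) \<partial>lborel)"
    unfolding pderiv_at_bump
  proof (rule integral_lebesgue_eq_lborel)
    show "(\<lambda>y. u y * - bump_deriv e i (x - y)) \<in> borel_measurable lebesgue"
      by (intro borel_measurable_times u measurable_completion) measurable
    show "AE y in lebesgue. u y * - bump_deriv e i (x - y) = v y * - bump_deriv e i (x - y)"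
      using uv by eventually_elim simp
  qed measurable
  have 2: "(\<integral>y. g y * bump e (x - y) \<partial>lebesgue) = (\<integral>y. k y * bump e (x - y) \<partial>lborel)"
  proof (rule integral_lebesgue_eq_lborel)
    show "(\<lambda>y. g y * bump e (x - y)) \<in> borel_measurable lebesgue"
      by (intro borel_measurable_times g measurable_completion) measurable
    show "AE y in lebesgue. g y * bump e (x - y) = k y * bump e (x - y)"
      using gk by eventually_elim simp
  qed measurable
  have "(\<integral>y. u y * pderiv_at i (\<lambda>y. bump e (x - y)) y \<partial>lebesgue) = - (\<integral>y. g y * bump e (x - y) \<partial>lebesgue)"
    using weak test_function_bump[OF e] by (auto simp: is_weak_pderiv_def)
  then show ?thesis unfolding 1 2 by (simp add: mollify_def)
qed

theorem Sobolev_inequality: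
  assumes N: "3 \<le> CARD('n::finite)"
  obtains C where "0 < C"
    "\<And>(u :: real ^ 'n \<Rightarrow> real) v. u \<in> H1 \<Longrightarrow> v \<in> borel_measurable borel \<Longrightarrow> (AE x in lebesgue. u x = v x) \<Longrightarrow>
      lp_le (2 * real CARD('n) / (real CARD('n) - 2)) (C * H1_norm u) v"
proof -
  obtain C where C: "0 < C"
    "\<And>(u :: real ^ 'n \<Rightarrow> real) g a K. lp_le 2 a u \<Longrightarrow> (\<And>i. g i \<in> borel_measurable borel) \<Longrightarrow>
      (\<And>e i x. 0 < e \<Longrightarrow> (\<integral>y. u y * bump_deriv e i (x - y) \<partial>lborel) = mollify e (g i) x) \<Longrightarrow>
      0 \<le> K \<Longrightarrow> (\<Sum>i\<in>UNIV. \<integral>\<^sup>+x. ennreal ((g i x)\<^sup>2) \<partial>lborel) \<le> ennreal (K\<^sup>2) \<Longrightarrow>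
      lp_le (2 * real CARD('n) / (real CARD('n) - 2)) (C * K) u"
    by (rule Sobolev_inequality_borel[OF N]) blast
  show ?thesis
  proof (rule that[OF C(1)])
    fix u v :: "real ^ 'n \<Rightarrow> real"
    assume u: "u \<in> H1" and v: "v \<in> borel_measurable borel" "AE x in lebesgue. u x = v x"
    note W = weak_pderiv_H1[OF u]
    have "\<exists>k. k \<in> borel_measurable borel \<and> (AE x in lebesgue. weak_pderiv i u x = k x)" for i
      by (intro borel_representative L2_fun_measurable W)
    then obtain k where k: "\<And>i. k i \<in> borel_measurable borel" "\<And>i. AE x in lebesgue. weak_pderiv i u x = k i x"
      by metis
    show "lp_le (2 * real CARD('n) / (real CARD('n) - 2)) (C * H1_norm u) v"
    proof (rule C(2)[OF H1_L2_bound[OF u v] k(1)])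
      show "(\<integral>y. v y * bump_deriv e i (x - y) \<partial>lborel) = mollify e (k i) x" if "0 < e" for e i x
        by (rule weak_pderiv_mollify[OF H1_measurable[OF u] L2_fun_measurable[OF W(1)] W(2) v k that])
      have "(\<Sum>i\<in>UNIV. \<integral>\<^sup>+x. ennreal ((k i x)\<^sup>2) \<partial>lborel) = (\<Sum>i\<in>UNIV. ennreal (\<integral>x. (weak_pderiv i u x)\<^sup>2 \<partial>lebesgue))"
        by (intro sum.cong refl L2_fun_square_integral W k)
      also have "\<dots> = ennreal (\<Sum>i\<in>UNIV. \<integral>x. (weak_pderiv i u x)\<^sup>2 \<partial>lebesgue)" by (simp add: sum_ennreal)
      also have "\<dots> \<le> ennreal ((H1_norm u)\<^sup>2)"
        unfolding H1_norm_square by (intro ennreal_leI) simp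
      finally show "(\<Sum>i\<in>UNIV. \<integral>\<^sup>+x. ennreal ((k i x)\<^sup>2) \<partial>lborel) \<le> ennreal ((H1_norm u)\<^sup>2)" .
    qed (rule H1_norm_nonneg)
  qed
qed

section \<open>Boundedness of weakly convergent sequences\<close>

definition H1_dual_ball :: "((real ^ 'n::finite \<Rightarrow> real) \<Rightarrow> real) set" where
  "H1_dual_ball = {l.
     (\<forall>u\<in>H1. \<forall>v\<in>H1. l (\<lambda>x. u x + v x) = l u + l v) \<and>
     (\<forall>c. \<forall>u\<in>H1. l (\<lambda>x. c * u x) = c * l u) \<and>
     (\<forall>u\<in>H1. \<bar>l u\<bar> \<le> H1_norm u)}"

text \<open>An absolutely convergent series of functionals is a functional. This replaces the completeness of the
dual space in the gliding hump argument.\<close>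

lemma H1_dual_ball_series:
  fixes l :: "nat \<Rightarrow> (real ^ 'n::finite \<Rightarrow> real) \<Rightarrow> real" and s :: "nat \<Rightarrow> real"
  assumes l: "\<And>k. l k \<in> H1_dual_ball" and s: "\<And>k. \<bar>s k\<bar> \<le> (1/3) ^ k"
  shows "(\<lambda>u. \<Sum>k. s k * l k u) \<in> H1_dual" "\<And>u. u \<in> H1 \<Longrightarrow> summable (\<lambda>k. s k * l k u)"
proof -
  have b: "\<bar>s k * l k u\<bar> \<le> (1/3) ^ k * H1_norm u" if "u \<in> H1" for k u
    unfolding abs_mult using l[of k] s[of k] that by (intro mult_mono) (auto simp: H1_dual_ball_def)
  have geo: "summable (\<lambda>k. (1/3::real) ^ k * c)" for c by (intro summable_mult2 summable_geometric) simp
  show sm: "summable (\<lambda>k. s k * l k u)" if "u \<in> H1" for u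
    by (rule summable_comparison_test'[OF geo[of "H1_norm u"], of 0]) (use b[OF that] in auto)
  have "(\<Sum>k. s k * l k (\<lambda>x. u x + v x)) = (\<Sum>k. s k * l k u) + (\<Sum>k. s k * l k v)" if "u \<in> H1" "v \<in> H1" for u v
  proof -
    have "(\<Sum>k. s k * l k (\<lambda>x. u x + v x)) = (\<Sum>k. s k * l k u + s k * l k v)"
      using l that by (intro suminf_cong) (auto simp: H1_dual_ball_def distrib_left)
    then show ?thesis using suminf_add[OF sm sm] that by simp
  qed
  moreover have "(\<Sum>k. s k * l k (\<lambda>x. c * u x)) = c * (\<Sum>k. s k * l k u)" if "u \<in> H1" for c u
  proof -
    have "(\<Sum>k. s k * l k (\<lambda>x. c * u x)) = (\<Sum>k. c * (s k * l k u))"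
      using l that by (intro suminf_cong) (auto simp: H1_dual_ball_def)
    then show ?thesis using suminf_mult[OF sm[OF that]] by simp
  qed
  moreover have "\<bar>\<Sum>k. s k * l k u\<bar> \<le> (\<Sum>k. (1/3) ^ k) * H1_norm u" if "u \<in> H1" for u
  proof -
    have sa: "summable (\<lambda>k. \<bar>s k * l k u\<bar>)"
      by (rule summable_comparison_test'[OF geo[of "H1_norm u"], of 0]) (use b[OF that] in auto)
    have "\<bar>\<Sum>k. s k * l k u\<bar> \<le> (\<Sum>k. \<bar>s k * l k u\<bar>)" by (rule summable_rabs[OF sa])
    also have "\<dots> \<le> (\<Sum>k. (1/3) ^ k * H1_norm u)" by (intro suminf_le b that sa geo)
    also have "\<dots> = (\<Sum>k. (1/3) ^ k) * H1_norm u" by (intro suminf_mult2[symmetric] summable_geometric) simp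
    finally show ?thesis .
  qed
  ultimately show "(\<lambda>u. \<Sum>k. s k * l k u) \<in> H1_dual" unfolding H1_dual_def by blast
qed

text \<open>Uniform boundedness by a gliding hump. If the values \<open>p n\<close> were unbounded, choose \<open>m k\<close> with
\<open>p (m k) > 4^k\<close> and a nearly norming functional \<open>l k\<close> for \<open>w (m k)\<close>. In the series of the \<open>\<plusminus> 3^(-k) l k\<close> the sign is
chosen so that the \<open>k\<close>-th term does not cancel the partial sum at \<open>w (m k)\<close>, and the later terms are too
small to compensate. The sum is then a functional that is unbounded on the sequence.\<close>

lemma H1_weak_imp_bounded:
  fixes w :: "nat \<Rightarrow> real ^ 'n::finite \<Rightarrow> real"
  assumes w: "\<And>n. w n \<in> H1" and weak: "H1_weakly_tendsto w w0"
  shows "\<exists>B. \<forall>n. \<forall>l\<in>H1_dual_ball. \<bar>l (w n)\<bar> \<le> B"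
proof (rule ccontr)
  assume unb: "\<not> ?thesis"
  let ?D = "H1_dual_ball :: ((real ^ 'n \<Rightarrow> real) \<Rightarrow> real) set"
  have D0: "(\<lambda>u. 0) \<in> ?D" by (simp add: H1_dual_ball_def H1_norm_nonneg)
  define p where "p n = (SUP l\<in>?D. \<bar>l (w n)\<bar>)" for n
  have bdd: "bdd_above ((\<lambda>l. \<bar>l (w n)\<bar>) ` ?D)" for n
    using w[of n] by (intro bdd_aboveI[of _ "H1_norm (w n)"]) (auto simp: H1_dual_ball_def)
  have lp: "\<bar>l (w n)\<bar> \<le> p n" if "l \<in> ?D" for l n
    unfolding p_def using that by (intro cSUP_upper bdd)
  have p0: "0 \<le> p n" for n using lp[OF D0, of n] by simp
  have "\<exists>n. 4 ^ k < p n" for k :: nat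
  proof -
    obtain n l where "l \<in> ?D" "4 ^ k < \<bar>l (w n)\<bar>" using unb by (meson not_le)
    then show ?thesis using lp[of l n] by (intro exI[of _ n]) linarith
  qed
  then obtain m where m: "\<And>k. 4 ^ k < p (m k)" by metis
  have "\<exists>l\<in>?D. 3 / 4 * p (m k) < \<bar>l (w (m k))\<bar>" for k
  proof -
    have "0 < p (m k)" using m[of k] by (meson less_trans zero_less_numeral zero_less_power)
    then have "3 / 4 * p (m k) < p (m k)" by simp
    then show ?thesis unfolding p_def[of "m k"] using D0 bdd
      by (subst (asm) less_cSUP_iff) auto
  qed
  then obtain l where l: "\<And>k. l k \<in> ?D" "\<And>k. 3 / 4 * p (m k) < \<bar>l k (w (m k))\<bar>" by metis
  define c :: "nat \<Rightarrow> real" where "c k = (1/3) ^ k" for k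
  have c0: "0 < c k" for k by (simp add: c_def)
  \<comment> \<open>For real numbers \<open>A\<close> and \<open>y\<close> one of \<open>|A + y|\<close> and \<open>|A - y|\<close> is at least \<open>|y|\<close>. The choice at \<open>k\<close> depends on the
    earlier ones through the partial sum, hence the recursion.\<close>
  have "\<exists>s. \<forall>k. \<bar>s k\<bar> = c k \<and> c k * \<bar>l k (w (m k))\<bar> \<le> \<bar>(\<Sum>j<k. s j * l j (w (m k))) + s k * l k (w (m k))\<bar>"
  proof (rule dependent_wf_choice[OF wf_less_than, where P = "\<lambda>s k r. \<bar>r\<bar> = c k \<and> c k * \<bar>l k (w (m k))\<bar> \<le> \<bar>(\<Sum>j<k. s j * l j (w (m k))) + r * l k (w (m k))\<bar>"])
    fix f g :: "nat \<Rightarrow> real" and x :: nat and r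
    assume "\<And>z. (z, x) \<in> less_than \<Longrightarrow> f z = g z"
    then have "(\<Sum>j<x. f j * l j (w (m x))) = (\<Sum>j<x. g j * l j (w (m x)))" by (intro sum.cong) auto
    then show "(\<bar>r\<bar> = c x \<and> c x * \<bar>l x (w (m x))\<bar> \<le> \<bar>(\<Sum>j<x. f j * l j (w (m x))) + r * l x (w (m x))\<bar>)
        = (\<bar>r\<bar> = c x \<and> c x * \<bar>l x (w (m x))\<bar> \<le> \<bar>(\<Sum>j<x. g j * l j (w (m x))) + r * l x (w (m x))\<bar>)" by simp
  next
    fix k :: nat and f :: "nat \<Rightarrow> real"
    define A where "A = (\<Sum>j<k. f j * l j (w (m k)))"
    define y where "y = c k * l k (w (m k))"
    have y: "c k * \<bar>l k (w (m k))\<bar> = \<bar>y\<bar>" using c0[of k] by (simp add: y_def abs_mult)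
    have "\<bar>y\<bar> \<le> \<bar>A + y\<bar> \<or> \<bar>y\<bar> \<le> \<bar>A - y\<bar>" by linarith
    then show "\<exists>r. \<bar>r\<bar> = c k \<and> c k * \<bar>l k (w (m k))\<bar> \<le> \<bar>(\<Sum>j<k. f j * l j (w (m k))) + r * l k (w (m k))\<bar>"
    proof
      assume "\<bar>y\<bar> \<le> \<bar>A + y\<bar>"
      then show ?thesis using c0[of k] y by (intro exI[of _ "c k"]) (simp add: A_def y_def)
    next
      assume "\<bar>y\<bar> \<le> \<bar>A - y\<bar>"
      then show ?thesis using c0[of k] y by (intro exI[of _ "- c k"]) (simp add: A_def y_def)
    qed
  qed
  then obtain s where s: "\<And>k. \<bar>s k\<bar> = c k" "\<And>k. c k * \<bar>l k (w (m k))\<bar> \<le> \<bar>(\<Sum>j<k. s j * l j (w (m k))) + s k * l k (w (m k))\<bar>"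
    by blast
  have s': "\<bar>s k\<bar> \<le> (1/3) ^ k" for k using s(1)[of k] by (simp add: c_def)
  define L where "L u = (\<Sum>k. s k * l k u)" for u
  have L: "L \<in> H1_dual" unfolding L_def using H1_dual_ball_series(1)[OF l(1) s'] .
  have sm: "summable (\<lambda>k. s k * l k (w n))" for n using H1_dual_ball_series(2)[OF l(1) s' w] .
  have low: "(4/3) ^ k / 4 \<le> \<bar>L (w (m k))\<bar>" for k
  proof -
    define u where "u = w (m k)"
    have "L u = (\<Sum>j. s (j + Suc k) * l (j + Suc k) u) + (\<Sum>j<Suc k. s j * l j u)"
      unfolding L_def u_def by (rule suminf_split_initial_segment[OF sm])
    \<comment> \<open>The partial sum is at least \<open>3/4 c k p\<close> and the weights after \<open>c k\<close> add up to \<open>c k / 2\<close>.\<close>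
    then have "\<bar>\<Sum>j<Suc k. s j * l j u\<bar> \<le> \<bar>L u\<bar> + \<bar>\<Sum>j. s (j + Suc k) * l (j + Suc k) u\<bar>"
      by linarith
    moreover have "\<bar>\<Sum>j. s (j + Suc k) * l (j + Suc k) u\<bar> \<le> 1/2 * c k * p (m k)"
    proof -
      have b: "\<bar>s (j + Suc k) * l (j + Suc k) u\<bar> \<le> (1/3) ^ j * (1/3 * c k * p (m k))" for j
      proof -
        have "\<bar>s (j + Suc k) * l (j + Suc k) u\<bar> \<le> c (j + Suc k) * p (m k)"
          unfolding abs_mult s(1) u_def using c0[of "j + Suc k"] by (intro mult_left_mono lp l) auto
        then show ?thesis by (simp add: c_def power_add mult_ac)
      qed
      have geo: "summable (\<lambda>j. (1/3::real) ^ j * (1/3 * c k * p (m k)))" by (intro summable_mult2 summable_geometric) simp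
      have sa: "summable (\<lambda>j. \<bar>s (j + Suc k) * l (j + Suc k) u\<bar>)"
        by (rule summable_comparison_test'[OF geo, of 0]) (use b in auto)
      have "\<bar>\<Sum>j. s (j + Suc k) * l (j + Suc k) u\<bar> \<le> (\<Sum>j. \<bar>s (j + Suc k) * l (j + Suc k) u\<bar>)" by (rule summable_rabs[OF sa])
      also have "\<dots> \<le> (\<Sum>j. (1/3) ^ j * (1/3 * c k * p (m k)))" by (intro suminf_le b sa geo)
      also have "\<dots> = (\<Sum>j. (1/3) ^ j) * (1/3 * c k * p (m k))" by (intro suminf_mult2[symmetric] summable_geometric) simp
      also have "(\<Sum>j. (1/3::real) ^ j) = 3/2" by (subst suminf_geometric) auto
      finally show ?thesis by simp
    qed
    moreover have "c k * (3 / 4 * p (m k)) \<le> \<bar>\<Sum>j<Suc k. s j * l j u\<bar>"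
    proof -
      have "c k * (3 / 4 * p (m k)) \<le> c k * \<bar>l k u\<bar>" using l(2)[of k] c0[of k] by (intro mult_left_mono) (auto simp: u_def)
      also have "\<dots> \<le> \<bar>\<Sum>j<Suc k. s j * l j u\<bar>" using s(2)[of k] by (simp add: u_def)
      finally show ?thesis .
    qed
    ultimately have "c k * (3 / 4 * p (m k)) \<le> \<bar>L u\<bar> + 1/2 * c k * p (m k)" by linarith
    then have "1/4 * (c k * p (m k)) \<le> \<bar>L u\<bar>" by (simp add: algebra_simps)
    moreover have "c k * 4 ^ k \<le> c k * p (m k)" using m[of k] c0[of k] by (intro mult_left_mono) auto
    moreover have "c k * 4 ^ k = (4/3) ^ k" by (simp add: c_def power_mult_distrib[symmetric])
    ultimately show ?thesis by (simp add: u_def)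
  qed
  have "(\<lambda>n. L (w n)) \<longlonglongrightarrow> L w0" using weak L by (simp add: H1_weakly_tendsto_def)
  then have "Bseq (\<lambda>n. L (w n))" by (intro convergent_imp_Bseq) (auto simp: convergent_def)
  then obtain K where K: "\<And>n. \<bar>L (w n)\<bar> \<le> K" unfolding Bseq_def by auto
  obtain k :: nat where "4 * K < (4/3) ^ k" using real_arch_pow[of "4/3" "4 * K"] by auto
  then show False using low[of k] K[of "m k"] by linarith
qed

text \<open>A bound on the \<open>L^s\<close> norm is obtained by testing with \<open>|v|^(s - 1) sgn v\<close>, which defines a functional on \<open>H1\<close>
because of the embedding \<open>emb\<close>. It acts on a function and not on its gradient, so its linearity
is that of the integral.\<close>

lemma H1_weak_imp_lp_bounded:
  fixes w :: "nat \<Rightarrow> real ^ 'n::finite \<Rightarrow> real"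
  assumes w: "\<And>n. w n \<in> H1" and weak: "H1_weakly_tendsto w w0"
    and s: "1 < s" and C: "0 < C"
    and emb: "\<And>(u :: real ^ 'n \<Rightarrow> real) v. u \<in> H1 \<Longrightarrow> v \<in> borel_measurable borel \<Longrightarrow> (AE x in lebesgue. u x = v x) \<Longrightarrow>
      lp_le s (C * H1_norm u) v"
  shows "\<exists>B\<ge>0. \<forall>n v. v \<in> borel_measurable borel \<longrightarrow> (AE x in lebesgue. w n x = v x) \<longrightarrow> lp_le s B v"
proof -
  obtain B where B: "\<And>n l. l \<in> H1_dual_ball \<Longrightarrow> \<bar>l (w n)\<bar> \<le> B" using H1_weak_imp_bounded[OF w weak] by blast
  have D0: "(\<lambda>u :: real ^ 'n \<Rightarrow> real. 0) \<in> H1_dual_ball" by (simp add: H1_dual_ball_def H1_norm_nonneg)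
  have B0: "0 \<le> B" using B[OF D0] by simp
  define r where "r = s / (s - 1)"
  have r: "1 < r" "1 / s + 1 / r = 1" "(s - 1) * r = s" using s by (auto simp: r_def field_simps)
  have "lp_le s (C * B) v" if v[measurable]: "v \<in> borel_measurable borel" and wv: "AE x in lebesgue. w n x = v x" for n v
  proof -
    have fin: "lp_le s (C * H1_norm (w n)) v" by (rule emb[OF w v wv])
    then have "(\<integral>\<^sup>+x. ennreal (\<bar>v x\<bar> powr s) \<partial>lborel) < \<infinity>" by (auto simp: lp_le_def intro: le_less_trans)
    then obtain I where I: "0 \<le> I" "(\<integral>\<^sup>+x. ennreal (\<bar>v x\<bar> powr s) \<partial>lborel) = ennreal I"
      by (metis ennreal_cases infinity_ennreal_def less_irrefl)
    have "I \<le> (C * B) powr s"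
    proof (cases "I = 0")
      case False
      then have I0: "0 < I" using I by simp
      define h where "h x = sgn (v x) * \<bar>v x\<bar> powr (s - 1) / I powr (1 / r)" for x
      have [measurable]: "h \<in> borel_measurable borel" unfolding h_def by measurable
      have hleb: "h \<in> borel_measurable lebesgue" by (rule measurable_completion) simp
      have "\<bar>h x\<bar> powr r = \<bar>v x\<bar> powr s / I" for x
        using I0 r by (cases "v x = 0") (simp_all add: h_def abs_mult abs_sgn_eq powr_divide powr_powr)
      then have "(\<integral>\<^sup>+x. ennreal (\<bar>h x\<bar> powr r) \<partial>lborel) = (\<integral>\<^sup>+x. ennreal (1 / I) * ennreal (\<bar>v x\<bar> powr s) \<partial>lborel)"
        using I0 by (intro nn_integral_cong) (simp add: ennreal_mult[symmetric])
      also have "\<dots> = 1" using I I0 by (subst nn_integral_cmult) (auto simp: ennreal_mult[symmetric])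
      finally have h: "lp_le r 1 h" by (simp add: lp_le_def)
      define l where "l u = (1 / C) * (\<integral>x. u x * h x \<partial>lebesgue)" for u
      have bnd: "(\<integral>\<^sup>+x. ennreal \<bar>u x * h x\<bar> \<partial>lebesgue) \<le> ennreal (C * H1_norm u)" if u: "u \<in> H1" for u
      proof -
        obtain u' where [measurable]: "u' \<in> borel_measurable borel" and u': "AE x in lebesgue. u x = u' x"
          using borel_representative[OF H1_measurable[OF u]] by blast
        have "(\<integral>\<^sup>+x. ennreal \<bar>u x * h x\<bar> \<partial>lebesgue) = (\<integral>\<^sup>+x. ennreal \<bar>u' x * h x\<bar> \<partial>lebesgue)"
          using u' by (intro nn_integral_cong_AE) (auto elim: eventually_mono)
        also have "\<dots> = (\<integral>\<^sup>+x. ennreal \<bar>u' x * h x\<bar> \<partial>lborel)" by (simp add: nn_integral_completion)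
        also have "\<dots> \<le> ennreal (C * H1_norm u * 1)"
          using emb[OF u _ u'] h s r by (intro lp_le_pairing) auto
        finally show ?thesis by simp
      qed
      have int: "integrable lebesgue (\<lambda>x. u x * h x)" if u: "u \<in> H1" for u
      proof (rule integrableI_bounded)
        show "(\<lambda>x. u x * h x) \<in> borel_measurable lebesgue" by (intro borel_measurable_times H1_measurable u hleb)
        show "(\<integral>\<^sup>+x. ennreal (norm (u x * h x)) \<partial>lebesgue) < \<infinity>" using bnd[OF u] by (auto intro: le_less_trans)
      qed
      have "l \<in> H1_dual_ball" unfolding H1_dual_ball_def
      proof (intro CollectI conjI ballI allI)
        fix u v :: "real ^ 'n \<Rightarrow> real" assume "u \<in> H1" "v \<in> H1"
        then show "l (\<lambda>x. u x + v x) = l u + l v"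
          using int by (simp add: l_def distrib_right add_divide_distrib)
      next
        fix c and u :: "real ^ 'n \<Rightarrow> real"
        show "l (\<lambda>x. c * u x) = c * l u" by (simp add: l_def mult.assoc)
      next
        fix u :: "real ^ 'n \<Rightarrow> real" assume u: "u \<in> H1"
        have "ennreal \<bar>\<integral>x. u x * h x \<partial>lebesgue\<bar> \<le> ennreal (C * H1_norm u)"
          using abs_integral_le_nn_integral bnd[OF u] by (rule order_trans)
        then have "\<bar>\<integral>x. u x * h x \<partial>lebesgue\<bar> \<le> C * H1_norm u" using C H1_norm_nonneg[of u] by (simp add: ennreal_le_iff)
        then show "\<bar>l u\<bar> \<le> H1_norm u" using C by (simp add: l_def abs_mult field_simps)
      qed
      from B[OF this] have lB: "\<bar>l (w n)\<bar> \<le> B" .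
      have "(\<integral>x. w n x * h x \<partial>lebesgue) = (\<integral>x. v x * h x \<partial>lborel)"
      proof (rule integral_lebesgue_eq_lborel)
        show "(\<lambda>x. w n x * h x) \<in> borel_measurable lebesgue" by (intro borel_measurable_times H1_measurable w hleb)
        show "AE x in lebesgue. w n x * h x = v x * h x" using wv by eventually_elim simp
      qed measurable
      also have "\<dots> = (\<integral>x. \<bar>v x\<bar> powr s / I powr (1 / r) \<partial>lborel)"
      proof (intro Bochner_Integration.integral_cong refl)
        fix x
        have "\<bar>v x\<bar> * \<bar>v x\<bar> powr (s - 1) = \<bar>v x\<bar> powr s"
          using powr_add[of "\<bar>v x\<bar>" 1 "s - 1"] by (cases "v x = 0") auto
        then show "v x * h x = \<bar>v x\<bar> powr s / I powr (1 / r)"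
          by (simp add: h_def abs_sgn mult_ac)
      qed
      also have "\<dots> = (\<integral>x. \<bar>v x\<bar> powr s \<partial>lborel) / I powr (1 / r)" by simp
      also have "(\<integral>x. \<bar>v x\<bar> powr s \<partial>lborel) = I"
        using I by (subst integral_eq_nn_integral) auto
      also have "I / I powr (1 / r) = I powr (1 / s)"
      proof -
        have "I powr (1 / s) * I powr (1 / r) = I" using I0 r(2) by (simp add: powr_add[symmetric])
        then show ?thesis using I0 by (simp add: field_simps)
      qed
      finally have "I powr (1 / s) / C \<le> B" using lB C by (simp add: l_def)
      then have "I powr (1 / s) \<le> C * B" using C by (simp add: field_simps)
      then have "(I powr (1 / s)) powr s \<le> (C * B) powr s" using s by (intro powr_mono2) auto
      then show ?thesis using I0 s by (simp add: powr_powr)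
    qed simp
    then show ?thesis using I C B0 by (auto simp: lp_le_def intro: ennreal_leI)
  qed
  then show ?thesis using C B0 by (intro exI[of _ "C * B"]) auto
qed

section \<open>Integrals that tend to zero\<close>

text \<open>The principle of Brezis and Lieb. The part of \<open>A n\<close> above \<open>\<delta> b n\<close> is dominated by \<open>c\<close> and tends to zero, so its
integral vanishes in the limit; the rest contributes at most \<open>\<delta> B\<close>.\<close>

lemma nn_integral_vanishing:
  fixes A b :: "nat \<Rightarrow> 'a \<Rightarrow> real"
  assumes [measurable]: "\<And>n. A n \<in> borel_measurable M" "\<And>n. b n \<in> borel_measurable M"
    and nonneg: "\<And>n x. 0 \<le> A n x" "\<And>n x. 0 \<le> b n x"
    and B: "\<And>n. (\<integral>\<^sup>+x. ennreal (b n x) \<partial>M) \<le> ennreal B" "0 \<le> B"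
    and dom: "\<And>\<delta>. 0 < \<delta> \<Longrightarrow> \<exists>c\<in>borel_measurable M. (\<integral>\<^sup>+x. ennreal (c x) \<partial>M) < \<infinity> \<and> (\<forall>n x. A n x \<le> \<delta> * b n x + c x)"
    and lim: "AE x in M. (\<lambda>n. A n x) \<longlonglongrightarrow> 0"
    and "0 < \<epsilon>"
  shows "\<forall>\<^sub>F n in sequentially. (\<integral>\<^sup>+x. ennreal (A n x) \<partial>M) \<le> ennreal \<epsilon>"
proof -
  define \<delta> where "\<delta> = \<epsilon> / (B + 1)"
  have "\<delta> * (B + 1) = \<epsilon>" using B(2) by (simp add: \<delta>_def)
  then have \<delta>: "0 < \<delta>" "\<delta> * B + \<delta> = \<epsilon>" using \<open>0 < \<epsilon>\<close> B(2) by (auto simp: \<delta>_def distrib_left)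
  obtain c where c[measurable]: "c \<in> borel_measurable M" and cfin: "(\<integral>\<^sup>+x. ennreal (c x) \<partial>M) < \<infinity>"
    and Ac: "\<And>n x. A n x \<le> \<delta> * b n x + c x"
    using dom[OF \<delta>(1)] by blast
  define r where "r n x = max 0 (A n x - \<delta> * b n x)" for n x
  have [measurable]: "r n \<in> borel_measurable M" for n unfolding r_def by measurable
  have rA: "r n x \<le> A n x" for n x using nonneg[of n x] \<delta>(1) by (auto simp: r_def)
  have "(\<lambda>n. \<integral>\<^sup>+x. ennreal (r n x) \<partial>M) \<longlonglongrightarrow> (\<integral>\<^sup>+x. 0 \<partial>M)"
  proof (rule nn_integral_dominated_convergence[where w = "\<lambda>x. ennreal (c x)"])
    show "AE x in M. ennreal (r n x) \<le> ennreal (c x)" for n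
    proof (rule AE_I2)
      fix x
      show "ennreal (r n x) \<le> ennreal (c x)"
        using Ac[of n x] by (cases "A n x \<le> \<delta> * b n x") (auto simp: r_def intro!: ennreal_leI)
    qed
    show "AE x in M. (\<lambda>n. ennreal (r n x)) \<longlonglongrightarrow> 0" using lim
    proof eventually_elim
      case (elim x)
      have "(\<lambda>n. r n x) \<longlonglongrightarrow> 0" by (rule tendsto_sandwich[OF _ _ tendsto_const elim]) (auto simp: rA, auto simp: r_def)
      then show ?case using tendsto_ennrealI by fastforce
    qed
  qed (use cfin in auto)
  then have "\<forall>\<^sub>F n in sequentially. (\<integral>\<^sup>+x. ennreal (r n x) \<partial>M) < ennreal \<delta>"
    using \<delta>(1) by (intro order_tendstoD) auto
  then show ?thesis
  proof eventually_elim
    case (elim n)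
    have "(\<integral>\<^sup>+x. ennreal (A n x) \<partial>M) \<le> (\<integral>\<^sup>+x. ennreal \<delta> * ennreal (b n x) + ennreal (r n x) \<partial>M)"
    proof (rule nn_integral_mono)
      fix x
      have "ennreal (A n x) \<le> ennreal (\<delta> * b n x + r n x)" by (intro ennreal_leI) (auto simp: r_def)
      also have "\<dots> = ennreal \<delta> * ennreal (b n x) + ennreal (r n x)"
        using \<delta>(1) nonneg(2)[of n x] by (subst ennreal_plus) (auto simp: r_def ennreal_mult simp del: ennreal_plus)
      finally show "ennreal (A n x) \<le> ennreal \<delta> * ennreal (b n x) + ennreal (r n x)" .
    qed
    also have "\<dots> = ennreal \<delta> * (\<integral>\<^sup>+x. ennreal (b n x) \<partial>M) + (\<integral>\<^sup>+x. ennreal (r n x) \<partial>M)"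
      by (subst nn_integral_add) (auto simp: nn_integral_cmult)
    also have "\<dots> \<le> ennreal \<delta> * ennreal B + ennreal \<delta>"
      using elim by (intro add_mono mult_left_mono B) auto
    also have "\<dots> = ennreal \<epsilon>" using \<delta> B(2) by (simp add: ennreal_mult[symmetric] ennreal_plus[symmetric] del: ennreal_plus)
    finally show ?case .
  qed
qed

lemma lp_le_of_integral_le:
  assumes "g \<in> borel_measurable borel" "0 < e" "0 < p" "(\<integral>\<^sup>+x. ennreal (\<bar>g x\<bar> powr p) \<partial>lborel) \<le> ennreal (e powr p)"
  shows "lp_le p e g"
  using assms by (auto simp: lp_le_def)

text \<open>A bounded sequence in \<open>L^p2\<close> that tends to zero almost everywhere tends to zero weakly, even in absolute value: by
Young's inequality the product is at most a small multiple of \<open>|k n|^p2\<close> plus a fixed multiple of \<open>|U|^p1\<close>.\<close>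

lemma Holder_vanishing:
  fixes U :: "'a::euclidean_space \<Rightarrow> real" and k :: "nat \<Rightarrow> 'a \<Rightarrow> real"
  assumes U: "lp_le p1 K U" and k: "\<And>n. lp_le p2 B (k n)" and lim: "AE x in lborel. (\<lambda>n. k n x) \<longlonglongrightarrow> 0"
    and p: "0 < p1" "0 < p2" "1 / \<sigma> = 1 / p1 + 1 / p2" and "0 < e"
  shows "\<forall>\<^sub>F n in sequentially. lp_le \<sigma> e (\<lambda>x. U x * k n x)"
proof -
  have [measurable]: "U \<in> borel_measurable borel" "\<And>n. k n \<in> borel_measurable borel" using U k by (auto simp: lp_le_def)
  have "0 < 1 / \<sigma>" unfolding p(3) using p(1,2) by (intro add_pos_pos) auto
  then have \<sigma>: "0 < \<sigma>" by simp
  define s t where "s = \<sigma> / p1" and "t = \<sigma> / p2"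
  have st: "0 < s" "0 < t" "s + t = 1"
  proof -
    show "0 < s" "0 < t" using \<sigma> p by (auto simp: s_def t_def)
    have "s + t = \<sigma> * (1 / p1 + 1 / p2)" by (simp add: s_def t_def distrib_left)
    then show "s + t = 1" using \<sigma> unfolding p(3)[symmetric] by simp
  qed
  have "\<forall>\<^sub>F n in sequentially. (\<integral>\<^sup>+x. ennreal (\<bar>U x * k n x\<bar> powr \<sigma>) \<partial>lborel) \<le> ennreal (e powr \<sigma>)"
  proof (rule nn_integral_vanishing[where b = "\<lambda>n x. \<bar>k n x\<bar> powr p2" and B = "B powr p2"])
    show "(\<integral>\<^sup>+x. ennreal (\<bar>k n x\<bar> powr p2) \<partial>lborel) \<le> ennreal (B powr p2)" for n using k by (simp add: lp_le_def)
    fix \<delta> :: real assume "0 < \<delta>"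
    then obtain C where C: "0 < C" "\<And>x y. 0 \<le> x \<Longrightarrow> 0 \<le> y \<Longrightarrow> x powr s * y powr t \<le> \<delta> * y powr (s + t) + C * x powr (s + t)"
      using young_small[OF st(1,2)] by blast
    have "\<bar>U x * k n x\<bar> powr \<sigma> \<le> \<delta> * \<bar>k n x\<bar> powr p2 + C * \<bar>U x\<bar> powr p1" for n x
    proof -
      have "\<bar>U x * k n x\<bar> powr \<sigma> = (\<bar>U x\<bar> powr p1) powr s * (\<bar>k n x\<bar> powr p2) powr t"
        using p by (simp add: abs_mult powr_mult powr_powr s_def t_def)
      also have "\<dots> \<le> \<delta> * (\<bar>k n x\<bar> powr p2) powr (s + t) + C * (\<bar>U x\<bar> powr p1) powr (s + t)"
        by (rule C(2)) auto
      finally show ?thesis by (simp add: st(3))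
    qed
    moreover have "(\<integral>\<^sup>+x. ennreal (C * \<bar>U x\<bar> powr p1) \<partial>lborel) < \<infinity>"
    proof -
      have "(\<integral>\<^sup>+x. ennreal (C * \<bar>U x\<bar> powr p1) \<partial>lborel) = ennreal C * (\<integral>\<^sup>+x. ennreal (\<bar>U x\<bar> powr p1) \<partial>lborel)"
        using C by (subst nn_integral_cmult[symmetric]) (auto simp: ennreal_mult)
      also have "\<dots> \<le> ennreal C * ennreal (K powr p1)" by (intro mult_left_mono lp_leD(3)[OF U]) auto
      also have "\<dots> < \<infinity>" by (simp add: ennreal_mult_less_top)
      finally show ?thesis .
    qed
    ultimately show "\<exists>c\<in>borel_measurable lborel. (\<integral>\<^sup>+x. ennreal (c x) \<partial>lborel) < \<infinity> \<and> (\<forall>n x. \<bar>U x * k n x\<bar> powr \<sigma> \<le> \<delta> * \<bar>k n x\<bar> powr p2 + c x)"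
      by (intro bexI[of _ "\<lambda>x. C * \<bar>U x\<bar> powr p1"]) auto
  next
    show "AE x in lborel. (\<lambda>n. \<bar>U x * k n x\<bar> powr \<sigma>) \<longlonglongrightarrow> 0" using lim
    proof eventually_elim
      case (elim x)
      have "(\<lambda>n. \<bar>U x * k n x\<bar> powr \<sigma>) \<longlonglongrightarrow> \<bar>U x * 0\<bar> powr \<sigma>"
        using \<sigma> by (intro tendsto_powr' tendsto_rabs tendsto_mult tendsto_const elim) auto
      then show ?case using \<sigma> by simp
    qed
  qed (use \<open>0 < e\<close> in auto)
  then show ?thesis by eventually_elim (use \<open>0 < e\<close> \<sigma> in \<open>auto intro!: lp_le_of_integral_le\<close>)
qed

text \<open>Inside the ball of radius \<open>r\<close> the kernel is at most \<open>r^(\<nu> - \<mu>)\<close> times the more singular kernel of exponent \<open>\<nu>\<close>.\<close>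

lemma riesz_pot_split:
  fixes g :: "'a::euclidean_space \<Rightarrow> real"
  assumes [measurable]: "g \<in> borel_measurable borel" and "0 < r" "\<mu> \<le> \<nu>"
  shows "riesz_pot \<mu> g x \<le> ennreal (r powr (\<nu> - \<mu>)) * riesz_pot \<nu> g x
    + (\<integral>\<^sup>+y. ennreal (norm (x - y) powr (-\<mu>) * indicator {y. r \<le> norm (x - y)} y * \<bar>g y\<bar>) \<partial>lborel)"
proof -
  have "riesz_pot \<mu> g x \<le> (\<integral>\<^sup>+y. ennreal (r powr (\<nu> - \<mu>)) * ennreal (norm (x - y) powr (-\<nu>) * \<bar>g y\<bar>)
      + ennreal (norm (x - y) powr (-\<mu>) * indicator {y. r \<le> norm (x - y)} y * \<bar>g y\<bar>) \<partial>lborel)"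
    unfolding riesz_pot_def
  proof (rule nn_integral_mono)
    fix y
    show "ennreal (norm (x - y) powr (-\<mu>) * \<bar>g y\<bar>) \<le> ennreal (r powr (\<nu> - \<mu>)) * ennreal (norm (x - y) powr (-\<nu>) * \<bar>g y\<bar>)
      + ennreal (norm (x - y) powr (-\<mu>) * indicator {y. r \<le> norm (x - y)} y * \<bar>g y\<bar>)"
    proof (cases "r \<le> norm (x - y)")
      case True
      then show ?thesis by (simp add: add_increasing)
    next
      case False
      have "norm (x - y) powr (-\<mu>) = norm (x - y) powr (\<nu> - \<mu>) * norm (x - y) powr (-\<nu>)"
        by (simp add: powr_add[symmetric])
      also have "\<dots> \<le> r powr (\<nu> - \<mu>) * norm (x - y) powr (-\<nu>)"
        using False assms by (intro mult_right_mono powr_mono2) auto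
      finally have "norm (x - y) powr (-\<mu>) * \<bar>g y\<bar> \<le> r powr (\<nu> - \<mu>) * (norm (x - y) powr (-\<nu>) * \<bar>g y\<bar>)"
        by (simp add: mult.assoc[symmetric] mult_right_mono)
      then show ?thesis using False by (simp add: ennreal_mult[symmetric] ennreal_leI)
    qed
  qed
  also have "\<dots> = ennreal (r powr (\<nu> - \<mu>)) * riesz_pot \<nu> g x
    + (\<integral>\<^sup>+y. ennreal (norm (x - y) powr (-\<mu>) * indicator {y. r \<le> norm (x - y)} y * \<bar>g y\<bar>) \<partial>lborel)"
    unfolding riesz_pot_def by (subst nn_integral_add) (auto simp: nn_integral_cmult)
  finally show ?thesis .
qed

lemma lp_le_truncated_kernel:
  fixes x :: "'a::euclidean_space" and \<mu> r t :: real
  assumes "0 < r" "0 < t" "DIM('a) < \<mu> * t"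
  shows "lp_le t ((\<mu> * t * unit_ball_vol DIM('a) / (\<mu> * t - DIM('a)) * r powr (DIM('a) - \<mu> * t)) powr (1 / t))
    (\<lambda>y. norm (x - y) powr (-\<mu>) * indicator {y. r \<le> norm (x - y)} y)"
proof -
  let ?c = "\<mu> * t * unit_ball_vol DIM('a) / (\<mu> * t - DIM('a)) * r powr (DIM('a) - \<mu> * t)"
  have "0 < \<mu> * t" using assms(3) of_nat_0_le_iff[of "DIM('a)"] by linarith
  then have "0 < \<mu>" using assms(2) by (simp add: zero_less_mult_iff)
  then have c0: "0 \<le> ?c" using assms by (intro mult_nonneg_nonneg divide_nonneg_pos) (auto simp: less_imp_le)
  have "(\<integral>\<^sup>+y. ennreal (\<bar>norm (x - y) powr (-\<mu>) * indicator {y. r \<le> norm (x - y)} y\<bar> powr t) \<partial>lborel)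
    = (\<integral>\<^sup>+y. ennreal (norm (x - y) powr (-(\<mu> * t))) * indicator {y. r \<le> norm (x - y)} y \<partial>lborel)"
    using assms by (intro nn_integral_cong) (auto simp: indicator_def powr_powr)
  also have "\<dots> \<le> ennreal ?c" using assms by (intro kernel_tail_integral) auto
  also have "\<dots> = ennreal ((?c powr (1 / t)) powr t)" using c0 assms by (simp add: powr_powr)
  finally show ?thesis by (auto simp: lp_le_def)
qed

section \<open>The Choquard nonlinearity\<close>

text \<open>The parameter \<open>space_type\<close> fixes the space on which functions live, and \<open>N\<close> is a real-number name for its
dimension, so that the exponents below depend on numbers only.\<close>

locale choquard_nonlinearity =
  fixes \<alpha> N :: real and f F :: "real \<Rightarrow> real" and space_type :: "'a::euclidean_space itself"
  assumes dim: "N = real DIM('a)" and N3: "3 \<le> N"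
    and \<alpha>: "0 < \<alpha>" "N - 4 < \<alpha>" "\<alpha> < N"
    and f_cont: "continuous_on UNIV f"
    and f_at_zero: "((\<lambda>t. f t / \<bar>t\<bar> powr (\<alpha> / N)) \<longlongrightarrow> 0) (at 0)"
    and f_at_infinity: "\<exists>L. ((\<lambda>t. f t / (\<bar>t\<bar> powr ((4 + \<alpha> - N) / (N - 2)) * t)) \<longlongrightarrow> L) at_infinity"
    and F_integral: "\<And>t. F t = (LBINT s=ereal 0..ereal t. f s)"
begin

text \<open>The exponents \<open>a\<close> and \<open>q\<close> bound the growth of \<open>f\<close> at 0 and at infinity; \<open>F(u)\<close> lies in \<open>L^p\<close>, \<open>crit\<close> is the Sobolev exponent,
\<open>|u|^a\<close> lies in \<open>L^q1\<close> and \<open>|u|^q\<close> in \<open>L^q2\<close>, and \<open>p'\<close> is conjugate to \<open>p\<close>.\<close>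

definition "a = \<alpha> / N"
definition "q = (\<alpha> + 2) / (N - 2)"
definition "p = 2 * N / (N + \<alpha>)"
definition "crit = 2 * N / (N - 2)"
definition "q1 = 2 * N / \<alpha>"
definition "q2 = 2 * N / (\<alpha> + 2)"
definition "p' = 2 * N / (N - \<alpha>)"

lemma exponents:
  "0 < a" "a < 1" "1 < q" "1 < p" "1 < crit" "1 < q1" "1 < q2" "1 < p'"
  "a * q1 = 2" "q * q2 = crit" "p * (1 + a) = 2" "p * (1 + q) = crit"
  "1 / p = 1 / q1 + 1 / 2" "1 / p = 1 / q2 + 1 / crit" "1 / p' = 1 / p + (N - \<alpha>) / N - 1" "1 / p + 1 / p' = 1"
  "q - 1 = (4 + \<alpha> - N) / (N - 2)" "1 / 2 = 1 / p' + 1 / q1"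
proof -
  have nz: "N + \<alpha> \<noteq> 0" "N - 2 \<noteq> 0" "\<alpha> + 2 \<noteq> 0" "N \<noteq> 0" using N3 \<alpha> by auto
  show "q * q2 = crit" using nz by (simp add: q_def q2_def crit_def)
  have "1 + a = (N + \<alpha>) / N" using nz by (simp add: a_def add_divide_distrib)
  then show "p * (1 + a) = 2" using nz by (simp add: p_def)
  have "1 + q = (N + \<alpha>) / (N - 2)" using nz by (simp add: q_def field_simps)
  then show "p * (1 + q) = crit" using nz by (simp add: p_def crit_def)
qed (use N3 \<alpha> in \<open>auto simp: a_def q_def p_def crit_def q1_def q2_def p'_def field_simps\<close>)

sublocale critical_primitive a q f F p
proof unfold_locales
  show "((\<lambda>t. f t / \<bar>t\<bar> powr a) \<longlongrightarrow> 0) (at 0)" using f_at_zero by (simp add: a_def)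
  show "\<exists>L. ((\<lambda>t. f t / (\<bar>t\<bar> powr (q - 1) * t)) \<longlongrightarrow> L) at_infinity"
    using f_at_infinity by (simp add: exponents(17))
qed (use exponents(1-4) f_cont F_integral in auto)

text \<open>The only information about functions in \<open>H1\<close> that the estimates use.\<close>

definition energy_le :: "real \<Rightarrow> ('a \<Rightarrow> real) \<Rightarrow> bool" where
  "energy_le A u \<longleftrightarrow> lp_le 2 A u \<and> lp_le crit A u"

lemma energy_leD:
  assumes "energy_le A u"
  shows "lp_le 2 A u" "lp_le crit A u" "u \<in> borel_measurable borel" "0 \<le> A"
  using assms by (auto simp: energy_le_def lp_le_def)

text \<open>A bound in the sum space \<open>L^q1 + L^q2\<close>. Multiplication by such a function maps \<open>L^2 \<inter> L^crit\<close> to \<open>L^p\<close>.\<close>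

definition multiplier_le :: "real \<Rightarrow> ('a \<Rightarrow> real) \<Rightarrow> bool" where
  "multiplier_le e k \<longleftrightarrow> k \<in> borel_measurable borel \<and>
     (\<exists>k1 k2. lp_le q1 e k1 \<and> lp_le q2 e k2 \<and> (\<forall>x. \<bar>k x\<bar> \<le> \<bar>k1 x\<bar> + \<bar>k2 x\<bar>))"

lemma multiplier_le_bound:
  assumes k: "multiplier_le e k" and \<phi>: "energy_le b \<phi>"
  shows "lp_le p (4 * e * b) (\<lambda>x. k x * \<phi> x)"
proof -
  note [measurable] = energy_leD(3)[OF \<phi>]
  obtain k1 k2 where k12: "lp_le q1 e k1" "lp_le q2 e k2" "\<And>x. \<bar>k x\<bar> \<le> \<bar>k1 x\<bar> + \<bar>k2 x\<bar>"
    and [measurable]: "k \<in> borel_measurable borel"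
    using k by (auto simp: multiplier_le_def)
  note ex = exponents(1-12)
  have 1: "lp_le p (e * b) (\<lambda>x. \<bar>k1 x * \<phi> x\<bar>)"
    using lp_le_mult[OF k12(1) energy_leD(1)[OF \<phi>] _ _ exponents(13)] ex by (auto simp: lp_le_def)
  have 2: "lp_le p (e * b) (\<lambda>x. \<bar>k2 x * \<phi> x\<bar>)"
    using lp_le_mult[OF k12(2) energy_leD(2)[OF \<phi>] _ _ exponents(14)] ex by (auto simp: lp_le_def)
  have "lp_le p (2 * (e * b + e * b)) (\<lambda>x. \<bar>k1 x * \<phi> x\<bar> + \<bar>k2 x * \<phi> x\<bar>)"
    using ex by (intro lp_le_add 1 2) auto
  then show ?thesis
  proof (rule lp_le_mono)
    fix x
    show "\<bar>k x * \<phi> x\<bar> \<le> \<bar>\<bar>k1 x * \<phi> x\<bar> + \<bar>k2 x * \<phi> x\<bar>\<bar>"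
      using mult_right_mono[OF k12(3)[of x], of "\<bar>\<phi> x\<bar>"] by (simp add: abs_mult distrib_right)
  qed (use ex in auto)
qed

lemma multiplier_le_growth:
  assumes u: "energy_le A u" and [measurable]: "k \<in> borel_measurable borel"
    and k: "\<And>x. \<bar>k x\<bar> \<le> c * growth a q (u x)" and c: "0 \<le> c"
  shows "multiplier_le (c * (A powr a + A powr q)) k"
proof -
  note ex = exponents(1-12)
  note [measurable] = energy_leD(3)[OF u]
  have "2 / a = q1" "crit / q = q2" using ex(1,3,9,10) by (auto simp: field_simps)
  then have 1: "lp_le q1 (A powr a) (\<lambda>x. \<bar>u x\<bar> powr a)" and 2: "lp_le q2 (A powr q) (\<lambda>x. \<bar>u x\<bar> powr q)"
    using lp_le_powr[OF energy_leD(1)[OF u], of a] lp_le_powr[OF energy_leD(2)[OF u], of q] ex by auto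
  have "lp_le q1 (c * (A powr a + A powr q)) (\<lambda>x. c * \<bar>u x\<bar> powr a)"
    by (rule lp_le_mono[OF lp_le_cmult[OF 1, of c]]) (use ex c in \<open>auto intro: mult_left_mono\<close>)
  moreover have "lp_le q2 (c * (A powr a + A powr q)) (\<lambda>x. c * \<bar>u x\<bar> powr q)"
    by (rule lp_le_mono[OF lp_le_cmult[OF 2, of c]]) (use ex c in \<open>auto intro: mult_left_mono\<close>)
  moreover have "\<bar>k x\<bar> \<le> \<bar>c * \<bar>u x\<bar> powr a\<bar> + \<bar>c * \<bar>u x\<bar> powr q\<bar>" for x
    using k[of x] c by (simp add: growth_def distrib_left)
  ultimately show ?thesis unfolding multiplier_le_def by (intro conjI exI[of _ "\<lambda>x. c * \<bar>u x\<bar> powr a"] exI[of _ "\<lambda>x. c * \<bar>u x\<bar> powr q"]) auto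
qed

text \<open>The principle of Brezis and Lieb in the sum space. The part of \<open>k n\<close> above \<open>\<delta>\<close> times the growth of \<open>v n\<close> is
dominated by the growth of \<open>w\<close>, which is of order \<open>|w|^a\<close> where \<open>|w| \<le> 1\<close> and of order \<open>|w|^q\<close> elsewhere; dominated
convergence applies on these two sets in \<open>L^q1\<close> and \<open>L^q2\<close> separately.\<close>

lemma multiplier_vanishing:
  assumes [measurable]: "\<And>n. k n \<in> borel_measurable borel" and lim: "AE x in lborel. (\<lambda>n. k n x) \<longlonglongrightarrow> 0"
    and v: "\<And>n. energy_le A (v n)" and w: "energy_le A w"
    and dom: "\<And>\<delta>. 0 < \<delta> \<Longrightarrow> \<exists>C>0. \<forall>n x. \<bar>k n x\<bar> \<le> \<delta> * growth a q (v n x) + C * growth a q (w x)"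
    and e: "0 < e"
  shows "\<forall>\<^sub>F n in sequentially. multiplier_le e (k n)"
proof -
  note ex = exponents(1-12)
  note [measurable] = energy_leD(3)[OF v] energy_leD(3)[OF w]
  have A0: "0 \<le> A" using energy_leD(4)[OF w] .
  define S where "S = A powr a + A powr q + 1"
  define \<delta> where "\<delta> = e / (4 * S)"
  have pos: "0 < S" by (simp add: S_def add_nonneg_pos)
  then have \<delta>: "0 < \<delta>" using e by (simp add: \<delta>_def)
  have "\<delta> * S = e / 4" using pos by (simp add: \<delta>_def)
  then have \<delta>A: "\<delta> * A powr a \<le> e / 4" "\<delta> * A powr q \<le> e / 4"
    using \<delta> mult_left_mono[of "A powr a" S \<delta>] mult_left_mono[of "A powr q" S \<delta>] by (auto simp: S_def)
  obtain C where C: "0 < C" "\<And>n x. \<bar>k n x\<bar> \<le> \<delta> * growth a q (v n x) + C * growth a q (w x)"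
    using dom[OF \<delta>] by blast
  \<comment> \<open>The excess over \<open>\<delta>\<close> times the growth of \<open>v n\<close> inherits the convergence to zero and does not
    depend on \<open>v n\<close> in its bound.\<close>
  define r where "r n x = max 0 (\<bar>k n x\<bar> - \<delta> * growth a q (v n x))" for n x
  have [measurable]: "r n \<in> borel_measurable borel" for n unfolding r_def growth_def by measurable
  have r0: "0 \<le> r n x" for n x by (simp add: r_def)
  have rC: "r n x \<le> C * growth a q (w x)" for n x using C(1) C(2)[of n x] by (simp add: r_def algebra_simps)
  have rlim: "AE x in lborel. (\<lambda>n. r n x) \<longlonglongrightarrow> 0" using lim
  proof eventually_elim
    case (elim x)
    have "(\<lambda>n. \<bar>k n x\<bar>) \<longlonglongrightarrow> 0" using tendsto_rabs[OF elim] by simp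
    then show ?case by (rule tendsto_sandwich[OF _ _ tendsto_const, rotated 2]) (use \<delta> in \<open>auto simp: r_def\<close>)
  qed
  have part: "\<forall>\<^sub>F n in sequentially. lp_le t (e / 4) (\<lambda>x. r n x * indicator S x)"
    if t: "0 < t" and S[measurable]: "S \<in> sets borel" and wS: "\<And>x. x \<in> S \<Longrightarrow> growth a q (w x) powr t \<le> D * \<bar>w x\<bar> powr z"
      and wz: "(\<integral>\<^sup>+x. ennreal (\<bar>w x\<bar> powr z) \<partial>lborel) \<le> ennreal H" and D: "0 \<le> D" for t S D z H
  proof -
    have "\<forall>\<^sub>F n in sequentially. (\<integral>\<^sup>+x. ennreal (\<bar>r n x * indicator S x\<bar> powr t) \<partial>lborel) \<le> ennreal ((e / 4) powr t)"
    proof (rule nn_integral_vanishing[where b = "\<lambda>n x. 0" and B = 0])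
      fix d :: real assume "0 < d"
      have "\<bar>r n x * indicator S x\<bar> powr t \<le> C powr t * D * \<bar>w x\<bar> powr z" for n x
      proof (cases "x \<in> S")
        case True
        have "\<bar>r n x * indicator S x\<bar> powr t \<le> (C * growth a q (w x)) powr t"
          using True r0 rC t by (intro powr_mono2) auto
        also have "\<dots> = C powr t * growth a q (w x) powr t" using C by (simp add: powr_mult)
        also have "\<dots> \<le> C powr t * (D * \<bar>w x\<bar> powr z)" by (intro mult_left_mono wS True) auto
        finally show ?thesis by simp
      qed (use t D in auto)
      moreover have "(\<integral>\<^sup>+x. ennreal (C powr t * D * \<bar>w x\<bar> powr z) \<partial>lborel) < \<infinity>"
      proof -
        have "(\<integral>\<^sup>+x. ennreal (C powr t * D * \<bar>w x\<bar> powr z) \<partial>lborel) = ennreal (C powr t * D) * (\<integral>\<^sup>+x. ennreal (\<bar>w x\<bar> powr z) \<partial>lborel)"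
          using D by (subst nn_integral_cmult[symmetric]) (auto simp: ennreal_mult)
        also have "\<dots> \<le> ennreal (C powr t * D) * ennreal H" by (intro mult_left_mono wz) auto
        also have "\<dots> < \<infinity>" by (simp add: ennreal_mult_less_top)
        finally show ?thesis .
      qed
      ultimately show "\<exists>c\<in>borel_measurable lborel. (\<integral>\<^sup>+x. ennreal (c x) \<partial>lborel) < \<infinity> \<and> (\<forall>n x. \<bar>r n x * indicator S x\<bar> powr t \<le> d * 0 + c x)"
        by (intro bexI[of _ "\<lambda>x. C powr t * D * \<bar>w x\<bar> powr z"]) auto
    next
      show "AE x in lborel. (\<lambda>n. \<bar>r n x * indicator S x\<bar> powr t) \<longlonglongrightarrow> 0" using rlim
      proof eventually_elim
        case (elim x)
        have "(\<lambda>n. \<bar>r n x * indicator S x\<bar> powr t) \<longlonglongrightarrow> \<bar>0 * indicator S x\<bar> powr t"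
          using t by (intro tendsto_powr' tendsto_rabs tendsto_mult tendsto_const elim) auto
        then show ?case using t by simp
      qed
    qed (use e t in auto)
    then show ?thesis by eventually_elim (use e t in \<open>auto intro!: lp_le_of_integral_le\<close>)
  qed
  have 1: "\<forall>\<^sub>F n in sequentially. lp_le q1 (e / 4) (\<lambda>x. r n x * indicator {x. \<bar>w x\<bar> \<le> 1} x)"
  proof (rule part[where D = "2 powr q1" and z = 2 and H = "A powr 2"])
    fix x assume "x \<in> {x. \<bar>w x\<bar> \<le> 1}"
    then have "\<bar>w x\<bar> powr q \<le> \<bar>w x\<bar> powr a" using ex by (intro powr_mono') auto
    then have "growth a q (w x) powr q1 \<le> (2 * \<bar>w x\<bar> powr a) powr q1" using ex by (intro powr_mono2) (auto simp: growth_def)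
    also have "\<dots> = 2 powr q1 * \<bar>w x\<bar> powr 2" using ex by (simp add: powr_mult powr_powr)
    finally show "growth a q (w x) powr q1 \<le> 2 powr q1 * \<bar>w x\<bar> powr 2" .
  qed (use ex lp_leD(3)[OF energy_leD(1)[OF w]] in auto)
  have 2: "\<forall>\<^sub>F n in sequentially. lp_le q2 (e / 4) (\<lambda>x. r n x * indicator {x. 1 < \<bar>w x\<bar>} x)"
  proof (rule part[where D = "2 powr q2" and z = crit and H = "A powr crit"])
    fix x assume "x \<in> {x. 1 < \<bar>w x\<bar>}"
    then have "\<bar>w x\<bar> powr a \<le> \<bar>w x\<bar> powr q" using ex by (intro powr_mono) auto
    then have "growth a q (w x) powr q2 \<le> (2 * \<bar>w x\<bar> powr q) powr q2" using ex by (intro powr_mono2) (auto simp: growth_def)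
    also have "\<dots> = 2 powr q2 * \<bar>w x\<bar> powr crit" using ex by (simp add: powr_mult powr_powr)
    finally show "growth a q (w x) powr q2 \<le> 2 powr q2 * \<bar>w x\<bar> powr crit" .
  qed (use ex lp_leD(3)[OF energy_leD(2)[OF w]] in auto)
  from 1 2 show ?thesis
  proof eventually_elim
    case (elim n)
    have dq: "2 / a = q1" "crit / q = q2" using ex(1,3,9,10) by (auto simp: field_simps)
    have 3: "lp_le q1 (e / 4) (\<lambda>x. \<delta> * \<bar>v n x\<bar> powr a)"
    proof (rule lp_le_mono)
      have "lp_le q1 (A powr a) (\<lambda>x. \<bar>v n x\<bar> powr a)"
        using lp_le_powr[OF energy_leD(1)[OF v], of a n] ex(1,3,5) dq by simp
      then show "lp_le q1 (\<bar>\<delta>\<bar> * A powr a) (\<lambda>x. \<delta> * \<bar>v n x\<bar> powr a)"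
        by (rule lp_le_cmult) (use ex(6,7) in simp)
      show "\<bar>\<delta>\<bar> * A powr a \<le> e / 4" using \<delta> \<delta>A by simp
    qed (use ex(6,7) in simp_all)
    have 4: "lp_le q2 (e / 4) (\<lambda>x. \<delta> * \<bar>v n x\<bar> powr q)"
    proof (rule lp_le_mono)
      have "lp_le q2 (A powr q) (\<lambda>x. \<bar>v n x\<bar> powr q)"
        using lp_le_powr[OF energy_leD(2)[OF v], of q n] ex(1,3,5) dq by simp
      then show "lp_le q2 (\<bar>\<delta>\<bar> * A powr q) (\<lambda>x. \<delta> * \<bar>v n x\<bar> powr q)"
        by (rule lp_le_cmult) (use ex(6,7) in simp)
      show "\<bar>\<delta>\<bar> * A powr q \<le> e / 4" using \<delta> \<delta>A by simp
    qed (use ex(6,7) in simp_all)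
    have "lp_le q1 (2 * (e / 4 + e / 4)) (\<lambda>x. \<delta> * \<bar>v n x\<bar> powr a + r n x * indicator {x. \<bar>w x\<bar> \<le> 1} x)"
      using ex by (intro lp_le_add 3 elim) auto
    moreover have "lp_le q2 (2 * (e / 4 + e / 4)) (\<lambda>x. \<delta> * \<bar>v n x\<bar> powr q + r n x * indicator {x. 1 < \<bar>w x\<bar>} x)"
      using ex by (intro lp_le_add 4 elim) auto
    moreover have "\<bar>k n x\<bar> \<le> \<bar>\<delta> * \<bar>v n x\<bar> powr a + r n x * indicator {x. \<bar>w x\<bar> \<le> 1} x\<bar> + \<bar>\<delta> * \<bar>v n x\<bar> powr q + r n x * indicator {x. 1 < \<bar>w x\<bar>} x\<bar>" for x
    proof -
      have "\<bar>k n x\<bar> \<le> \<delta> * growth a q (v n x) + r n x" by (auto simp: r_def)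
      also have "\<dots> = (\<delta> * \<bar>v n x\<bar> powr a + r n x * indicator {x. \<bar>w x\<bar> \<le> 1} x) + (\<delta> * \<bar>v n x\<bar> powr q + r n x * indicator {x. 1 < \<bar>w x\<bar>} x)"
        by (auto simp: growth_def indicator_def algebra_simps)
      also have "\<dots> \<le> \<bar>\<delta> * \<bar>v n x\<bar> powr a + r n x * indicator {x. \<bar>w x\<bar> \<le> 1} x\<bar> + \<bar>\<delta> * \<bar>v n x\<bar> powr q + r n x * indicator {x. 1 < \<bar>w x\<bar>} x\<bar>"
        by (intro add_mono abs_ge_self)
      finally show ?thesis .
    qed
    ultimately show ?case unfolding multiplier_le_def by auto
  qed
qed


section \<open>Functionals that tend to zero\<close>

text \<open>Convergence to zero, in the dual of \<open>L^2 \<inter> L^crit\<close>, of the functionals with densities \<open>H n\<close>.\<close>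

definition vanishing_form :: "(nat \<Rightarrow> 'a \<Rightarrow> ennreal) \<Rightarrow> bool" where
  "vanishing_form H \<longleftrightarrow> (\<forall>e>0. \<forall>\<^sub>F n in sequentially. \<forall>\<phi> b. energy_le b \<phi> \<longrightarrow>
     (\<integral>\<^sup>+x. H n x * ennreal \<bar>\<phi> x\<bar> \<partial>lborel) \<le> ennreal (e * b))"

lemma vanishing_formI:
  assumes "0 \<le> D"
    and "\<And>e. 0 < e \<Longrightarrow> \<forall>\<^sub>F n in sequentially. \<forall>\<phi> b. energy_le b \<phi> \<longrightarrow>
      (\<integral>\<^sup>+x. H n x * ennreal \<bar>\<phi> x\<bar> \<partial>lborel) \<le> ennreal (D * e * b)"
  shows "vanishing_form H"
  unfolding vanishing_form_def
proof (intro allI impI)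
  fix e :: real assume "0 < e"
  define d where "d = e / (D + 1)"
  have "0 < d" using \<open>0 < e\<close> assms(1) by (simp add: d_def)
  have "d * (D + 1) = e" using assms(1) by (simp add: d_def)
  then have "D * d \<le> e" using \<open>0 < d\<close> by (simp add: algebra_simps)
  show "\<forall>\<^sub>F n in sequentially. \<forall>\<phi> b. energy_le b \<phi> \<longrightarrow>
     (\<integral>\<^sup>+x. H n x * ennreal \<bar>\<phi> x\<bar> \<partial>lborel) \<le> ennreal (e * b)"
    using assms(2)[OF \<open>0 < d\<close>]
  proof eventually_elim
    case (elim n)
    show ?case
    proof (intro allI impI)
      fix \<phi> b assume \<phi>: "energy_le b \<phi>"
      then have "(\<integral>\<^sup>+x. H n x * ennreal \<bar>\<phi> x\<bar> \<partial>lborel) \<le> ennreal (D * d * b)" using elim by blast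
      also have "\<dots> \<le> ennreal (e * b)"
        using \<open>D * d \<le> e\<close> energy_leD(4)[OF \<phi>] by (intro ennreal_leI mult_right_mono)
      finally show "(\<integral>\<^sup>+x. H n x * ennreal \<bar>\<phi> x\<bar> \<partial>lborel) \<le> ennreal (e * b)" .
    qed
  qed
qed

lemma potential_form_bound:
  obtains C where "0 < C"
    "\<And>g K k e \<phi> b. lp_le p K g \<Longrightarrow> multiplier_le e k \<Longrightarrow> energy_le b \<phi> \<Longrightarrow>
      (\<integral>\<^sup>+x. riesz_pot (N - \<alpha>) g x * ennreal \<bar>k x\<bar> * ennreal \<bar>\<phi> x\<bar> \<partial>lborel) \<le> ennreal (C * K * e * b)"
proof -
  have h: "0 < N - \<alpha>" "N - \<alpha> < real DIM('a)" "1 < p" "1 / p + 1 / p + (N - \<alpha>) / real DIM('a) = 2"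
    using \<alpha> exponents(4) N3 by (auto simp: dim[symmetric] p_def field_simps)
  obtain C where C: "0 < C"
    "\<And>(g::'a \<Rightarrow> real) h a b. lp_le p a g \<Longrightarrow> lp_le p b h \<Longrightarrow>
      (\<integral>\<^sup>+x. riesz_pot (N - \<alpha>) g x * ennreal \<bar>h x\<bar> \<partial>lborel) \<le> ennreal (C * a * b)"
    by (rule Hardy_Littlewood_Sobolev[OF h(1-3) h(3-4)]) blast
  show ?thesis
  proof (rule that[of "4 * C"])
    show "0 < 4 * C" using C by simp
    fix g :: "'a \<Rightarrow> real" and K k e \<phi> b assume g: "lp_le p K g" and k: "multiplier_le e k" and \<phi>: "energy_le b \<phi>"
    show "(\<integral>\<^sup>+x. riesz_pot (N - \<alpha>) g x * ennreal \<bar>k x\<bar> * ennreal \<bar>\<phi> x\<bar> \<partial>lborel) \<le> ennreal (4 * C * K * e * b)"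
      using C(2)[OF g multiplier_le_bound[OF k \<phi>]] by (simp add: abs_mult ennreal_mult mult_ac)
  qed
qed

lemma F_lp_bound:
  assumes "0 \<le> A"
  obtains K where "0 \<le> K" "\<And>u. energy_le A u \<Longrightarrow> lp_le p K (\<lambda>x. F (u x))"
proof -
  note ex = exponents(1-12)
  obtain c where c: "0 < c" "\<And>t. \<bar>F t\<bar> powr p \<le> c * growth 2 crit t"
    using F_growth ex(11,12) by auto
  define K where "K = (c * (A powr 2 + A powr crit)) powr (1 / p)"
  have "lp_le p K (\<lambda>x. F (u x))" if u: "energy_le A u" for u
  proof -
    note [measurable] = energy_leD(3)[OF u]
    have "(\<integral>\<^sup>+x. ennreal (\<bar>F (u x)\<bar> powr p) \<partial>lborel) \<le> (\<integral>\<^sup>+x. ennreal c * (ennreal (\<bar>u x\<bar> powr 2) + ennreal (\<bar>u x\<bar> powr crit)) \<partial>lborel)"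
    proof (rule nn_integral_mono)
      fix x
      show "ennreal (\<bar>F (u x)\<bar> powr p) \<le> ennreal c * (ennreal (\<bar>u x\<bar> powr 2) + ennreal (\<bar>u x\<bar> powr crit))"
        using c(2)[of "u x"] c(1) by (simp add: growth_def ennreal_mult[symmetric] ennreal_plus[symmetric] ennreal_leI del: ennreal_plus)
    qed
    also have "\<dots> = ennreal c * ((\<integral>\<^sup>+x. ennreal (\<bar>u x\<bar> powr 2) \<partial>lborel) + (\<integral>\<^sup>+x. ennreal (\<bar>u x\<bar> powr crit) \<partial>lborel))"
      by (subst nn_integral_cmult) (auto simp: nn_integral_add)
    also have "\<dots> \<le> ennreal c * (ennreal (A powr 2) + ennreal (A powr crit))"
      by (intro mult_left_mono add_mono lp_leD(3) energy_leD[OF u]) auto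
    also have "\<dots> = ennreal (c * (A powr 2 + A powr crit))"
      using c by (simp add: ennreal_mult[symmetric] ennreal_plus[symmetric] del: ennreal_plus)
    also have "\<dots> = ennreal (K powr p)" using c ex by (simp add: K_def powr_powr)
    finally show ?thesis by (auto simp: lp_le_def K_def)
  qed
  then show ?thesis by (intro that[of K]) (auto simp: K_def)
qed

lemma vanishing_multiplier_form:
  assumes g: "\<And>n. lp_le p K (g n)" and k: "\<And>e. 0 < e \<Longrightarrow> \<forall>\<^sub>F n in sequentially. multiplier_le e (k n)"
  shows "vanishing_form (\<lambda>n x. riesz_pot (N - \<alpha>) (g n) x * ennreal \<bar>k n x\<bar>)"
proof -
  obtain C where C: "0 < C"
    "\<And>g K k e \<phi> b. lp_le p K g \<Longrightarrow> multiplier_le e k \<Longrightarrow> energy_le b \<phi> \<Longrightarrow>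
      (\<integral>\<^sup>+x. riesz_pot (N - \<alpha>) g x * ennreal \<bar>k x\<bar> * ennreal \<bar>\<phi> x\<bar> \<partial>lborel) \<le> ennreal (C * K * e * b)"
    by (rule potential_form_bound) blast
  have "0 \<le> K" using g[of 0] by (simp add: lp_le_def)
  show ?thesis
  proof (rule vanishing_formI[of "C * K"])
    show "0 \<le> C * K" using C \<open>0 \<le> K\<close> by simp
    fix e :: real assume "0 < e"
    from k[OF this] show "\<forall>\<^sub>F n in sequentially. \<forall>\<phi> b. energy_le b \<phi> \<longrightarrow>
      (\<integral>\<^sup>+x. riesz_pot (N - \<alpha>) (g n) x * ennreal \<bar>k n x\<bar> * ennreal \<bar>\<phi> x\<bar> \<partial>lborel) \<le> ennreal (C * K * e * b)"
      by eventually_elim (use C(2)[OF g] in blast)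
  qed
qed

lemma vanishing_potential_form:
  assumes g: "\<And>e. 0 < e \<Longrightarrow> \<forall>\<^sub>F n in sequentially. lp_le p e (g n)" and k: "\<And>n. multiplier_le M (k n)" and M: "0 \<le> M"
  shows "vanishing_form (\<lambda>n x. riesz_pot (N - \<alpha>) (g n) x * ennreal \<bar>k n x\<bar>)"
proof -
  obtain C where C: "0 < C"
    "\<And>g K k e \<phi> b. lp_le p K g \<Longrightarrow> multiplier_le e k \<Longrightarrow> energy_le b \<phi> \<Longrightarrow>
      (\<integral>\<^sup>+x. riesz_pot (N - \<alpha>) g x * ennreal \<bar>k x\<bar> * ennreal \<bar>\<phi> x\<bar> \<partial>lborel) \<le> ennreal (C * K * e * b)"
    by (rule potential_form_bound) blast
  show ?thesis
  proof (rule vanishing_formI[of "C * M"])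
    show "0 \<le> C * M" using C M by simp
    fix e :: real assume "0 < e"
    from g[OF this] show "\<forall>\<^sub>F n in sequentially. \<forall>\<phi> b. energy_le b \<phi> \<longrightarrow>
      (\<integral>\<^sup>+x. riesz_pot (N - \<alpha>) (g n) x * ennreal \<bar>k n x\<bar> * ennreal \<bar>\<phi> x\<bar> \<partial>lborel) \<le> ennreal (C * M * e * b)"
    proof eventually_elim
      case (elim n)
      show ?case using C(2)[OF elim k] by (simp add: mult_ac)
    qed
  qed
qed

text \<open>The potential of \<open>g\<close> is a fixed function in \<open>L^p'\<close>, and \<open>k n\<close> is bounded in \<open>L^q1 + L^q2\<close>. Splitting \<open>k n\<close> according to
the size of \<open>v n\<close>, the products with the potential tend to zero in \<open>L^2\<close> and in the conjugate of \<open>L^crit\<close>,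
respectively.\<close>

lemma vanishing_fixed_potential_form:
  assumes U: "lp_le p K g" and v: "\<And>n. energy_le A (v n)" and k[measurable]: "\<And>n. k n \<in> borel_measurable borel"
    and kv: "\<And>n x. \<bar>k n x\<bar> \<le> c * growth a q (v n x)" and c: "0 \<le> c"
    and lim: "AE x in lborel. (\<lambda>n. k n x) \<longlonglongrightarrow> 0"
  shows "vanishing_form (\<lambda>n x. riesz_pot (N - \<alpha>) g x * ennreal \<bar>k n x\<bar>)"
proof -
  note ex = exponents(1-12)
  note [measurable] = energy_leD(3)[OF v] lp_leD(1)[OF U]
  have h: "0 < N - \<alpha>" "N - \<alpha> < real DIM('a)" "1 < p" "1 < p'" "1 / p' = 1 / p + (N - \<alpha>) / real DIM('a) - 1"
    using \<alpha> ex exponents(15) by (auto simp: dim[symmetric])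
  obtain C where C: "0 < C"
    "\<And>(g::'a \<Rightarrow> real) a. lp_le p a g \<Longrightarrow> AE x in lborel. riesz_pot (N - \<alpha>) g x < \<infinity>"
    "\<And>(g::'a \<Rightarrow> real) a. lp_le p a g \<Longrightarrow> lp_le p' (C * a) (\<lambda>x. enn2real (riesz_pot (N - \<alpha>) g x))"
    by (rule Riesz_potential_bound[OF h]) blast
  define P where "P x = enn2real (riesz_pot (N - \<alpha>) g x)" for x
  have P: "lp_le p' (C * K) P" unfolding P_def by (rule C(3)[OF U])
  note [measurable] = lp_leD(1)[OF P]
  define k1 where "k1 n x = k n x * indicator {x. \<bar>v n x\<bar> \<le> 1} x" for n x
  define k2 where "k2 n x = k n x * indicator {x. 1 < \<bar>v n x\<bar>} x" for n x
  have dq: "2 / a = q1" "crit / q = q2" using ex(1,3,9,10) by (auto simp: field_simps)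
  have 1: "lp_le q1 (2 * c * A powr a) (k1 n)" for n
  proof (rule lp_le_mono[OF lp_le_cmult[where c = "2 * c" and p = q1 and a = "A powr a" and g = "\<lambda>x. \<bar>v n x\<bar> powr a"]])
    show "lp_le q1 (A powr a) (\<lambda>x. \<bar>v n x\<bar> powr a)" using lp_le_powr[OF energy_leD(1)[OF v], of a n] ex dq by simp
    show "k1 n \<in> borel_measurable borel" unfolding k1_def by measurable
    fix x
    show "\<bar>k1 n x\<bar> \<le> \<bar>2 * c * \<bar>v n x\<bar> powr a\<bar>"
    proof (cases "\<bar>v n x\<bar> \<le> 1")
      case True
      then have "\<bar>v n x\<bar> powr q \<le> \<bar>v n x\<bar> powr a" using ex by (intro powr_mono') auto
      then have "c * growth a q (v n x) \<le> c * (2 * \<bar>v n x\<bar> powr a)" using c by (intro mult_left_mono) (auto simp: growth_def)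
      then show ?thesis using kv[of n x] True c by (simp add: k1_def mult_ac)
    qed (simp add: k1_def)
  qed (use ex c in auto)
  have 2: "lp_le q2 (2 * c * A powr q) (k2 n)" for n
  proof (rule lp_le_mono[OF lp_le_cmult[where c = "2 * c" and p = q2 and a = "A powr q" and g = "\<lambda>x. \<bar>v n x\<bar> powr q"]])
    show "lp_le q2 (A powr q) (\<lambda>x. \<bar>v n x\<bar> powr q)" using lp_le_powr[OF energy_leD(2)[OF v], of q n] ex dq by simp
    show "k2 n \<in> borel_measurable borel" unfolding k2_def by measurable
    fix x
    show "\<bar>k2 n x\<bar> \<le> \<bar>2 * c * \<bar>v n x\<bar> powr q\<bar>"
    proof (cases "1 < \<bar>v n x\<bar>")
      case True
      then have "\<bar>v n x\<bar> powr a \<le> \<bar>v n x\<bar> powr q" using ex by (intro powr_mono) auto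
      then have "c * growth a q (v n x) \<le> c * (2 * \<bar>v n x\<bar> powr q)" using c by (intro mult_left_mono) (auto simp: growth_def)
      then show ?thesis using kv[of n x] True c by (simp add: k2_def mult_ac)
    qed (simp add: k2_def)
  qed (use ex c in auto)
  have lim1: "AE x in lborel. (\<lambda>n. k1 n x) \<longlonglongrightarrow> 0" and lim2: "AE x in lborel. (\<lambda>n. k2 n x) \<longlonglongrightarrow> 0"
  proof -
    have ind: "(\<lambda>n. k n x * (if Q n then 1 else 0)) \<longlonglongrightarrow> 0" if "(\<lambda>n. k n x) \<longlonglongrightarrow> 0" for Q x
      by (rule Lim_null_comparison[OF _ tendsto_norm_zero[OF that]]) (auto intro!: always_eventually)
    show "AE x in lborel. (\<lambda>n. k1 n x) \<longlonglongrightarrow> 0" using lim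
      by eventually_elim (simp add: k1_def indicator_def of_bool_def ind)
    show "AE x in lborel. (\<lambda>n. k2 n x) \<longlonglongrightarrow> 0" using lim
      by eventually_elim (simp add: k2_def indicator_def of_bool_def ind)
  qed
  define s where "s = 2 * N / (N + 2)"
  have s: "0 < s" "1 / s = 1 / p' + 1 / q2" "1 / s + 1 / crit = 1"
    using N3 \<alpha> by (auto simp: s_def p'_def q2_def crit_def field_simps)
  show ?thesis
  proof (rule vanishing_formI[of 2])
    fix e :: real assume e: "0 < e"
    have A1: "\<forall>\<^sub>F n in sequentially. lp_le 2 e (\<lambda>x. P x * k1 n x)"
      using ex e by (intro Holder_vanishing[OF P 1 lim1 _ _ exponents(18)]) auto
    have A2: "\<forall>\<^sub>F n in sequentially. lp_le s e (\<lambda>x. P x * k2 n x)"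
      using ex e by (intro Holder_vanishing[OF P 2 lim2 _ _ s(2)]) auto
    from A1 A2 show "\<forall>\<^sub>F n in sequentially. \<forall>\<phi> b. energy_le b \<phi> \<longrightarrow>
      (\<integral>\<^sup>+x. riesz_pot (N - \<alpha>) g x * ennreal \<bar>k n x\<bar> * ennreal \<bar>\<phi> x\<bar> \<partial>lborel) \<le> ennreal (2 * e * b)"
    proof eventually_elim
      case (elim n)
      show ?case
      proof (intro allI impI)
        fix \<phi> b assume \<phi>: "energy_le b \<phi>"
        note [measurable] = energy_leD(3)[OF \<phi>]
        have [measurable]: "k1 n \<in> borel_measurable borel" "k2 n \<in> borel_measurable borel"
          unfolding k1_def k2_def by measurable
        have "(\<integral>\<^sup>+x. riesz_pot (N - \<alpha>) g x * ennreal \<bar>k n x\<bar> * ennreal \<bar>\<phi> x\<bar> \<partial>lborel)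
          \<le> (\<integral>\<^sup>+x. ennreal \<bar>P x * k1 n x * \<phi> x\<bar> + ennreal \<bar>P x * k2 n x * \<phi> x\<bar> \<partial>lborel)"
        proof (rule nn_integral_mono_AE, use C(2)[OF U] in eventually_elim)
          fix x assume "riesz_pot (N - \<alpha>) g x < \<infinity>"
          then have "riesz_pot (N - \<alpha>) g x = ennreal (P x)" by (simp add: P_def less_top)
          moreover have "0 \<le> P x" by (simp add: P_def)
          ultimately have "riesz_pot (N - \<alpha>) g x * ennreal \<bar>k n x\<bar> * ennreal \<bar>\<phi> x\<bar> = ennreal \<bar>P x * k n x * \<phi> x\<bar>"
            by (simp add: ennreal_mult abs_mult)
          also have "\<dots> \<le> ennreal \<bar>P x * k1 n x * \<phi> x\<bar> + ennreal \<bar>P x * k2 n x * \<phi> x\<bar>"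
            by (auto simp: k1_def k2_def indicator_def)
          finally show "riesz_pot (N - \<alpha>) g x * ennreal \<bar>k n x\<bar> * ennreal \<bar>\<phi> x\<bar> \<le> ennreal \<bar>P x * k1 n x * \<phi> x\<bar> + ennreal \<bar>P x * k2 n x * \<phi> x\<bar>" .
        qed
        also have "\<dots> = (\<integral>\<^sup>+x. ennreal \<bar>P x * k1 n x * \<phi> x\<bar> \<partial>lborel) + (\<integral>\<^sup>+x. ennreal \<bar>P x * k2 n x * \<phi> x\<bar> \<partial>lborel)"
          by (rule nn_integral_add) measurable
        also have "\<dots> \<le> ennreal (e * b) + ennreal (e * b)"
          using ex s elim by (intro add_mono lp_le_pairing[OF _ energy_leD(1)[OF \<phi>], of 2] lp_le_pairing[OF _ energy_leD(2)[OF \<phi>], of s]) auto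
        also have "\<dots> = ennreal (2 * e * b)" using e energy_leD(4)[OF \<phi>] by (simp add: ennreal_plus[symmetric] del: ennreal_plus)
        finally show "(\<integral>\<^sup>+x. riesz_pot (N - \<alpha>) g x * ennreal \<bar>k n x\<bar> * ennreal \<bar>\<phi> x\<bar> \<partial>lborel) \<le> ennreal (2 * e * b)" .
      qed
    qed
  qed simp
qed

text \<open>The difficulty is that the test function is arbitrary, so the potentials themselves must converge on the
support of \<open>k\<close>. Within distance \<open>r\<close> the kernel is at most \<open>r^(\<alpha>/2)\<close> times the kernel with exponent
\<open>N - \<alpha>/2\<close>, for which \<open>L^p\<close> is paired with \<open>L^2\<close>, so the near part is small uniformly in \<open>n\<close>. The far part of the kernel belongs to \<open>L^p'\<close>;
hence the far part \<open>J n\<close> of the potential is bounded and tends to zero at every point, and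
therefore in \<open>L^2\<close> of the ball that contains the support of \<open>k\<close>.\<close>

lemma vanishing_local_form:
  assumes g: "\<And>n. lp_le p K (g n)" and lim: "AE x in lborel. (\<lambda>n. g n x) \<longlonglongrightarrow> 0"
    and k[measurable]: "k \<in> borel_measurable borel" and kM: "\<And>x. \<bar>k x\<bar> \<le> M * indicator (cball 0 R) x"
  shows "vanishing_form (\<lambda>n x. riesz_pot (N - \<alpha>) (g n) x * ennreal \<bar>k x\<bar>)"
proof -
  note ex = exponents(1-12)
  note [measurable] = lp_leD(1)[OF g]
  have K0: "0 \<le> K" using lp_leD(2)[OF g] .
  have dual: "1 / p' + 1 / p = 1" using exponents(16) by simp
  define M' where "M' = \<bar>M\<bar>"
  have kM': "\<bar>k x\<bar> \<le> M' * indicator (cball 0 R) x" for x using kM[of x] by (auto simp: M'_def indicator_def)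
  have M'0: "0 \<le> M'" by (simp add: M'_def)
  define \<nu> where "\<nu> = N - \<alpha> / 2"
  have \<nu>: "0 < \<nu>" "\<nu> < real DIM('a)" "1 / p + 1 / 2 + \<nu> / real DIM('a) = 2" "N - \<alpha> \<le> \<nu>" "\<nu> - (N - \<alpha>) = \<alpha> / 2"
    using \<alpha> N3 by (auto simp: dim[symmetric] \<nu>_def p_def field_simps)
  have two: "1 < (2::real)" by simp
  obtain C where C: "0 < C"
    "\<And>(g::'a \<Rightarrow> real) h a b. lp_le p a g \<Longrightarrow> lp_le 2 b h \<Longrightarrow>
      (\<integral>\<^sup>+x. riesz_pot \<nu> g x * ennreal \<bar>h x\<bar> \<partial>lborel) \<le> ennreal (C * a * b)"
    by (rule Hardy_Littlewood_Sobolev[OF \<nu>(1,2) ex(4) two \<nu>(3)]) blast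
  show ?thesis
  proof (rule vanishing_formI[of "C * K * M' + M'"])
    show "0 \<le> C * K * M' + M'" using C K0 M'0 by simp
    fix e :: real assume e: "0 < e"
    \<comment> \<open>The near part of the kernel then carries the factor \<open>r^(\<alpha>/2) = e\<close>.\<close>
    define r where "r = e powr (2 / \<alpha>)"
    have r: "0 < r" "r powr (\<alpha> / 2) = e" using e \<alpha> by (auto simp: r_def powr_powr)
    define \<kappa> where "\<kappa> x y = norm (x - y) powr (-(N - \<alpha>)) * indicator {y. r \<le> norm (x - y)} y" for x y :: 'a
    have [measurable]: "(\<lambda>(x, y). \<kappa> x y) \<in> borel_measurable (borel \<Otimes>\<^sub>M borel)"
      unfolding \<kappa>_def by (simp add: indicator_def, measurable)
    have [measurable]: "\<kappa> x \<in> borel_measurable borel" for x unfolding \<kappa>_def by measurable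
    have \<kappa>0: "0 \<le> \<kappa> x y" for x y by (simp add: \<kappa>_def)
    define L where "L = ((N - \<alpha>) * p' * unit_ball_vol N / ((N - \<alpha>) * p' - N) * r powr (N - (N - \<alpha>) * p')) powr (1 / p')"
    have Np: "(N - \<alpha>) * p' = 2 * N" using \<alpha> by (simp add: p'_def)
    have \<kappa>: "lp_le p' L (\<kappa> x)" for x
      using lp_le_truncated_kernel[OF r(1), of p' "N - \<alpha>" x] ex(8) Np N3
      by (simp add: \<kappa>_def[abs_def] L_def dim[symmetric])
    define J where "J n x = (\<integral>\<^sup>+y. ennreal \<bar>\<kappa> x y * g n y\<bar> \<partial>lborel)" for n x
    have [measurable]: "J n \<in> borel_measurable borel" for n unfolding J_def by measurable
    have JL: "J n x \<le> ennreal (L * K)" for n x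
      unfolding J_def using ex by (intro lp_le_pairing[OF \<kappa> g _ _ dual]) auto
    have Jlim: "(\<lambda>n. J n x) \<longlonglongrightarrow> 0" for x
    proof (rule order_tendstoI)
      fix c :: ennreal assume "0 < c"
      obtain d where d: "0 < d" "ennreal d < c"
      proof (cases c)
        case (real c')
        then show ?thesis using \<open>0 < c\<close> by (intro that[of "c' / 2"]) (auto simp: ennreal_less_iff)
      next
        case top
        then show ?thesis by (intro that[of 1]) auto
      qed
      have "\<forall>\<^sub>F n in sequentially. lp_le 1 d (\<lambda>y. \<kappa> x y * g n y)"
        using ex d dual by (intro Holder_vanishing[OF \<kappa> g lim]) auto
      then show "\<forall>\<^sub>F n in sequentially. J n x < c"
      proof eventually_elim
        case (elim n)
        have "J n x \<le> ennreal d" using lp_leD(3)[OF elim] d(1) by (simp add: J_def)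
        then show ?case using d(2) by simp
      qed
    qed simp
    define B where "B = cball (0::'a) R"
    have [measurable]: "B \<in> sets borel" by (simp add: B_def)
    have Bfin: "emeasure lborel B < \<infinity>" unfolding B_def using emeasure_bounded_finite[of "cball (0::'a) R"] by simp
    have "(\<lambda>n. \<integral>\<^sup>+x. (J n x)\<^sup>2 * indicator B x \<partial>lborel) \<longlonglongrightarrow> (\<integral>\<^sup>+(x::'a). 0 \<partial>lborel)"
    proof (rule nn_integral_dominated_convergence[where w = "\<lambda>x. (ennreal (L * K))\<^sup>2 * indicator B x"])
      show "AE x in lborel. (J n x)\<^sup>2 * indicator B x \<le> (ennreal (L * K))\<^sup>2 * indicator B x" for n
        using JL by (intro AE_I2 mult_right_mono power_mono) auto
      show "(\<integral>\<^sup>+x. (ennreal (L * K))\<^sup>2 * indicator B x \<partial>lborel) < \<infinity>"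
      proof -
        have "(ennreal (L * K))\<^sup>2 < top" by (simp add: power2_eq_square ennreal_mult_less_top)
        then show ?thesis using Bfin by (subst nn_integral_cmult) (auto simp: ennreal_mult_less_top)
      qed
      show "AE x in lborel. (\<lambda>n. (J n x)\<^sup>2 * indicator B x) \<longlonglongrightarrow> 0"
      proof (rule AE_I2)
        fix x
        have "\<forall>\<^sub>F n in sequentially. J n x < 1" using Jlim by (rule order_tendstoD) simp
        then have "\<forall>\<^sub>F n in sequentially. (J n x)\<^sup>2 * indicator B x \<le> J n x"
        proof eventually_elim
          case (elim n)
          have "J n x * J n x \<le> J n x * 1" using elim by (intro mult_left_mono) auto
          then show ?case by (simp add: power2_eq_square indicator_def)
        qed
        then show "(\<lambda>n. (J n x)\<^sup>2 * indicator B x) \<longlonglongrightarrow> 0"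
          by (intro tendsto_sandwich[OF _ _ tendsto_const Jlim]) auto
      qed
    qed measurable
    then have "\<forall>\<^sub>F n in sequentially. (\<integral>\<^sup>+x. (J n x)\<^sup>2 * indicator B x \<partial>lborel) < ennreal (e\<^sup>2)"
      using e by (intro order_tendstoD) auto
    then show "\<forall>\<^sub>F n in sequentially. \<forall>\<phi> b. energy_le b \<phi> \<longrightarrow>
      (\<integral>\<^sup>+x. riesz_pot (N - \<alpha>) (g n) x * ennreal \<bar>k x\<bar> * ennreal \<bar>\<phi> x\<bar> \<partial>lborel) \<le> ennreal ((C * K * M' + M') * e * b)"
    proof eventually_elim
      case (elim n)
      show ?case
      proof (intro allI impI)
        fix \<phi> b assume \<phi>: "energy_le b \<phi>"
        note [measurable] = energy_leD(3)[OF \<phi>]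
        have b: "0 \<le> b" using energy_leD(4)[OF \<phi>] .
        have k\<phi>: "lp_le 2 (M' * b) (\<lambda>x. k x * \<phi> x)"
        proof (rule lp_le_mono[OF lp_le_cmult[OF energy_leD(1)[OF \<phi>], of M']])
          fix x
          have "\<bar>k x\<bar> \<le> M'" using kM'[of x] M'0 by (cases "x \<in> cball 0 R") auto
          then show "\<bar>k x * \<phi> x\<bar> \<le> \<bar>M' * \<phi> x\<bar>" using M'0 by (simp add: abs_mult mult_right_mono)
        qed (use M'0 in auto)
        have Jb: "lp_le 2 e (\<lambda>x. enn2real (J n x) * indicator B x)"
        proof -
          have "ennreal ((enn2real (J n x) * indicator B x)\<^sup>2) = (J n x)\<^sup>2 * indicator B x" for x
          proof -
            have "J n x < top" using JL[of n x] by (rule le_less_trans) simp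
            then have "ennreal ((enn2real (J n x))\<^sup>2) = (J n x)\<^sup>2" by (simp add: ennreal_power[symmetric])
            then show ?thesis by (simp add: indicator_def)
          qed
          then show ?thesis using elim e unfolding lp_le_2_iff by simp
        qed
        have "(\<integral>\<^sup>+x. riesz_pot (N - \<alpha>) (g n) x * ennreal \<bar>k x\<bar> * ennreal \<bar>\<phi> x\<bar> \<partial>lborel)
          \<le> (\<integral>\<^sup>+x. ennreal e * (riesz_pot \<nu> (g n) x * ennreal \<bar>k x * \<phi> x\<bar>) + ennreal M' * ennreal \<bar>(enn2real (J n x) * indicator B x) * \<phi> x\<bar> \<partial>lborel)"
        proof (rule nn_integral_mono)
          fix x
          have fin: "J n x < top" using JL[of n x] by (rule le_less_trans) simp
          have "riesz_pot (N - \<alpha>) (g n) x \<le> ennreal e * riesz_pot \<nu> (g n) x + J n x"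
            using riesz_pot_split[OF _ r(1) \<nu>(4), of "g n" x] r(2) \<nu>(5) \<kappa>0
            by (simp add: J_def abs_mult \<kappa>_def)
          then have "riesz_pot (N - \<alpha>) (g n) x * (ennreal \<bar>k x\<bar> * ennreal \<bar>\<phi> x\<bar>)
            \<le> (ennreal e * riesz_pot \<nu> (g n) x + J n x) * (ennreal \<bar>k x\<bar> * ennreal \<bar>\<phi> x\<bar>)"
            by (rule mult_right_mono) simp
          also have "\<dots> = ennreal e * (riesz_pot \<nu> (g n) x * ennreal \<bar>k x * \<phi> x\<bar>) + J n x * (ennreal \<bar>k x\<bar> * ennreal \<bar>\<phi> x\<bar>)"
            by (simp only: distrib_right mult.assoc abs_mult ennreal_mult[OF abs_ge_zero abs_ge_zero])
          also have "J n x * (ennreal \<bar>k x\<bar> * ennreal \<bar>\<phi> x\<bar>) \<le> ennreal M' * ennreal \<bar>(enn2real (J n x) * indicator B x) * \<phi> x\<bar>"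
          proof -
            have "J n x * (ennreal \<bar>k x\<bar> * ennreal \<bar>\<phi> x\<bar>) = ennreal (enn2real (J n x) * (\<bar>k x\<bar> * \<bar>\<phi> x\<bar>))"
              using fin by (simp add: ennreal_mult)
            also have "\<dots> \<le> ennreal (enn2real (J n x) * (M' * indicator B x * \<bar>\<phi> x\<bar>))"
              using kM'[of x] by (intro ennreal_leI mult_left_mono mult_right_mono) (auto simp: B_def)
            also have "\<dots> = ennreal M' * ennreal \<bar>(enn2real (J n x) * indicator B x) * \<phi> x\<bar>"
              using M'0 by (simp add: ennreal_mult[symmetric] abs_mult mult_ac)
            finally show ?thesis .
          qed
          finally show "riesz_pot (N - \<alpha>) (g n) x * ennreal \<bar>k x\<bar> * ennreal \<bar>\<phi> x\<bar>
            \<le> ennreal e * (riesz_pot \<nu> (g n) x * ennreal \<bar>k x * \<phi> x\<bar>) + ennreal M' * ennreal \<bar>(enn2real (J n x) * indicator B x) * \<phi> x\<bar>"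
            by (simp add: mult.assoc add_left_mono)
        qed
        also have "\<dots> = ennreal e * (\<integral>\<^sup>+x. riesz_pot \<nu> (g n) x * ennreal \<bar>k x * \<phi> x\<bar> \<partial>lborel)
            + ennreal M' * (\<integral>\<^sup>+x. ennreal \<bar>(enn2real (J n x) * indicator B x) * \<phi> x\<bar> \<partial>lborel)"
          by (subst nn_integral_add, measurable, subst nn_integral_cmult, measurable, subst nn_integral_cmult, measurable)
        also have "\<dots> \<le> ennreal e * ennreal (C * K * (M' * b)) + ennreal M' * ennreal (e * b)"
          by (intro add_mono mult_left_mono C(2)[OF g k\<phi>] lp_le_pairing[OF Jb energy_leD(1)[OF \<phi>]]) auto
        also have "\<dots> = ennreal ((C * K * M' + M') * e * b)"
          using e C K0 M'0 b by (simp add: ennreal_mult[symmetric] ennreal_plus[symmetric] algebra_simps del: ennreal_plus)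
        finally show "(\<integral>\<^sup>+x. riesz_pot (N - \<alpha>) (g n) x * ennreal \<bar>k x\<bar> * ennreal \<bar>\<phi> x\<bar> \<partial>lborel) \<le> ennreal ((C * K * M' + M') * e * b)" .
      qed
    qed
  qed
qed


lemma vanishing_form_add:
  assumes H: "vanishing_form H" "vanishing_form H'"
    and [measurable]: "\<And>n. H n \<in> borel_measurable borel" "\<And>n. H' n \<in> borel_measurable borel"
  shows "vanishing_form (\<lambda>n x. H n x + H' n x)"
proof (rule vanishing_formI[of 2])
  fix e :: real assume e: "0 < e"
  from H[unfolded vanishing_form_def] e
  have "\<forall>\<^sub>F n in sequentially. \<forall>\<phi> b. energy_le b \<phi> \<longrightarrow> (\<integral>\<^sup>+x. H n x * ennreal \<bar>\<phi> x\<bar> \<partial>lborel) \<le> ennreal (e * b)"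
    "\<forall>\<^sub>F n in sequentially. \<forall>\<phi> b. energy_le b \<phi> \<longrightarrow> (\<integral>\<^sup>+x. H' n x * ennreal \<bar>\<phi> x\<bar> \<partial>lborel) \<le> ennreal (e * b)"
    by blast+
  then show "\<forall>\<^sub>F n in sequentially. \<forall>\<phi> b. energy_le b \<phi> \<longrightarrow>
      (\<integral>\<^sup>+x. (H n x + H' n x) * ennreal \<bar>\<phi> x\<bar> \<partial>lborel) \<le> ennreal (2 * e * b)"
  proof eventually_elim
    case (elim n)
    show ?case
    proof (intro allI impI)
      fix \<phi> b assume \<phi>: "energy_le b \<phi>"
      note [measurable] = energy_leD(3)[OF \<phi>]
      have "(\<integral>\<^sup>+x. (H n x + H' n x) * ennreal \<bar>\<phi> x\<bar> \<partial>lborel) = (\<integral>\<^sup>+x. H n x * ennreal \<bar>\<phi> x\<bar> \<partial>lborel) + (\<integral>\<^sup>+x. H' n x * ennreal \<bar>\<phi> x\<bar> \<partial>lborel)"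
        unfolding distrib_right by (rule nn_integral_add) measurable
      also have "\<dots> \<le> ennreal (e * b) + ennreal (e * b)" using elim \<phi> by (intro add_mono) blast+
      also have "\<dots> = ennreal (2 * e * b)"
        using e energy_leD(4)[OF \<phi>] by (simp add: ennreal_plus[symmetric] del: ennreal_plus)
      finally show "(\<integral>\<^sup>+x. (H n x + H' n x) * ennreal \<bar>\<phi> x\<bar> \<partial>lborel) \<le> ennreal (2 * e * b)" .
    qed
  qed
qed simp

lemma F_splitting_vanishing:
  assumes v: "\<And>n. energy_le A (v n)" and w: "energy_le A w"
    and lim: "AE x in lborel. (\<lambda>n. v n x) \<longlonglongrightarrow> 0" and e: "0 < e"
  shows "\<forall>\<^sub>F n in sequentially. lp_le p e (\<lambda>x. F (v n x + w x) - F (v n x) - F (w x))"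
proof -
  note ex = exponents(1-12)
  note [measurable] = energy_leD(3)[OF v] energy_leD(3)[OF w]
  have fin: "(\<integral>\<^sup>+x. ennreal (growth 2 crit (u x)) \<partial>lborel) \<le> ennreal (A powr 2 + A powr crit)" if u: "energy_le A u" for u
  proof -
    note [measurable] = energy_leD(3)[OF u]
    have "(\<integral>\<^sup>+x. ennreal (growth 2 crit (u x)) \<partial>lborel) = (\<integral>\<^sup>+x. ennreal (\<bar>u x\<bar> powr 2) \<partial>lborel) + (\<integral>\<^sup>+x. ennreal (\<bar>u x\<bar> powr crit) \<partial>lborel)"
      by (subst nn_integral_add[symmetric]) (auto simp: growth_def)
    also have "\<dots> \<le> ennreal (A powr 2) + ennreal (A powr crit)"
      by (intro add_mono lp_leD(3) energy_leD[OF u])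
    finally show ?thesis by simp
  qed
  have gm[measurable]: "(\<lambda>x. growth 2 crit (u x)) \<in> borel_measurable borel" if [measurable]: "u \<in> borel_measurable borel" for u :: "'a \<Rightarrow> real"
    unfolding growth_def by measurable
  have "\<forall>\<^sub>F n in sequentially. (\<integral>\<^sup>+x. ennreal (\<bar>F (v n x + w x) - F (v n x) - F (w x)\<bar> powr p) \<partial>lborel) \<le> ennreal (e powr p)"
  proof (rule nn_integral_vanishing[where b = "\<lambda>n x. growth 2 crit (v n x)" and B = "A powr 2 + A powr crit"])
    show "(\<integral>\<^sup>+x. ennreal (growth 2 crit (v n x)) \<partial>lborel) \<le> ennreal (A powr 2 + A powr crit)" for n by (rule fin[OF v])
    fix \<delta> :: real assume "0 < \<delta>"
    from F_splitting_bound[OF this] obtain C where C: "0 < C"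
      "\<And>x y. \<bar>F (x + y) - F x - F y\<bar> powr p \<le> \<delta> * growth 2 crit x + C * growth 2 crit y"
      unfolding ex(11,12) by blast
    have "(\<integral>\<^sup>+x. ennreal (C * growth 2 crit (w x)) \<partial>lborel) = ennreal C * (\<integral>\<^sup>+x. ennreal (growth 2 crit (w x)) \<partial>lborel)"
      using C(1) by (subst nn_integral_cmult[symmetric]) (auto simp: ennreal_mult)
    also have "\<dots> \<le> ennreal C * ennreal (A powr 2 + A powr crit)" by (intro mult_left_mono fin[OF w]) auto
    also have "\<dots> < \<infinity>" by (simp add: ennreal_mult_less_top)
    finally show "\<exists>c\<in>borel_measurable lborel. (\<integral>\<^sup>+x. ennreal (c x) \<partial>lborel) < \<infinity> \<and>
        (\<forall>n x. \<bar>F (v n x + w x) - F (v n x) - F (w x)\<bar> powr p \<le> \<delta> * growth 2 crit (v n x) + c x)"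
      using C(2) by (intro bexI[of _ "\<lambda>x. C * growth 2 crit (w x)"]) auto
  next
    show "AE x in lborel. (\<lambda>n. \<bar>F (v n x + w x) - F (v n x) - F (w x)\<bar> powr p) \<longlonglongrightarrow> 0" using lim
    proof eventually_elim
      case (elim x)
      have "(\<lambda>n. \<bar>F (v n x + w x) - F (v n x) - F (w x)\<bar> powr p) \<longlonglongrightarrow> \<bar>F (0 + w x) - F 0 - F (w x)\<bar> powr p"
        using ex(4) by (intro tendsto_powr' tendsto_rabs tendsto_diff F_tendsto tendsto_add elim tendsto_const) auto
      then show ?case by simp
    qed
  qed (use e in auto)
  then show ?thesis by eventually_elim (use e ex(4) in \<open>auto intro!: lp_le_of_integral_le\<close>)
qed

lemma f_splitting_vanishing:
  assumes v: "\<And>n. energy_le A (v n)" and w: "energy_le A w"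
    and lim: "AE x in lborel. (\<lambda>n. v n x) \<longlonglongrightarrow> 0" and e: "0 < e"
  shows "\<forall>\<^sub>F n in sequentially. multiplier_le e (\<lambda>x. f (v n x + w x) - f (v n x) - f (w x))"
proof (rule multiplier_vanishing[OF _ _ v w _ e])
  note [measurable] = energy_leD(3)[OF v] energy_leD(3)[OF w]
  show "(\<lambda>x. f (v n x + w x) - f (v n x) - f (w x)) \<in> borel_measurable borel" for n by measurable
  show "AE x in lborel. (\<lambda>n. f (v n x + w x) - f (v n x) - f (w x)) \<longlonglongrightarrow> 0" using lim
  proof eventually_elim
    case (elim x)
    have "(\<lambda>n. f (v n x + w x) - f (v n x) - f (w x)) \<longlonglongrightarrow> f (0 + w x) - f 0 - f (w x)"
      by (intro tendsto_diff f_tendsto tendsto_add elim tendsto_const)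
    then show ?case by simp
  qed
  show "\<exists>C>0. \<forall>n x. \<bar>f (v n x + w x) - f (v n x) - f (w x)\<bar> \<le> \<delta> * growth a q (v n x) + C * growth a q (w x)" if "0 < \<delta>" for \<delta>
    using splitting_bound[OF that] by blast
qed

text \<open>Cutting off \<open>f(w)\<close> where \<open>|x|\<close> or \<open>|w x|\<close> is large changes it by a function that is small in the sum space; what remains is
bounded with bounded support.\<close>

lemma vanishing_form_f_fixed:
  assumes g: "\<And>n. lp_le p K (g n)" and lim: "AE x in lborel. (\<lambda>n. g n x) \<longlonglongrightarrow> 0" and w: "energy_le A w"
  shows "vanishing_form (\<lambda>n x. riesz_pot (N - \<alpha>) (g n) x * ennreal \<bar>f (w x)\<bar>)"
proof -
  note [measurable] = energy_leD(3)[OF w] lp_leD(1)[OF g]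
  obtain c where c: "0 < c" "\<And>t. \<bar>f t\<bar> \<le> c * growth a q t" using f_growth by blast
  have aq0: "0 < a" "0 < q" using exponents(1,3) by auto
  define S where "S m = {x. norm x \<le> real m \<and> \<bar>w x\<bar> \<le> real m}" for m
  have [measurable]: "S m \<in> sets borel" for m unfolding S_def by measurable
  define rest where "rest m x = f (w x) * indicator (- S m) x" for m x
  have [measurable]: "rest m \<in> borel_measurable borel" for m unfolding rest_def by measurable
  have rest: "\<forall>\<^sub>F m in sequentially. multiplier_le e (rest m)" if e: "0 < e" for e
  proof (rule multiplier_vanishing[OF _ _ _ w _ e, where v = "\<lambda>_. w"])
    show "AE x in lborel. (\<lambda>m. rest m x) \<longlonglongrightarrow> 0"
    proof (rule AE_I2)
      fix x
      obtain j :: nat where j: "max (norm x) \<bar>w x\<bar> < j" using reals_Archimedean2 by blast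
      have "rest m x = 0" if "j \<le> m" for m
      proof -
        have "x \<in> S m" using j that by (auto simp: S_def)
        then show ?thesis by (simp add: rest_def)
      qed
      then have "\<forall>\<^sub>F m in sequentially. rest m x = 0" unfolding eventually_sequentially by blast
      then show "(\<lambda>m. rest m x) \<longlonglongrightarrow> 0" by (rule tendsto_eventually)
    qed
    show "\<exists>C>0. \<forall>n x. \<bar>rest n x\<bar> \<le> \<delta> * growth a q (w x) + C * growth a q (w x)" if "0 < \<delta>" for \<delta>
    proof (intro exI[of _ c] conjI allI c)
      fix n x
      have "\<bar>rest n x\<bar> \<le> \<bar>f (w x)\<bar>" by (auto simp: rest_def indicator_def)
      also have "\<dots> \<le> c * growth a q (w x)" by (rule c)
      also have "\<dots> \<le> \<delta> * growth a q (w x) + c * growth a q (w x)" using that by simp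
      finally show "\<bar>rest n x\<bar> \<le> \<delta> * growth a q (w x) + c * growth a q (w x)" .
    qed
  qed (use w in auto)
  obtain C where C: "0 < C"
    "\<And>g K k e \<phi> b. lp_le p K g \<Longrightarrow> multiplier_le e k \<Longrightarrow> energy_le b \<phi> \<Longrightarrow>
      (\<integral>\<^sup>+x. riesz_pot (N - \<alpha>) g x * ennreal \<bar>k x\<bar> * ennreal \<bar>\<phi> x\<bar> \<partial>lborel) \<le> ennreal (C * K * e * b)"
    by (rule potential_form_bound) blast
  have K0: "0 \<le> K" using lp_leD(2)[OF g] .
  show ?thesis
  proof (rule vanishing_formI[of "C * K + 1"])
    show "0 \<le> C * K + 1" using C K0 by simp
    fix e :: real assume e: "0 < e"
    obtain m where m: "multiplier_le e (rest m)" using rest[OF e] by (auto simp: eventually_sequentially)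
    define k where "k x = f (w x) * indicator (S m) x" for x
    have [measurable]: "k \<in> borel_measurable borel" unfolding k_def by measurable
    have "\<bar>k x\<bar> \<le> c * growth a q (real m) * indicator (cball 0 (real m)) x" for x
    proof (cases "x \<in> S m")
      case True
      have "\<bar>f (w x)\<bar> \<le> c * growth a q (w x)" by (rule c)
      also have "\<dots> \<le> c * growth a q (real m)"
        using True c aq0 by (intro mult_left_mono growth_mono) (auto simp: S_def)
      finally show ?thesis using True by (simp add: k_def S_def)
    next
      case False
      then show ?thesis using c by (simp add: k_def)
    qed
    then have "vanishing_form (\<lambda>n x. riesz_pot (N - \<alpha>) (g n) x * ennreal \<bar>k x\<bar>)"
      by (intro vanishing_local_form[OF g lim]) auto
    then have "\<forall>\<^sub>F n in sequentially. \<forall>\<phi> b. energy_le b \<phi> \<longrightarrow>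
      (\<integral>\<^sup>+x. riesz_pot (N - \<alpha>) (g n) x * ennreal \<bar>k x\<bar> * ennreal \<bar>\<phi> x\<bar> \<partial>lborel) \<le> ennreal (e * b)"
      using e by (auto simp: vanishing_form_def)
    then show "\<forall>\<^sub>F n in sequentially. \<forall>\<phi> b. energy_le b \<phi> \<longrightarrow>
      (\<integral>\<^sup>+x. riesz_pot (N - \<alpha>) (g n) x * ennreal \<bar>f (w x)\<bar> * ennreal \<bar>\<phi> x\<bar> \<partial>lborel) \<le> ennreal ((C * K + 1) * e * b)"
    proof eventually_elim
      case (elim n)
      show ?case
      proof (intro allI impI)
        fix \<phi> b assume \<phi>: "energy_le b \<phi>"
        note [measurable] = energy_leD(3)[OF \<phi>]
        have "(\<integral>\<^sup>+x. riesz_pot (N - \<alpha>) (g n) x * ennreal \<bar>f (w x)\<bar> * ennreal \<bar>\<phi> x\<bar> \<partial>lborel)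
          = (\<integral>\<^sup>+x. riesz_pot (N - \<alpha>) (g n) x * ennreal \<bar>rest m x\<bar> * ennreal \<bar>\<phi> x\<bar> + riesz_pot (N - \<alpha>) (g n) x * ennreal \<bar>k x\<bar> * ennreal \<bar>\<phi> x\<bar> \<partial>lborel)"
          by (intro nn_integral_cong) (auto simp: rest_def k_def indicator_def)
        also have "\<dots> = (\<integral>\<^sup>+x. riesz_pot (N - \<alpha>) (g n) x * ennreal \<bar>rest m x\<bar> * ennreal \<bar>\<phi> x\<bar> \<partial>lborel) + (\<integral>\<^sup>+x. riesz_pot (N - \<alpha>) (g n) x * ennreal \<bar>k x\<bar> * ennreal \<bar>\<phi> x\<bar> \<partial>lborel)"
          by (rule nn_integral_add) measurable
        also have "\<dots> \<le> ennreal (C * K * e * b) + ennreal (e * b)"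
          using elim \<phi> by (intro add_mono C(2)[OF g m \<phi>]) blast
        also have "\<dots> = ennreal ((C * K + 1) * e * b)"
          using e C K0 energy_leD(4)[OF \<phi>] by (simp add: ennreal_plus[symmetric] algebra_simps del: ennreal_plus)
        finally show "(\<integral>\<^sup>+x. riesz_pot (N - \<alpha>) (g n) x * ennreal \<bar>f (w x)\<bar> * ennreal \<bar>\<phi> x\<bar> \<partial>lborel) \<le> ennreal ((C * K + 1) * e * b)" .
      qed
    qed
  qed
qed

text \<open>For \<open>c = riesz_const DIM('a) \<alpha>\<close> this is the convolution with the Riesz kernel, as an integral with respect to
\<open>lborel\<close>; the constant only has to be nonnegative in what follows.\<close>

definition riesz_conv :: "real \<Rightarrow> ('a \<Rightarrow> real) \<Rightarrow> 'a \<Rightarrow> real" where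
  "riesz_conv c g x = (\<integral>y. c / norm (x - y) powr (N - \<alpha>) * g y \<partial>lborel)"

lemma riesz_conv_bound:
  assumes [measurable]: "g \<in> borel_measurable borel" and c: "0 \<le> c"
  shows "ennreal \<bar>riesz_conv c g x\<bar> \<le> ennreal c * riesz_pot (N - \<alpha>) g x"
proof -
  have "ennreal \<bar>riesz_conv c g x\<bar> \<le> (\<integral>\<^sup>+y. ennreal \<bar>c / norm (x - y) powr (N - \<alpha>) * g y\<bar> \<partial>lborel)"
    unfolding riesz_conv_def by (rule abs_integral_le_nn_integral)
  also have "\<dots> = (\<integral>\<^sup>+y. ennreal c * ennreal (norm (x - y) powr (-(N - \<alpha>)) * \<bar>g y\<bar>) \<partial>lborel)"
  proof (rule nn_integral_cong)
    fix y
    have "\<bar>c / norm (x - y) powr (N - \<alpha>) * g y\<bar> = c * (norm (x - y) powr (-(N - \<alpha>)) * \<bar>g y\<bar>)"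
      using c unfolding powr_minus_divide by (simp add: abs_mult)
    then show "ennreal \<bar>c / norm (x - y) powr (N - \<alpha>) * g y\<bar> = ennreal c * ennreal (norm (x - y) powr (-(N - \<alpha>)) * \<bar>g y\<bar>)"
      using c by (simp add: ennreal_mult)
  qed
  also have "\<dots> = ennreal c * riesz_pot (N - \<alpha>) g x"
    unfolding riesz_pot_def by (rule nn_integral_cmult) measurable
  finally show ?thesis .
qed

lemma riesz_conv_integrable:
  assumes [measurable]: "g \<in> borel_measurable borel" and c: "0 \<le> c" and fin: "riesz_pot (N - \<alpha>) g x < \<infinity>"
  shows "integrable lborel (\<lambda>y. c / norm (x - y) powr (N - \<alpha>) * g y)"
proof -
  have "integrable lborel (\<lambda>y. norm (x - y) powr (-(N - \<alpha>)) * g y)"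
  proof (rule integrableI_bounded)
    show "(\<integral>\<^sup>+y. ennreal (norm (norm (x - y) powr (-(N - \<alpha>)) * g y)) \<partial>lborel) < \<infinity>"
      using fin by (simp add: riesz_pot_def abs_mult)
  qed measurable
  then have "integrable lborel (\<lambda>y. c * (norm (x - y) powr (-(N - \<alpha>)) * g y))" by (rule integrable_mult_right)
  then show ?thesis unfolding powr_minus_divide by simp
qed

text \<open>The five terms are estimated as densities of functionals, each by the absolute value of one factor times the potential
of the other. The identity behind the decomposition holds at almost every point only, namely where the three
potentials are finite.\<close>

theorem choquard_splitting:
  assumes v: "\<And>n. energy_le A (v n)" and w: "energy_le A w" and vw: "\<And>n. energy_le A (\<lambda>x. v n x + w x)"
    and lim: "AE x in lborel. (\<lambda>n. v n x) \<longlonglongrightarrow> 0" and c: "0 \<le> c" and e: "0 < e"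
  shows "\<forall>\<^sub>F n in sequentially. \<forall>\<phi> b. energy_le b \<phi> \<longrightarrow>
    (\<integral>\<^sup>+x. ennreal \<bar>(riesz_conv c (\<lambda>y. F (v n y + w y)) x * f (v n x + w x)
        - riesz_conv c (\<lambda>y. F (v n y)) x * f (v n x)
        - riesz_conv c (\<lambda>y. F (w y)) x * f (w x)) * \<phi> x\<bar> \<partial>lborel) \<le> ennreal (e * b)"
proof -
  note [measurable] = energy_leD(3)[OF v] energy_leD(3)[OF w]
  have A0: "0 \<le> A" using energy_leD(4)[OF w] .
  obtain K where K: "0 \<le> K" "\<And>u. energy_le A u \<Longrightarrow> lp_le p K (\<lambda>x. F (u x))" by (rule F_lp_bound[OF A0]) blast
  obtain c0 where c0: "0 < c0" "\<And>t. \<bar>f t\<bar> \<le> c0 * growth a q t" using f_growth by blast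
  define d where "d n x = F (v n x + w x) - F (v n x) - F (w x)" for n x
  define k where "k n x = f (v n x + w x) - f (v n x) - f (w x)" for n x
  let ?P = "riesz_pot (N - \<alpha>)"
  have [measurable]: "d n \<in> borel_measurable borel" "k n \<in> borel_measurable borel" for n
    unfolding d_def k_def by measurable
  have t1: "vanishing_form (\<lambda>n x. ?P (d n) x * ennreal \<bar>f (v n x + w x)\<bar>)"
  proof (rule vanishing_potential_form)
    show "\<forall>\<^sub>F n in sequentially. lp_le p e (d n)" if "0 < e" for e
      unfolding d_def by (rule F_splitting_vanishing[OF v w lim that])
    show "multiplier_le (c0 * (A powr a + A powr q)) (\<lambda>x. f (v n x + w x))" for n
      by (rule multiplier_le_growth[OF vw[of n] _ c0(2) less_imp_le[OF c0(1)]]) measurable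
  qed (use c0 in simp)
  have kv: "\<forall>\<^sub>F n in sequentially. multiplier_le e (k n)" if "0 < e" for e
    unfolding k_def by (rule f_splitting_vanishing[OF v w lim that])
  have t2: "vanishing_form (\<lambda>n x. ?P (\<lambda>y. F (v n y)) x * ennreal \<bar>k n x\<bar>)"
    by (rule vanishing_multiplier_form[OF K(2)[OF v] kv])
  have t3: "vanishing_form (\<lambda>n x. ?P (\<lambda>y. F (w y)) x * ennreal \<bar>k n x\<bar>)"
    by (rule vanishing_multiplier_form[OF K(2)[OF w] kv])
  have Flim: "AE x in lborel. (\<lambda>n. F (v n x)) \<longlonglongrightarrow> 0"
    using lim by eventually_elim (rule F_tendsto[where c = 0, simplified])
  have flim: "AE x in lborel. (\<lambda>n. f (v n x)) \<longlonglongrightarrow> 0"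
    using lim by eventually_elim (rule f_tendsto[where c = 0, simplified])
  have t4: "vanishing_form (\<lambda>n x. ?P (\<lambda>y. F (v n y)) x * ennreal \<bar>f (w x)\<bar>)"
    by (rule vanishing_form_f_fixed[OF K(2)[OF v] Flim w])
  have t5: "vanishing_form (\<lambda>n x. ?P (\<lambda>y. F (w y)) x * ennreal \<bar>f (v n x)\<bar>)"
    using c0 by (intro vanishing_fixed_potential_form[OF K(2)[OF w] v _ _ _ flim, where c = c0]) auto
  define H where "H n x = ?P (d n) x * ennreal \<bar>f (v n x + w x)\<bar> + ?P (\<lambda>y. F (v n y)) x * ennreal \<bar>k n x\<bar>
    + ?P (\<lambda>y. F (w y)) x * ennreal \<bar>k n x\<bar> + ?P (\<lambda>y. F (v n y)) x * ennreal \<bar>f (w x)\<bar> + ?P (\<lambda>y. F (w y)) x * ennreal \<bar>f (v n x)\<bar>" for n x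
  have [measurable]: "H n \<in> borel_measurable borel" for n unfolding H_def by measurable
  have "vanishing_form H" unfolding H_def
    by (intro vanishing_form_add t1 t2 t3 t4 t5) measurable
  moreover have "0 < e / (c + 1)" using e c by simp
  ultimately have small: "\<forall>\<^sub>F n in sequentially. \<forall>\<phi> b. energy_le b \<phi> \<longrightarrow>
      (\<integral>\<^sup>+x. H n x * ennreal \<bar>\<phi> x\<bar> \<partial>lborel) \<le> ennreal (e / (c + 1) * b)"
    unfolding vanishing_form_def by blast
  have h: "0 < N - \<alpha>" "N - \<alpha> < real DIM('a)" "1 < p" "1 < p'" "1 / p' = 1 / p + (N - \<alpha>) / real DIM('a) - 1"
    using \<alpha> exponents(1-8) exponents(15) by (auto simp: dim[symmetric])
  have fin: "AE x in lborel. ?P g x < \<infinity>" if "lp_le p K g" for K and g :: "'a \<Rightarrow> real"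
    by (rule Riesz_potential_bound[OF h]) (use that in blast)
  from small
  show ?thesis
  proof eventually_elim
    case (elim n)
    let ?V = "\<lambda>y. F (v n y)" and ?W = "\<lambda>y. F (w y)" and ?S = "\<lambda>y. F (v n y + w y)"
    define E where "E x = riesz_conv c ?S x * f (v n x + w x) - riesz_conv c ?V x * f (v n x) - riesz_conv c ?W x * f (w x)" for x
    have bound: "AE x in lborel. ennreal \<bar>E x\<bar> \<le> ennreal c * H n x"
      using fin[OF K(2)[OF v]] fin[OF K(2)[OF w]] fin[OF K(2)[OF vw]]
    proof eventually_elim
      fix x assume fx: "?P ?V x < \<infinity>" "?P ?W x < \<infinity>" "?P ?S x < \<infinity>"
      have i: "integrable lborel (\<lambda>y. c / norm (x - y) powr (N - \<alpha>) * ?V y)"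
        "integrable lborel (\<lambda>y. c / norm (x - y) powr (N - \<alpha>) * ?W y)"
        "integrable lborel (\<lambda>y. c / norm (x - y) powr (N - \<alpha>) * ?S y)"
        using fx c by (intro riesz_conv_integrable; simp)+
      have "riesz_conv c (d n) x = (\<integral>y. c / norm (x - y) powr (N - \<alpha>) * ?S y - c / norm (x - y) powr (N - \<alpha>) * ?V y - c / norm (x - y) powr (N - \<alpha>) * ?W y \<partial>lborel)"
        by (simp add: riesz_conv_def d_def right_diff_distrib)
      also have "\<dots> = riesz_conv c ?S x - riesz_conv c ?V x - riesz_conv c ?W x"
        unfolding riesz_conv_def using i by (subst Bochner_Integration.integral_diff Bochner_Integration.integrable_diff, simp_all)
      finally have S: "riesz_conv c ?S x = riesz_conv c (d n) x + riesz_conv c ?V x + riesz_conv c ?W x" by simp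
      have "E x = riesz_conv c (d n) x * f (v n x + w x) + riesz_conv c ?V x * k n x + riesz_conv c ?W x * k n x
          + riesz_conv c ?V x * f (w x) + riesz_conv c ?W x * f (v n x)"
        unfolding E_def S k_def by (simp add: algebra_simps)
      then have "\<bar>E x\<bar> \<le> \<bar>riesz_conv c (d n) x\<bar> * \<bar>f (v n x + w x)\<bar> + \<bar>riesz_conv c ?V x\<bar> * \<bar>k n x\<bar> + \<bar>riesz_conv c ?W x\<bar> * \<bar>k n x\<bar>
          + \<bar>riesz_conv c ?V x\<bar> * \<bar>f (w x)\<bar> + \<bar>riesz_conv c ?W x\<bar> * \<bar>f (v n x)\<bar>"
        unfolding abs_mult[symmetric] by linarith
      then have "ennreal \<bar>E x\<bar> \<le> ennreal (\<bar>riesz_conv c (d n) x\<bar> * \<bar>f (v n x + w x)\<bar> + \<bar>riesz_conv c ?V x\<bar> * \<bar>k n x\<bar> + \<bar>riesz_conv c ?W x\<bar> * \<bar>k n x\<bar>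
          + \<bar>riesz_conv c ?V x\<bar> * \<bar>f (w x)\<bar> + \<bar>riesz_conv c ?W x\<bar> * \<bar>f (v n x)\<bar>)"
        by (rule ennreal_leI)
      also have "\<dots> = ennreal \<bar>riesz_conv c (d n) x\<bar> * ennreal \<bar>f (v n x + w x)\<bar> + ennreal \<bar>riesz_conv c ?V x\<bar> * ennreal \<bar>k n x\<bar>
          + ennreal \<bar>riesz_conv c ?W x\<bar> * ennreal \<bar>k n x\<bar> + ennreal \<bar>riesz_conv c ?V x\<bar> * ennreal \<bar>f (w x)\<bar> + ennreal \<bar>riesz_conv c ?W x\<bar> * ennreal \<bar>f (v n x)\<bar>"
        by (simp add: ennreal_mult)
      also have "\<dots> \<le> (ennreal c * ?P (d n) x) * ennreal \<bar>f (v n x + w x)\<bar> + (ennreal c * ?P ?V x) * ennreal \<bar>k n x\<bar>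
          + (ennreal c * ?P ?W x) * ennreal \<bar>k n x\<bar> + (ennreal c * ?P ?V x) * ennreal \<bar>f (w x)\<bar> + (ennreal c * ?P ?W x) * ennreal \<bar>f (v n x)\<bar>"
        using c by (intro add_mono mult_right_mono riesz_conv_bound) auto
      also have "\<dots> = ennreal c * H n x" by (simp add: H_def distrib_left mult.assoc)
      finally show "ennreal \<bar>E x\<bar> \<le> ennreal c * H n x" .
    qed
    show ?case
    proof (intro allI impI)
      fix \<phi> b assume \<phi>: "energy_le b \<phi>"
      note [measurable] = energy_leD(3)[OF \<phi>]
      have b: "0 \<le> b" using energy_leD(4)[OF \<phi>] .
      have "(\<integral>\<^sup>+x. ennreal \<bar>E x * \<phi> x\<bar> \<partial>lborel) \<le> (\<integral>\<^sup>+x. ennreal c * (H n x * ennreal \<bar>\<phi> x\<bar>) \<partial>lborel)"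
      proof (rule nn_integral_mono_AE, use bound in eventually_elim)
        fix x assume "ennreal \<bar>E x\<bar> \<le> ennreal c * H n x"
        from mult_right_mono[OF this, of "ennreal \<bar>\<phi> x\<bar>"]
        show "ennreal \<bar>E x * \<phi> x\<bar> \<le> ennreal c * (H n x * ennreal \<bar>\<phi> x\<bar>)"
          by (simp add: abs_mult ennreal_mult mult.assoc)
      qed
      also have "\<dots> = ennreal c * (\<integral>\<^sup>+x. H n x * ennreal \<bar>\<phi> x\<bar> \<partial>lborel)" by (rule nn_integral_cmult) measurable
      also have "\<dots> \<le> ennreal c * ennreal (e / (c + 1) * b)" using elim \<phi> by (intro mult_left_mono) (blast, simp)
      also have "\<dots> = ennreal (c * (e / (c + 1)) * b)" using c e b by (simp add: ennreal_mult[symmetric] mult.assoc)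
      also have "\<dots> \<le> ennreal (e * b)"
        using c e b by (intro ennreal_leI mult_right_mono) (auto simp: field_simps)
      finally show "(\<integral>\<^sup>+x. ennreal \<bar>(riesz_conv c ?S x * f (v n x + w x) - riesz_conv c ?V x * f (v n x) - riesz_conv c ?W x * f (w x)) * \<phi> x\<bar> \<partial>lborel) \<le> ennreal (e * b)"
        by (simp only: E_def)
    qed
  qed
qed

end

section \<open>The splitting on the Sobolev space\<close>

text \<open>The best constant for the index \<open>n\<close> serves as the rate. It is a real number once the bound with constant 1
holds, and the subsequence starts at such an index.\<close>

lemma uniform_rate_subsequence:
  fixes I :: "nat \<Rightarrow> 'b \<Rightarrow> real" and h :: "'b \<Rightarrow> real"
  assumes h: "\<And>\<phi>. 0 \<le> h \<phi>"
    and ev: "\<And>e. 0 < e \<Longrightarrow> \<forall>\<^sub>F n in sequentially. \<forall>\<phi>\<in>S. \<bar>I n \<phi>\<bar> \<le> e * h \<phi>"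
  shows "\<exists>r::nat \<Rightarrow> nat. strict_mono r \<and> (\<exists>\<epsilon>::nat \<Rightarrow> real. \<epsilon> \<longlonglongrightarrow> 0 \<and> (\<forall>n. \<forall>\<phi>\<in>S. \<bar>I (r n) \<phi>\<bar> \<le> \<epsilon> n * h \<phi>))"
proof -
  obtain m where m: "\<And>n. m \<le> n \<Longrightarrow> \<forall>\<phi>\<in>S. \<bar>I n \<phi>\<bar> \<le> 1 * h \<phi>"
    using ev[OF zero_less_one] by (auto simp: eventually_sequentially)
  define E where "E n = {e. 0 \<le> e \<and> (\<forall>\<phi>\<in>S. \<bar>I (n + m) \<phi>\<bar> \<le> e * h \<phi>)}" for n
  define \<epsilon> where "\<epsilon> n = Inf (E n)" for n
  have 1: "1 \<in> E n" for n using m[of "n + m"] by (auto simp: E_def)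
  have bdd: "bdd_below (E n)" for n by (auto simp: E_def intro: bdd_belowI[of _ 0])
  have \<epsilon>0: "0 \<le> \<epsilon> n" for n unfolding \<epsilon>_def
  proof (rule cInf_greatest)
    show "E n \<noteq> {}" using 1 by blast
  qed (simp add: E_def)
  have \<epsilon>_le: "\<epsilon> n \<le> e" if "e \<in> E n" for n e unfolding \<epsilon>_def by (rule cInf_lower[OF that bdd])
  have bound: "\<bar>I (n + m) \<phi>\<bar> \<le> \<epsilon> n * h \<phi>" if \<phi>: "\<phi> \<in> S" for n \<phi>
  proof (cases "h \<phi> = 0")
    case True
    then show ?thesis using bspec[OF m[of "n + m"] \<phi>] by simp
  next
    case False
    then have "0 < h \<phi>" using h[of \<phi>] by simp
    have "\<bar>I (n + m) \<phi>\<bar> / h \<phi> \<le> \<epsilon> n"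
      unfolding \<epsilon>_def
    proof (rule cInf_greatest)
      show "E n \<noteq> {}" using 1 by blast
      show "\<bar>I (n + m) \<phi>\<bar> / h \<phi> \<le> e" if "e \<in> E n" for e
        using that \<phi> \<open>0 < h \<phi>\<close> by (simp add: E_def divide_le_eq)
    qed
    then show ?thesis using \<open>0 < h \<phi>\<close> by (simp add: divide_le_eq)
  qed
  have "\<epsilon> \<longlonglongrightarrow> 0"
  proof (rule order_tendstoI)
    fix c :: real assume "0 < c"
    then have "\<forall>\<^sub>F n in sequentially. \<forall>\<phi>\<in>S. \<bar>I (n + m) \<phi>\<bar> \<le> c / 2 * h \<phi>"
      using ev[of "c / 2"] by (subst eventually_sequentially_seg) simp
    then show "\<forall>\<^sub>F n in sequentially. \<epsilon> n < c"
    proof eventually_elim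
      case (elim n)
      then have "\<epsilon> n \<le> c / 2" using \<open>0 < c\<close> by (intro \<epsilon>_le) (auto simp: E_def)
      then show ?case using \<open>0 < c\<close> by simp
    qed
  next
    fix c :: real assume "c < 0"
    then have "c < \<epsilon> n" for n using \<epsilon>0[of n] by linarith
    then show "\<forall>\<^sub>F n in sequentially. c < \<epsilon> n" by (simp add: always_eventually)
  qed
  then show ?thesis using bound by (intro exI[of _ "\<lambda>n. n + m"] conjI exI[of _ \<epsilon>]) (auto simp: strict_mono_def)
qed

lemma riesz_const_nonneg:
  assumes "0 < \<alpha>" "\<alpha> < real N"
  shows "0 \<le> riesz_const N \<alpha>"
  using assms by (simp add: riesz_const_def Gamma_real_pos less_imp_le)

lemma convol_riesz_eq:
  fixes u v :: "real ^ 'n::finite \<Rightarrow> real"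
  assumes u: "u \<in> borel_measurable lebesgue" and v: "v \<in> borel_measurable borel" and uv: "AE x in lebesgue. u x = v x"
    and F[measurable]: "F \<in> borel_measurable borel"
  shows "convol (riesz \<alpha>) (\<lambda>y. F (u y)) x
    = (\<integral>y. riesz_const CARD('n) \<alpha> / norm (x - y) powr (real CARD('n) - \<alpha>) * F (v y) \<partial>lborel)"
  unfolding convol_def riesz_def
proof (rule integral_lebesgue_eq_lborel)
  have "(\<lambda>y. F (u y)) \<in> borel_measurable lebesgue" using measurable_compose[OF u F] by (simp add: o_def)
  moreover have "(\<lambda>y. riesz_const CARD('n) \<alpha> / norm (x - y) powr (real CARD('n) - \<alpha>)) \<in> borel_measurable lebesgue"
    by (rule measurable_completion) measurable
  ultimately show "(\<lambda>y. riesz_const CARD('n) \<alpha> / norm (x - y) powr (real CARD('n) - \<alpha>) * F (u y)) \<in> borel_measurable lebesgue"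
    by (intro borel_measurable_times)
  show "(\<lambda>y. riesz_const CARD('n) \<alpha> / norm (x - y) powr (real CARD('n) - \<alpha>) * F (v y)) \<in> borel_measurable borel"
    using v by measurable
  show "AE y in lebesgue. riesz_const CARD('n) \<alpha> / norm (x - y) powr (real CARD('n) - \<alpha>) * F (u y)
      = riesz_const CARD('n) \<alpha> / norm (x - y) powr (real CARD('n) - \<alpha>) * F (v y)"
    using uv by eventually_elim simp
qed

theorem proposition3p1:
  fixes \<alpha> :: real
    and f F :: "real \<Rightarrow> real"
    and w :: "nat \<Rightarrow> real ^ 'n::finite \<Rightarrow> real"
    and w0 :: "real ^ 'n \<Rightarrow> real"
  assumes "CARD('n) \<ge> 3"
    and "max (real CARD('n) - 4) 0 < \<alpha>" and "\<alpha> < real CARD('n)"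
    and "continuous_on UNIV f"
    and "((\<lambda>t. f t / \<bar>t\<bar> powr (\<alpha> / real CARD('n))) \<longlongrightarrow> 0) (at 0)"
    and "\<exists>L\<ge>0. ((\<lambda>t. f t / (\<bar>t\<bar> powr ((4 + \<alpha> - real CARD('n)) / (real CARD('n) - 2)) * t)) \<longlongrightarrow> L) at_infinity"
    and "\<And>t. F t = (LBINT s=ereal 0..ereal t. f s)"
    and "\<And>n. w n \<in> H1" and "w0 \<in> H1"
    and "H1_weakly_tendsto w w0"
    and "AE x in lebesgue. (\<lambda>n. w n x) \<longlonglongrightarrow> w0 x"
  shows "\<exists>r :: nat \<Rightarrow> nat. strict_mono r \<and>
    (\<exists>\<epsilon> :: nat \<Rightarrow> real. \<epsilon> \<longlonglongrightarrow> 0 \<and>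
      (\<forall>n. \<forall>\<phi>\<in>H1.
        \<bar>\<integral>x. (convol (riesz \<alpha>) (\<lambda>y. F (w (r n) y)) x * f (w (r n) x)
              - convol (riesz \<alpha>) (\<lambda>y. F (w (r n) y - w0 y)) x * f (w (r n) x - w0 x)
              - convol (riesz \<alpha>) (\<lambda>y. F (w0 y)) x * f (w0 x)) * \<phi> x \<partial>lebesgue\<bar>
        \<le> \<epsilon> n * H1_norm \<phi>))"
proof -
  let ?N = "real CARD('n)"
  have N3: "3 \<le> ?N" using assms(1) by simp
  have \<alpha>0: "0 < \<alpha>" using assms(2) by simp
  interpret choquard_nonlinearity \<alpha> ?N f F "TYPE(real ^ 'n)"
    by unfold_locales (use assms N3 in auto)
  obtain C where C: "0 < C"
    "\<And>(u :: real ^ 'n \<Rightarrow> real) v. u \<in> H1 \<Longrightarrow> v \<in> borel_measurable borel \<Longrightarrow> (AE x in lebesgue. u x = v x) \<Longrightarrow>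
      lp_le (2 * ?N / (?N - 2)) (C * H1_norm u) v"
    by (rule Sobolev_inequality[OF assms(1)]) blast
  note crit_bound = C(2)[folded crit_def]
  have L2_bound: "lp_le 2 (1 * H1_norm u) v"
    if "u \<in> H1" "v \<in> borel_measurable borel" "AE x in lebesgue. u x = v x" for u v :: "real ^ 'n \<Rightarrow> real"
    using H1_L2_bound[OF that] by simp
  have two: "1 < (2::real)" by simp
  have energy: "energy_le ((1 + C) * H1_norm u) v"
    if "u \<in> H1" "v \<in> borel_measurable borel" "AE x in lebesgue. u x = v x" for u v :: "real ^ 'n \<Rightarrow> real"
  proof -
    have "0 \<le> H1_norm u" "0 \<le> C * H1_norm u" using C(1) H1_norm_nonneg[of u] by auto
    then show ?thesis unfolding energy_le_def distrib_right
      using that exponents(5) by (intro conjI lp_le_mono[OF L2_bound[OF that]] lp_le_mono[OF crit_bound[OF that]]) auto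
  qed
  obtain B2 where B2: "0 \<le> B2" "\<And>n v. v \<in> borel_measurable borel \<Longrightarrow> (AE x in lebesgue. w n x = v x) \<Longrightarrow> lp_le 2 B2 v"
    using H1_weak_imp_lp_bounded[OF assms(8,10) two zero_less_one L2_bound] by blast
  obtain Bc where Bc: "0 \<le> Bc" "\<And>n v. v \<in> borel_measurable borel \<Longrightarrow> (AE x in lebesgue. w n x = v x) \<Longrightarrow> lp_le crit Bc v"
    using H1_weak_imp_lp_bounded[OF assms(8,10) exponents(5) C(1) crit_bound] by blast
  obtain w' where w': "\<And>n. w' n \<in> borel_measurable borel" "\<And>n. AE x in lebesgue. w n x = w' n x"
    using borel_representative[OF H1_measurable[OF assms(8)]] by metis
  obtain w0' where w0': "w0' \<in> borel_measurable borel" "AE x in lebesgue. w0 x = w0' x"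
    using borel_representative[OF H1_measurable[OF assms(9)]] by blast
  note [measurable] = w'(1) w0'(1)
  define A0 where "A0 = B2 + Bc + (1 + C) * H1_norm w0"
  have "0 \<le> (1 + C) * H1_norm w0" using C(1) H1_norm_nonneg[of w0] by simp
  then have A0: "B2 \<le> A0" "Bc \<le> A0" "(1 + C) * H1_norm w0 \<le> A0" "0 \<le> A0" using B2(1) Bc(1) by (auto simp: A0_def)
  have w'A: "lp_le 2 A0 (w' n)" "lp_le crit A0 (w' n)" for n
    using A0 exponents(5)
    by (auto intro: lp_le_mono[OF B2(2)[OF w'(1) w'(2)]] lp_le_mono[OF Bc(2)[OF w'(1) w'(2)]])
  have w0'A: "lp_le 2 A0 w0'" "lp_le crit A0 w0'"
    using A0 exponents(5) energy_leD(1,2)[OF energy[OF assms(9) w0']]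
    by (auto intro: lp_le_mono)
  \<comment> \<open>Written as a sum so that the bounds for sums and multiples of functions apply.\<close>
  define v where "v n x = w' n x + (-1) * w0' x" for n x
  define A where "A = 2 * (A0 + \<bar>-1\<bar> * A0)"
  have AA: "A0 \<le> A" using A0 by (simp add: A_def)
  have v: "energy_le A (v n)" for n
    unfolding energy_le_def v_def A_def using exponents(5)
    by (intro conjI lp_le_add w'A lp_le_cmult w0'A) auto
  have w0A: "energy_le A w0'"
    unfolding energy_le_def using exponents(5) AA by (auto intro: lp_le_mono[OF w0'A(1)] lp_le_mono[OF w0'A(2)])
  have vw: "energy_le A (\<lambda>x. v n x + w0' x)" for n
    unfolding energy_le_def v_def using exponents(5) AA by (auto intro: lp_le_mono[OF w'A(1)] lp_le_mono[OF w'A(2)])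
  have lim: "AE x in lborel. (\<lambda>n. v n x) \<longlonglongrightarrow> 0"
  proof (rule AE_lborel_of_lebesgue)
    have "AE x in lebesgue. \<forall>n. w n x = w' n x" using w'(2) by (simp add: AE_all_countable)
    then show "AE x in lebesgue. (\<lambda>n. v n x) \<longlonglongrightarrow> 0" using assms(11) w0'(2)
    proof eventually_elim
      case (elim x)
      then have "(\<lambda>n. w' n x + (-1) * w0' x) \<longlonglongrightarrow> w0' x + (-1) * w0' x"
        by (intro tendsto_add tendsto_const) simp
      then show ?case by (simp add: v_def)
    qed
  qed
  define c where "c = riesz_const CARD('n) \<alpha>"
  have c: "0 \<le> c" unfolding c_def using \<alpha>0 assms(3) by (rule riesz_const_nonneg)
  define I where "I n \<phi> = (\<integral>x. (convol (riesz \<alpha>) (\<lambda>y. F (w n y)) x * f (w n x)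
              - convol (riesz \<alpha>) (\<lambda>y. F (w n y - w0 y)) x * f (w n x - w0 x)
              - convol (riesz \<alpha>) (\<lambda>y. F (w0 y)) x * f (w0 x)) * \<phi> x \<partial>lebesgue)" for n \<phi>
  have conv: "convol (riesz \<alpha>) (\<lambda>y. F (u y)) x = riesz_conv c (\<lambda>y. F (u' y)) x"
    if "u \<in> borel_measurable lebesgue" "u' \<in> borel_measurable borel" "AE x in lebesgue. u x = u' x" for u u' :: "real ^ 'n \<Rightarrow> real" and x
    unfolding riesz_conv_def c_def by (rule convol_riesz_eq[OF that F_measurable])
  have ev: "\<forall>\<^sub>F n in sequentially. \<forall>\<phi>\<in>H1. \<bar>I n \<phi>\<bar> \<le> e * H1_norm \<phi>" if e: "0 < e" for e
  proof -
    have "0 < e / (1 + C)" using e C(1) by simp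
    from choquard_splitting[OF v w0A vw lim c this] show ?thesis
    proof eventually_elim
      case (elim n)
      show ?case
      proof
        fix \<phi> :: "real ^ 'n \<Rightarrow> real" assume \<phi>: "\<phi> \<in> H1"
        obtain \<phi>' where \<phi>': "\<phi>' \<in> borel_measurable borel" "AE x in lebesgue. \<phi> x = \<phi>' x"
          using borel_representative[OF H1_measurable[OF \<phi>]] by blast
        let ?E = "\<lambda>x. (riesz_conv c (\<lambda>y. F (v n y + w0' y)) x * f (v n x + w0' x)
            - riesz_conv c (\<lambda>y. F (v n y)) x * f (v n x)
            - riesz_conv c (\<lambda>y. F (w0' y)) x * f (w0' x)) * \<phi>' x"
        have vm: "v n \<in> borel_measurable borel" "(\<lambda>y. v n y + w0' y) \<in> borel_measurable borel"
          unfolding v_def by measurable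
        have 1: "convol (riesz \<alpha>) (\<lambda>y. F (w n y)) x = riesz_conv c (\<lambda>y. F (v n y + w0' y)) x" for x
          by (rule conv[OF H1_measurable[OF assms(8)] vm(2)]) (use w'(2)[of n] in \<open>simp add: v_def\<close>)
        have 2: "convol (riesz \<alpha>) (\<lambda>y. F (w n y - w0 y)) x = riesz_conv c (\<lambda>y. F (v n y)) x" for x
        proof (rule conv[OF _ vm(1)])
          show "(\<lambda>y. w n y - w0 y) \<in> borel_measurable lebesgue"
            by (intro borel_measurable_diff H1_measurable assms)
          show "AE x in lebesgue. w n x - w0 x = v n x"
            using w'(2)[of n] w0'(2) by eventually_elim (simp add: v_def)
        qed
        have 3: "convol (riesz \<alpha>) (\<lambda>y. F (w0 y)) x = riesz_conv c (\<lambda>y. F (w0' y)) x" for x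
          by (rule conv[OF H1_measurable[OF assms(9)] w0'])
        have "ennreal \<bar>I n \<phi>\<bar> \<le> (\<integral>\<^sup>+x. ennreal \<bar>(convol (riesz \<alpha>) (\<lambda>y. F (w n y)) x * f (w n x)
              - convol (riesz \<alpha>) (\<lambda>y. F (w n y - w0 y)) x * f (w n x - w0 x)
              - convol (riesz \<alpha>) (\<lambda>y. F (w0 y)) x * f (w0 x)) * \<phi> x\<bar> \<partial>lebesgue)"
          unfolding I_def by (rule abs_integral_le_nn_integral)
        also have "\<dots> = (\<integral>\<^sup>+x. ennreal \<bar>?E x\<bar> \<partial>lebesgue)"
          unfolding 1 2 3
        proof (rule nn_integral_cong_AE, use w'(2)[of n] w0'(2) \<phi>'(2) in eventually_elim)
          case (elim x)
          have "w n x = v n x + w0' x" "w n x - w0 x = v n x" using elim by (simp_all add: v_def)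
          then show ?case using elim by (simp only:)
        qed
        also have "\<dots> = (\<integral>\<^sup>+x. ennreal \<bar>?E x\<bar> \<partial>lborel)" by (rule nn_integral_completion)
        also have "\<dots> \<le> ennreal (e / (1 + C) * ((1 + C) * H1_norm \<phi>))"
          using elim energy[OF \<phi> \<phi>'] by blast
        also have "e / (1 + C) * ((1 + C) * H1_norm \<phi>) = e * H1_norm \<phi>" using C(1) by simp
        finally show "\<bar>I n \<phi>\<bar> \<le> e * H1_norm \<phi>"
          using e H1_norm_nonneg[of \<phi>] by (simp add: ennreal_le_iff)
      qed
    qed
  qed
  show ?thesis
    using uniform_rate_subsequence[where S = "H1 :: (real ^ 'n \<Rightarrow> real) set" and I = I and h = H1_norm, OF H1_norm_nonneg ev]
    unfolding I_def .
qed

end
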